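(* Let $s\ge 3$ be an integer, let $a,b\in\mathbb{C}\setminus\{0\}$, and let $v(x)=a e^{-2ix}+b e^{2isx}$. Then there is no basis in $L^2([0,\pi],\mathbb{C})$ consisting of root functions of the operator $L_{Per^-}(v)$.
   Context: For a smooth $\pi$-periodic complex-valued potential $v$, $L_{Per^-}(v)$ denotes the Hill operator $Ly=-y''+v(x)y$, $0\le x\le\pi$, acting in $L^2([0,\pi],\mathbb{C})$ on the domain of all $y\in H^2([0,\pi])$ satisfying the antiperiodic boundary conditions $y(\pi)=-y(0)$, $y'(\pi)=-y'(0)$. The spectrum is discrete. Root functions are eigenfunctions and associated functions, i.e. nonzero elements of $\bigcup_{k\ge1}\ker (L-\lambda)^k$ for eigenvalues $\lambda$. "Basis" means a (Schauder) basis of the Hilbert space. *)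

theory Defs
  imports "HOL-Analysis.Analysis"
begin

text \<open>
  Elements of the Hilbert space are represented by functions; all notions below are invariant
  under changing a function on a null set, and equality in the Hilbert space is
  equality almost everywhere.
\<close>

abbreviation I_meas :: "real measure" where
  "I_meas \<equiv> lebesgue_on {0..pi}"

definition L2 :: "(real \<Rightarrow> complex) set" where
  "L2 = {f. f \<in> borel_measurable I_meas \<and> integrable I_meas (\<lambda>x. (norm (f x))\<^sup>2)}"

definition L2_norm :: "(real \<Rightarrow> complex) \<Rightarrow> real" where
  "L2_norm f = sqrt (integral\<^sup>L I_meas (\<lambda>x. (norm (f x))\<^sup>2))"

definition L2_eq :: "(real \<Rightarrow> complex) \<Rightarrow> (real \<Rightarrow> complex) \<Rightarrow> bool" where
  "L2_eq f g \<longleftrightarrow> (AE x in I_meas. f x = g x)"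

definition schauder_basis :: "(nat \<Rightarrow> real \<Rightarrow> complex) \<Rightarrow> bool" where
  "schauder_basis u \<longleftrightarrow>
     (\<forall>n. u n \<in> L2) \<and>
     (\<forall>f\<in>L2. \<exists>!c :: nat \<Rightarrow> complex.
        (\<lambda>N. L2_norm (\<lambda>x. f x - (\<Sum>n<N. c n * u n x))) \<longlonglongrightarrow> 0)"

definition test_function :: "(real \<Rightarrow> complex) \<Rightarrow> bool" where
  "test_function \<phi> \<longleftrightarrow>
     \<phi> C1_differentiable_on UNIV \<and> closure {x. \<phi> x \<noteq> 0} \<subseteq> {0<..<pi}"

text \<open>
  Square-integrable functions with a square-integrable weak derivative form the Sobolev space
  of order one on the interval. Testing against continuously differentiable functions of compact
  support is equivalent to testing against smooth ones.
\<close>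

definition weak_deriv :: "(real \<Rightarrow> complex) \<Rightarrow> (real \<Rightarrow> complex) \<Rightarrow> bool" where
  "weak_deriv f g \<longleftrightarrow> f \<in> L2 \<and> g \<in> L2 \<and>
     (\<forall>\<phi>. test_function \<phi> \<longrightarrow>
        integral\<^sup>L I_meas (\<lambda>x. f x * vector_derivative \<phi> (at x)) =
        - integral\<^sup>L I_meas (\<lambda>x. g x * \<phi> x))"

text \<open>Boundary values of a Sobolev function are those of its continuous representative.\<close>

definition antiperiodic :: "(real \<Rightarrow> complex) \<Rightarrow> bool" where
  "antiperiodic f \<longleftrightarrow>
     (\<exists>F. continuous_on {0..pi} F \<and> L2_eq f F \<and> F pi = - F 0)"

text \<open>
  The graph of \<open>L - \<mu>\<close>, where \<open>L y = - y'' + v y\<close> with antiperiodic boundary conditions: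
  \<open>g\<close> and \<open>h\<close> are the first and second weak derivatives of \<open>y\<close>.
\<close>

definition hill_graph ::
  "(real \<Rightarrow> complex) \<Rightarrow> complex \<Rightarrow> ((real \<Rightarrow> complex) \<times> (real \<Rightarrow> complex)) set" where
  "hill_graph v \<mu> =
     {(y, w). w \<in> L2 \<and>
        (\<exists>g h. weak_deriv y g \<and> weak_deriv g h \<and> antiperiodic y \<and> antiperiodic g \<and>
               L2_eq w (\<lambda>x. - h x + v x * y x - \<mu> * y x))}"

definition hill_ker :: "(real \<Rightarrow> complex) \<Rightarrow> complex \<Rightarrow> nat \<Rightarrow> (real \<Rightarrow> complex) set" where
  "hill_ker v \<mu> k = {y. \<exists>w. (y, w) \<in> hill_graph v \<mu> ^^ k \<and> L2_eq w (\<lambda>x. 0)}"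

definition hill_eigenvalue :: "(real \<Rightarrow> complex) \<Rightarrow> complex \<Rightarrow> bool" where
  "hill_eigenvalue v \<mu> \<longleftrightarrow> (\<exists>y \<in> hill_ker v \<mu> 1. \<not> L2_eq y (\<lambda>x. 0))"

definition root_function :: "(real \<Rightarrow> complex) \<Rightarrow> (real \<Rightarrow> complex) \<Rightarrow> bool" where
  "root_function v y \<longleftrightarrow>
     \<not> L2_eq y (\<lambda>x. 0) \<and>
     (\<exists>\<mu> k. hill_eigenvalue v \<mu> \<and> k \<ge> 1 \<and> y \<in> hill_ker v \<mu> k)"

end

theory Submission
  imports Defs
begin

text \<open>
  With respect to the exponentials \<open>exp (\<i> k x)\<close>, \<open>k\<close> odd, the eigenvalue equation is a recurrence
  whose off-diagonal part consists of steps \<open>-2\<close> with weight \<open>a\<close> and steps \<open>2 s\<close> with weight \<open>b\<close>.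
  Near \<open>\<lambda> = n\<^sup>2\<close> it reduces to a two by two system for the coefficients at \<open>n\<close> and \<open>-n\<close>, whose
  off-diagonal entries are sums over paths from \<open>n\<close> to \<open>-n\<close> and from \<open>-n\<close> to \<open>n\<close>. The former needs at
  least \<open>n\<close> steps, the latter only about \<open>n / s\<close>, so for \<open>n = s q - 1\<close> the first entry is far
  smaller than the second, provided that the leading contributions to the second, which differ by the
  position of one \<open>a\<close>-step, do not cancel; this is where \<open>s \<ge> 3\<close> enters. Hence there are
  infinitely many simple eigenvalues with eigenfunctions \<open>y\<close> for which the integral of \<open>y\<^sup>2\<close> is not
  zero but arbitrarily small compared with that of \<open>\<bar>y\<bar>\<^sup>2\<close>. As \<open>L\<close> is symmetric with respect to
  the bilinear form given by the integral of \<open>f g\<close>, this integral is the denominator of the spectral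
  projection onto \<open>y\<close>, so these projections are unbounded. A lacunary Fourier series then has an
  expansion whose terms do not tend to zero.
\<close>

text \<open>Antiperiodic functions involve odd frequencies, so \<open>n\<close> must be odd. With
  \<open>n = s q - 1\<close> and \<open>q\<close> even this holds for every \<open>s\<close>,
  whereas \<open>n = s q\<close> is even whenever \<open>s\<close> is. The price is one
  \<open>a\<close>-step on each ascending path, hence \<open>q + 1\<close> competing leading paths
  in place of a single one. Their normalized sum decays like the power \<open>- 1 / s\<close> of
  \<open>q\<close>. A lower bound of order \<open>1 / sqrt n\<close> is therefore available, and
  every correction must be shown to be \<open>O(1 / n)\<close>, uniformly for \<open>z\<close> in a
  disc containing the unknown eigenvalue shift. This precision is why \<open>R\<close> is compared
  with its leading path one residue class modulo \<open>s\<close> at a time. The eigenvectors remain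
  coefficient sequences throughout. An absolutely summable sequence acts as a continuous functional
  on L2 through Fourier coefficients; these are bounded, so uniqueness is established among bounded
  sequences. The eigenfunctions themselves are supplied by the supposed basis.\<close>

section \<open>Bounded solutions of the recurrence\<close>

text \<open>With \<open>C\<close> the supremum of the norms, which boundedness makes finite, the
  hypothesis gives \<open>C \<le> max m ((m + C) / 2)\<close> and hence \<open>C \<le> m\<close>.
  This serves as a maximum principle: prescribed entries are at most \<open>m\<close>, and at all
  others the recurrence halves the supremum.\<close>

lemma norm_le_if_self_improving:
  fixes f :: "'i \<Rightarrow> 'b::real_normed_vector"
  assumes "bounded (range f)"
    and half: "\<And>C i. (\<And>j. norm (f j) \<le> C) \<Longrightarrow> norm (f i) \<le> max m ((m + C) / 2)"
  shows "norm (f i) \<le> m"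
proof -
  define C where "C = (SUP j. norm (f j))"
  have bdd: "bdd_above (range (\<lambda>j. norm (f j)))"
    using assms(1) by (auto simp: bounded_iff bdd_above_def)
  have le: "norm (f j) \<le> C" for j
    unfolding C_def by (rule cSUP_upper[OF _ bdd]) auto
  have "C \<le> max m ((m + C) / 2)"
    unfolding C_def by (rule cSUP_least) (use half[OF le] in \<open>auto simp: C_def\<close>)
  then have "C \<le> m"
    by (auto simp: max_def field_simps split: if_splits)
  then show ?thesis
    using le[of i] by linarith
qed

lemma summable_on_inverse_square_int: "(\<lambda>i::int. 1 / (real_of_int i)\<^sup>2) summable_on UNIV"
proof -
  have nat: "(\<lambda>i::nat. 1 / (real i)\<^sup>2) summable_on UNIV"
    using inverse_power_summable[of 2, where ?'a = real]
    by (intro norm_summable_imp_summable_on) (simp add: field_simps)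
  have "(\<lambda>i::int. 1 / (real_of_int i)\<^sup>2) summable_on (range int)"
    by (subst summable_on_reindex) (use nat in \<open>auto simp: o_def\<close>)
  moreover have "(\<lambda>i::int. 1 / (real_of_int i)\<^sup>2) summable_on (range (\<lambda>n. - int n))"
    by (subst summable_on_reindex) (use nat in \<open>auto simp: o_def inj_on_def\<close>)
  ultimately have "(\<lambda>i::int. 1 / (real_of_int i)\<^sup>2) summable_on (range int \<union> range (\<lambda>n. - int n))"
    by (rule summable_on_union)
  moreover have "range int \<union> range (\<lambda>n. - int n) = UNIV"
  proof -
    have "i \<in> range int \<union> range (\<lambda>n. - int n)" for i
      by (cases i rule: int_cases2) auto
    then show ?thesis by auto
  qed
  ultimately show ?thesis by simp
qed

lemma summable_on_shift_int:
  fixes f :: "int \<Rightarrow> 'b::{comm_monoid_add, t2_space}"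
  shows "f summable_on UNIV \<Longrightarrow> (\<lambda>i. f (i + c)) summable_on UNIV"
  using summable_on_reindex_bij_witness[of UNIV "\<lambda>i. i - c" "\<lambda>i. i + c" UNIV f "\<lambda>i. f (i + c)"] by auto

lemma summable_on_reflect_int:
  fixes f :: "int \<Rightarrow> 'b::{comm_monoid_add, t2_space}"
  shows "f summable_on UNIV \<Longrightarrow> (\<lambda>i. f (c - i)) summable_on UNIV"
  using summable_on_reindex_bij_witness[of UNIV "\<lambda>i. c - i" "\<lambda>i. c - i" UNIV f "\<lambda>i. f (c - i)"] by auto

lemma infsum_shift_int:
  fixes f :: "int \<Rightarrow> 'b::{comm_monoid_add, t2_space}"
  shows "infsum (\<lambda>i. f (i + c)) UNIV = infsum f UNIV"
  by (rule infsum_reindex_bij_witness[of _ "\<lambda>i. i - c" "\<lambda>i. i + c"]) auto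

lemma infsum_reflect_int:
  fixes f :: "int \<Rightarrow> 'b::{comm_monoid_add, t2_space}"
  shows "infsum (\<lambda>i. f (c - i)) UNIV = infsum f UNIV"
  by (rule infsum_reindex_bij_witness[of _ "\<lambda>i. c - i" "\<lambda>i. c - i"]) auto

lemma summable_on_bounded_mult:
  fixes u y :: "int \<Rightarrow> complex"
  assumes "bounded (range u)" and "(\<lambda>i. norm (y i)) summable_on UNIV"
  shows "(\<lambda>i. u i * y i) summable_on UNIV" "(\<lambda>i. norm (u i * y i)) summable_on UNIV"
proof -
  obtain C where C: "\<And>i. norm (u i) \<le> C"
    using assms(1) by (auto simp: bounded_iff)
  have "(\<lambda>i. C * norm (y i)) summable_on UNIV"
    using assms(2) by (rule summable_on_cmult_right)
  then show *: "(\<lambda>i. norm (u i * y i)) summable_on UNIV"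
    by (rule Infinite_Sum.abs_summable_on_comparison_test') (auto simp: norm_mult intro: mult_right_mono C)
  from * show "(\<lambda>i. u i * y i) summable_on UNIV"
    by (rule abs_summable_summable)
qed

text \<open>
  With \<open>k = 2 i - n\<close> and \<open>\<lambda> = n\<^sup>2 + z\<close>, the operator \<open>L - \<lambda>\<close> acts on the Fourier coefficients
  with respect to the exponentials \<open>exp (\<i> k x)\<close>, \<open>k\<close> odd, as \<open>T z\<close> below.
\<close>

locale hill_sequence =
  fixes a b :: complex and s n :: int
begin

definition T :: "complex \<Rightarrow> (int \<Rightarrow> complex) \<Rightarrow> int \<Rightarrow> complex" where
  "T z u i = (of_int (4 * i * (i - n)) - z) * u i + a * u (i + 1) + b * u (i - s)"

text \<open>Summability after multiplication by the diagonal entry lets \<open>T z y\<close> be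
  summed against a merely bounded sequence, such as the Fourier coefficients of any function in
  L2.\<close>

definition strongly_summable :: "(int \<Rightarrow> complex) \<Rightarrow> bool" where
  "strongly_summable y \<longleftrightarrow> (\<lambda>i. norm (y i)) summable_on UNIV \<and>
     (\<lambda>i. norm (of_int (4 * i * (i - n)) * y i)) summable_on UNIV"

text \<open>The reflection \<open>i \<mapsto> n - i\<close> fixes the diagonal entry, and an index
  shift moves each of the two steps onto the other factor. This is the symmetry of the operator for
  the bilinear form given by the integral of \<open>f g\<close>, with all the decay demanded of
  \<open>y\<close>.\<close>

lemma T_symmetric:
  assumes u: "bounded (range u)" and y: "strongly_summable y"
  shows "(\<Sum>\<^sub>\<infinity>i. T z u i * y (n - i)) = (\<Sum>\<^sub>\<infinity>i. u i * T z y (n - i))"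
proof -
  define D where "D i = (of_int (4 * i * (i - n)) :: complex)" for i
  have y1: "(\<lambda>i. norm (y i)) summable_on UNIV" and y2: "(\<lambda>i. norm (D i * y i)) summable_on UNIV"
    using y by (auto simp: strongly_summable_def D_def)
  have Dr: "D (n - i) = D i" for i
    by (simp add: D_def algebra_simps)
  have r1: "(\<lambda>i. norm (y (c - i))) summable_on UNIV" for c
    using summable_on_reflect_int[OF y1] .
  have r2: "(\<lambda>i. norm (D i * y (n - i))) summable_on UNIV"
    using summable_on_reflect_int[OF y2, of n] by (simp add: Dr)
  note S = summable_on_bounded_mult(1)[OF u]
  have bu: "bounded (range (\<lambda>i. u (i + c)))" for c
    using u by (auto simp: bounded_iff)
  note [simp del] = mult_minus_left
  have s1: "(\<lambda>i. u i * (D i * y (n - i))) summable_on UNIV"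
    and s2: "(\<lambda>i. - z * (u i * y (n - i))) summable_on UNIV"
    and s3: "(\<lambda>i. a * (u i * y (n - i + 1))) summable_on UNIV"
    and s4: "(\<lambda>i. b * (u i * y (n - i - s))) summable_on UNIV"
    by (rule S[OF r2], rule summable_on_cmult_right[OF S[OF r1[of n]]],
      use summable_on_cmult_right[OF S[OF r1[of "n + 1"]]] in \<open>simp add: algebra_simps\<close>,
      use summable_on_cmult_right[OF S[OF r1[of "n - s"]]] in \<open>simp add: algebra_simps\<close>)
  have s3': "(\<lambda>i. a * (u (i + 1) * y (n - i))) summable_on UNIV"
    using summable_on_bounded_mult(1)[OF bu r1] by (rule summable_on_cmult_right)
  have s4': "(\<lambda>i. b * (u (i - s) * y (n - i))) summable_on UNIV"
    using summable_on_bounded_mult(1)[OF bu[of "- s"] r1] by (auto intro: summable_on_cmult_right)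
  let ?A = "(\<Sum>\<^sub>\<infinity>i. u i * (D i * y (n - i))) + (\<Sum>\<^sub>\<infinity>i. - z * (u i * y (n - i)))"
  have "(\<Sum>\<^sub>\<infinity>i. u i * T z y (n - i)) = (\<Sum>\<^sub>\<infinity>i. u i * (D i * y (n - i)) + - z * (u i * y (n - i))
      + a * (u i * y (n - i + 1)) + b * (u i * y (n - i - s)))"
    by (rule infsum_cong) (simp add: T_def D_def algebra_simps)
  also have "\<dots> = ?A + (\<Sum>\<^sub>\<infinity>i. a * (u i * y (n - i + 1))) + (\<Sum>\<^sub>\<infinity>i. b * (u i * y (n - i - s)))"
    by (simp only: infsum_add s1 s2 s3 s4 summable_on_add)
  also have "(\<Sum>\<^sub>\<infinity>i. a * (u i * y (n - i + 1))) = (\<Sum>\<^sub>\<infinity>i. a * (u (i + 1) * y (n - i)))"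
    using infsum_shift_int[of "\<lambda>i. a * (u i * y (n - i + 1))" 1] by (simp add: algebra_simps)
  also have "(\<Sum>\<^sub>\<infinity>i. b * (u i * y (n - i - s))) = (\<Sum>\<^sub>\<infinity>i. b * (u (i - s) * y (n - i)))"
    using infsum_shift_int[of "\<lambda>i. b * (u i * y (n - i - s))" "-s"] by (simp add: algebra_simps)
  also have "?A + (\<Sum>\<^sub>\<infinity>i. a * (u (i + 1) * y (n - i))) + (\<Sum>\<^sub>\<infinity>i. b * (u (i - s) * y (n - i)))
      = (\<Sum>\<^sub>\<infinity>i. u i * (D i * y (n - i)) + - z * (u i * y (n - i))
      + a * (u (i + 1) * y (n - i)) + b * (u (i - s) * y (n - i)))"
    by (simp only: infsum_add s1 s2 s3' s4' summable_on_add)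
  also have "\<dots> = (\<Sum>\<^sub>\<infinity>i. T z u i * y (n - i))"
    by (rule infsum_cong) (simp add: T_def D_def algebra_simps)
  finally show "(\<Sum>\<^sub>\<infinity>i. T z u i * y (n - i)) = (\<Sum>\<^sub>\<infinity>i. u i * T z y (n - i))" ..
qed

lemma T_diff: "T z (\<lambda>i. u i - c * w i) i = T z u i - c * T z w i"
  by (simp add: T_def algebra_simps)

lemma T_add: "T z (\<lambda>i. u i + c * w i) i = T z u i + c * T z w i"
  by (simp add: T_def algebra_simps)

text \<open>The equation is omitted at \<open>0\<close> and \<open>n\<close>, the zeros of the
  diagonal entry for \<open>z = 0\<close>. Elsewhere that entry dominates the two steps, so a
  bounded solution is determined by its values at these two indices.\<close>

definition sol :: "complex \<Rightarrow> (int \<Rightarrow> complex) \<Rightarrow> bool" where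
  "sol z y \<longleftrightarrow> bounded (range y) \<and> (\<forall>i. i \<noteq> 0 \<longrightarrow> i \<noteq> n \<longrightarrow> T z y i = 0)"

lemma bounded_lincomb:
  fixes u w :: "int \<Rightarrow> complex"
  assumes "bounded (range u)" "bounded (range w)"
  shows "bounded (range (\<lambda>i. u i - c * w i))"
proof -
  obtain A where A: "\<And>i. norm (u i) \<le> A" using assms(1) by (auto simp: bounded_iff)
  obtain B where B: "\<And>i. norm (w i) \<le> B" using assms(2) by (auto simp: bounded_iff)
  have "norm (u i - c * w i) \<le> A + norm c * B" for i
    using norm_triangle_ineq4[of "u i" "c * w i"] A[of i] mult_left_mono[OF B[of i], of "norm c"]
    by (auto simp: norm_mult)
  then show ?thesis by (auto simp: bounded_iff)
qed

lemma sol_diff: "sol z u \<Longrightarrow> sol z w \<Longrightarrow> sol z (\<lambda>i. u i - c * w i)"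
  by (auto simp: sol_def T_diff bounded_lincomb)

end

text \<open>The diagonal entries are at least \<open>2 n\<close> away from \<open>0\<close> and
  \<open>n\<close>, so the bound on \<open>norm a + norm b\<close> makes the off-diagonal part a
  contraction by one half. The bound on its square places the disc in which the eigenvalue shift is
  sought inside the unit disc.\<close>

locale hill_sequence_large = hill_sequence +
  assumes a0: "a \<noteq> 0" and b0: "b \<noteq> 0" and s2: "s \<ge> 2" and n3: "n \<ge> 3" and sn: "s < n"
    and n_large: "norm a + norm b \<le> of_int n" "(norm a + norm b)\<^sup>2 \<le> of_int n"
begin

definition c0 :: real where "c0 = norm a + norm b"

lemma c0: "0 \<le> c0" "c0 \<le> of_int n" "c0\<^sup>2 \<le> of_int n" "norm a \<le> c0" "norm b \<le> c0"
  using n_large by (auto simp: c0_def)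

lemma n_pos: "(0::real) < of_int n" "(3::real) \<le> of_int n"
  using n3 by linarith+

lemma abs_mult_ge:
  assumes "i \<noteq> 0" "i \<noteq> n"
  shows "\<bar>i * (i - n)\<bar> \<ge> n - 1"
proof -
  consider "i < 0" | "0 < i" "i < n" | "i > n" using assms by linarith
  then show ?thesis
  proof cases
    case 1
    then have "1 * (n - i) \<le> (- i) * (n - i)" using n3 by (intro mult_right_mono) auto
    also have "\<dots> = i * (i - n)" by (simp add: algebra_simps)
    finally have "n - i \<le> i * (i - n)" by simp
    moreover have "n - 1 \<le> n - i" using 1 by simp
    ultimately have "n - 1 \<le> i * (i - n)" by (rule order_trans[rotated])
    then show ?thesis by linarith
  next
    case 2
    then have "0 \<le> (i - 1) * (n - i - 1)" by auto
    then have "n - 1 \<le> - (i * (i - n))" by (simp add: algebra_simps)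
    then show ?thesis by linarith
  next
    case 3
    then have "i * 1 \<le> i * (i - n)" using n3 by (intro mult_left_mono) auto
    then show ?thesis using 3 by linarith
  qed
qed

definition D0 :: "int \<Rightarrow> complex" where "D0 i = of_int (4 * i * (i - n))"

lemma norm_D0: "norm (D0 i) = 4 * \<bar>of_int i\<bar> * \<bar>of_int i - of_int n\<bar>"
  unfolding D0_def norm_of_int by (simp add: abs_mult)

lemma norm_D0_ge:
  assumes "i \<noteq> 0" "i \<noteq> n"
  shows "norm (D0 i) \<ge> 4 * of_int n - 4"
proof -
  have "norm (D0 i) = of_int (4 * \<bar>i * (i - n)\<bar>)"
    by (simp add: norm_D0 abs_mult)
  moreover have "4 * \<bar>i * (i - n)\<bar> \<ge> 4 * n - 4"
    using abs_mult_ge[OF assms] by linarith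
  ultimately show ?thesis
    using of_int_le_iff[of "4 * n - 4" "4 * \<bar>i * (i - n)\<bar>", where ?'a = real] by simp
qed

lemma norm_D_ge:
  assumes "i \<noteq> 0" "i \<noteq> n" "norm z \<le> 1"
  shows "norm (D0 i - z) \<ge> 2 * of_int n"
  using norm_D0_ge[OF assms(1,2)] norm_triangle_ineq2[of "D0 i" z] assms(3) n_pos by linarith

lemma norm_D0_ge2:
  assumes "i \<noteq> 0" "i \<noteq> n" shows "norm (D0 i) \<ge> 2 * of_int n"
  using norm_D_ge[OF assms, of 0] by simp

lemma norm_step:
  assumes "norm u \<le> C" "norm w \<le> C"
  shows "norm (a * u + b * w) \<le> c0 * C"
proof -
  have "norm (a * u + b * w) \<le> norm a * norm u + norm b * norm w"
    using norm_triangle_ineq[of "a * u" "b * w"] by (simp add: norm_mult)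
  also have "\<dots> \<le> norm a * C + norm b * C"
    using assms by (intro add_mono mult_left_mono) auto
  finally show ?thesis by (simp add: c0_def algebra_simps)
qed

lemma T_zero_iff: "T z y i = 0 \<longleftrightarrow> (D0 i - z) * y i = - (a * y (i + 1) + b * y (i - s))"
  by (simp add: T_def D0_def algebra_simps add_eq_0_iff2)

lemma norm_step_div:
  assumes "i \<noteq> 0" "i \<noteq> n" "norm z \<le> 1" "T z y i = 0" "norm (y (i + 1)) \<le> C" "norm (y (i - s)) \<le> C"
  shows "norm (y i) \<le> c0 * C / (2 * of_int n)" "norm (y i) \<le> C / 2"
proof -
  have "0 \<le> C" using assms(5) norm_ge_zero order_trans by blast
  have "2 * of_int n * norm (y i) \<le> norm (D0 i - z) * norm (y i)"
    by (intro mult_right_mono norm_D_ge assms) auto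
  also have "\<dots> = norm (a * y (i + 1) + b * y (i - s))"
    using assms(4) unfolding T_zero_iff by (metis norm_minus_cancel norm_mult)
  also have "\<dots> \<le> c0 * C"
    by (intro norm_step assms)
  finally show *: "norm (y i) \<le> c0 * C / (2 * of_int n)"
    using n_pos by (simp add: field_simps)
  have "c0 * C \<le> of_int n * C"
    using c0 \<open>0 \<le> C\<close> by (intro mult_right_mono) auto
  then have "c0 * C / (2 * of_int n) \<le> of_int n * C / (2 * of_int n)"
    using n_pos by (intro divide_right_mono) auto
  moreover have "of_int n * C / (2 * of_int n) = C / 2" using n_pos by simp
  ultimately show "norm (y i) \<le> C / 2"
    using * by linarith
qed

lemma sol_bound:
  assumes "sol z y" "norm z \<le> 1" "norm (y 0) \<le> m" "norm (y n) \<le> m"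
  shows "norm (y i) \<le> m"
proof (rule norm_le_if_self_improving[where f = y])
  show "bounded (range y)" using assms by (auto simp: sol_def)
  have m: "0 \<le> m" using assms(3) norm_ge_zero order_trans by blast
  fix C i assume C: "\<And>j. norm (y j) \<le> C"
  show "norm (y i) \<le> max m ((m + C) / 2)"
  proof (cases "i = 0 \<or> i = n")
    case False
    then have "norm (y i) \<le> C / 2"
      using assms C by (intro norm_step_div[of i z]) (auto simp: sol_def)
    then show ?thesis using m by (simp add: le_max_iff_disj)
  qed (use assms in auto)
qed

lemma sol_bound_off:
  assumes "sol z y" "norm z \<le> 1" "norm (y 0) \<le> m" "norm (y n) \<le> m" "i \<noteq> 0" "i \<noteq> n"
  shows "norm (y i) \<le> c0 * m / (2 * of_int n)"
  using assms sol_bound[OF assms(1-4)] by (intro norm_step_div[of i z]) (auto simp: sol_def)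

lemma sol_eq_0:
  assumes "sol z y" "norm z \<le> 1" "y 0 = 0" "y n = 0"
  shows "y i = 0"
  using sol_bound[OF assms(1,2), of 0] assms by auto

text \<open>The difference vanishes at \<open>0\<close> and \<open>n\<close> and solves the equation
  with source \<open>(z - z') * y'\<close>; the diagonal entry absorbs both the steps and the
  source. Continuity in \<open>z\<close>, required for Brouwer's theorem, follows from this.\<close>

lemma sol_lipschitz:
  assumes "sol z y" "sol z' y'" "norm z \<le> 1" "norm z' \<le> 1" "y 0 = y' 0" "y n = y' n"
    and "\<And>i. norm (y' i) \<le> m"
  shows "norm (y i - y' i) \<le> m * norm (z - z')"
proof (rule norm_le_if_self_improving[where f = "\<lambda>i. y i - y' i"])
  have "bounded (range (\<lambda>i. y i - 1 * y' i))"
    using assms(1,2) by (intro bounded_lincomb) (auto simp: sol_def)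
  then show "bounded (range (\<lambda>i. y i - y' i))" by simp
  have m: "0 \<le> m" using assms(7) norm_ge_zero order_trans by blast
  then have m': "0 \<le> m * norm (z - z')" by simp
  fix C i assume C: "\<And>j. norm (y j - y' j) \<le> C"
  have C0: "0 \<le> C" using C norm_ge_zero order_trans by blast
  show "norm (y i - y' i) \<le> max (m * norm (z - z')) ((m * norm (z - z') + C) / 2)"
  proof (cases "i = 0 \<or> i = n")
    case True
    have "0 \<le> max (m * norm (z - z')) ((m * norm (z - z') + C) / 2)" using m' by simp
    then show ?thesis using True assms by auto
  next
    case False
    have T: "T z y i = 0" "T z' y' i = 0" using assms False by (auto simp: sol_def)
    define d where "d i = y i - y' i" for i
    have "(D0 i - z) * d i = - (a * d (i + 1) + b * d (i - s)) + (z - z') * y' i"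
      using T unfolding T_zero_iff d_def by (simp add: algebra_simps)
    then have "norm (D0 i - z) * norm (d i) \<le> norm (a * d (i + 1) + b * d (i - s)) + norm ((z - z') * y' i)"
      by (metis norm_minus_cancel norm_mult norm_triangle_ineq)
    also have "\<dots> \<le> c0 * C + norm (z - z') * m"
      using C assms(7) by (intro add_mono norm_step) (auto simp: d_def norm_mult intro: mult_left_mono)
    finally have "norm (D0 i - z) * norm (d i) \<le> c0 * C + norm (z - z') * m" .
    moreover have "2 * of_int n * norm (d i) \<le> norm (D0 i - z) * norm (d i)"
      using False by (intro mult_right_mono norm_D_ge assms) auto
    moreover have "c0 * C \<le> of_int n * C" using c0 C0 by (intro mult_right_mono) auto
    moreover have "norm (z - z') * m \<le> of_int n * (norm (z - z') * m)"
      using n_pos m mult_right_mono[of 1 "of_int n" "norm (z - z') * m"] by auto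
    ultimately have "of_int n * (2 * norm (d i)) \<le> of_int n * (C + norm (z - z') * m)"
      by (simp add: algebra_simps)
    then have "2 * norm (d i) \<le> C + norm (z - z') * m"
      using n_pos by (simp only: mult_le_cancel_left_pos)
    then have "norm (d i) \<le> (m * norm (z - z') + C) / 2"
      by (simp add: algebra_simps)
    then show ?thesis unfolding d_def by (simp add: le_max_iff_disj)
  qed
qed

lemma sol_exists:
  assumes "norm z \<le> 1"
  shows "\<exists>y. sol z y \<and> y 0 = \<eta> \<and> y n = \<xi>"
proof -
  \<comment> \<open>A fixed point of \<open>G\<close> is a solution: the prescribed values at
    \<open>0\<close> and \<open>n\<close>, and elsewhere the equation solved for its diagonal term.
    \<open>G\<close> contracts differences by one half in the supremum norm.\<close>
  define G where "G y i = (if i = 0 then \<eta> else if i = n then \<xi>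
    else - (a * y (i + 1) + b * y (i - s)) / (D0 i - z))" for y :: "int \<Rightarrow> complex" and i
  have Gle: "norm (G y i) \<le> max (max (norm \<eta>) (norm \<xi>)) (C / 2)" if "\<And>i. norm (y i) \<le> C" for y C i
  proof -
    have "norm (a * y (i + 1) + b * y (i - s)) / norm (D0 i - z) \<le> C / 2" if "i \<noteq> 0" "i \<noteq> n"
    proof -
      have C: "0 \<le> C" using \<open>\<And>i. norm (y i) \<le> C\<close> norm_ge_zero order_trans by blast
      have "norm (a * y (i + 1) + b * y (i - s)) \<le> c0 * C"
        using \<open>\<And>i. norm (y i) \<le> C\<close> by (intro norm_step)
      also have "\<dots> \<le> of_int n * C" using c0 C by (intro mult_right_mono) auto
      finally have "norm (a * y (i + 1) + b * y (i - s)) / norm (D0 i - z) \<le> (of_int n * C) / (2 * of_int n)"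
        using norm_D_ge[OF that assms] n_pos C by (intro frac_le) auto
      also have "\<dots> = C / 2" using n_pos by simp
      finally show ?thesis .
    qed
    then have "norm (G y i) \<le> C / 2" if "i \<noteq> 0" "i \<noteq> n"
      using that by (simp add: G_def norm_divide norm_minus_cancel del: minus_add_distrib)
    moreover have "norm (G y i) \<le> max (norm \<eta>) (norm \<xi>)" if "i = 0 \<or> i = n"
      using that by (auto simp: G_def)
    ultimately show ?thesis by (cases "i = 0 \<or> i = n") (simp_all add: le_max_iff_disj)
  qed
  have Gd: "norm (G y i - G y' i) \<le> C / 2" if "\<And>i. norm (y i - y' i) \<le> C" for y y' C i
  proof -
    have C: "0 \<le> C" using that norm_ge_zero order_trans by blast
    have "norm (G y i - G y' i) \<le> C / 2" if "i \<noteq> 0" "i \<noteq> n"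
    proof -
      have "G y i - G y' i = - (a * (y (i + 1) - y' (i + 1)) + b * (y (i - s) - y' (i - s))) / (D0 i - z)"
        using that by (simp add: G_def diff_divide_distrib[symmetric] algebra_simps)
      then have "norm (G y i - G y' i) = norm (a * (y (i + 1) - y' (i + 1)) + b * (y (i - s) - y' (i - s))) / norm (D0 i - z)"
        by (simp only: norm_divide norm_minus_cancel)
      also have "\<dots> \<le> (of_int n * C) / (2 * of_int n)"
      proof (rule frac_le)
        have "norm (a * (y (i + 1) - y' (i + 1)) + b * (y (i - s) - y' (i - s))) \<le> c0 * C"
          using \<open>\<And>i. norm (y i - y' i) \<le> C\<close> by (intro norm_step)
        also have "\<dots> \<le> of_int n * C" using c0 C by (intro mult_right_mono) auto
        finally show "norm (a * (y (i + 1) - y' (i + 1)) + b * (y (i - s) - y' (i - s))) \<le> of_int n * C" .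
      qed (use norm_D_ge[OF that assms] n_pos C in auto)
      also have "\<dots> = C / 2" using n_pos by simp
      finally show ?thesis .
    qed
    then show ?thesis using C by (cases "i = 0 \<or> i = n") (auto simp: G_def)
  qed
  define M where "M = max (norm \<eta>) (norm \<xi>)"
  have M0: "0 \<le> M" by (simp add: M_def le_max_iff_disj)
  define Y where "Y k = (G ^^ k) (\<lambda>_. 0)" for k
  have Y: "Y 0 = (\<lambda>_. 0)" "Y (Suc k) = G (Y k)" for k by (simp_all add: Y_def)
  have YM: "norm (Y k i) \<le> M" for k i
  proof (induction k arbitrary: i)
    case (Suc k)
    show ?case
      using Gle[of "Y k" M i, OF Suc.IH] M0 by (simp add: Y M_def max_def split: if_splits)
  qed (simp add: Y M0)
  have Ydiff: "norm (Y (Suc k) i - Y k i) \<le> M * (1/2) ^ k" for k i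
  proof (induction k arbitrary: i)
    case 0
    show ?case using YM[of 1 i] by (simp add: Y)
  next
    case (Suc k)
    show ?case using Gd[OF Suc.IH] by (simp add: Y)
  qed
  \<comment> \<open>Each entry is a telescoping series dominated by a geometric one. Pointwise
    limits suffice, because every entry of \<open>G y\<close> depends on two entries of
    \<open>y\<close>.\<close>
  have "convergent (\<lambda>k. Y k i)" for i
  proof -
    have "summable (\<lambda>k. Y (Suc k) i - Y k i)"
      by (rule summable_comparison_test'[of "\<lambda>k. M * (1/2) ^ k" 0])
        (auto intro!: summable_mult summable_geometric Ydiff)
    then show ?thesis
      unfolding summable_iff_convergent by (simp add: sum_lessThan_telescope[of "\<lambda>k. Y k i"] Y(1))
  qed
  then obtain y where y: "\<And>i. (\<lambda>k. Y k i) \<longlonglongrightarrow> y i"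
    unfolding convergent_def by metis
  have fixed_point: "y i = G y i" for i
  proof (rule LIMSEQ_unique)
    show "(\<lambda>k. Y (Suc k) i) \<longlonglongrightarrow> y i" by (rule LIMSEQ_Suc[OF y])
    have "D0 i - z \<noteq> 0" if "i \<noteq> 0" "i \<noteq> n" using norm_D_ge[OF that assms] n_pos by auto
    then show "(\<lambda>k. Y (Suc k) i) \<longlonglongrightarrow> G y i"
      unfolding Y G_def
      by (cases "i = 0"; cases "i = n")
        (auto intro!: tendsto_divide tendsto_minus tendsto_add tendsto_mult tendsto_const y
          simp del: minus_add_distrib)
  qed
  have "sol z y"
    unfolding sol_def
  proof (intro conjI allI impI)
    have "norm (y i) \<le> M" for i
      by (rule LIMSEQ_le_const2[OF tendsto_norm[OF y]]) (use YM in auto)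
    then show "bounded (range y)"
      by (auto simp: bounded_iff)
    fix i assume i: "i \<noteq> 0" "i \<noteq> n"
    have "D0 i - z \<noteq> 0" using norm_D_ge[OF i assms] n_pos by auto
    then show "T z y i = 0"
      using fixed_point[of i] i unfolding T_zero_iff by (simp add: G_def field_simps)
  qed
  moreover have "y 0 = \<eta>" using fixed_point[of 0] by (simp add: G_def)
  moreover have "y n = \<xi>" using fixed_point[of n] n3 by (simp add: G_def)
  ultimately show ?thesis by blast
qed

text \<open>The equation is used twice: boundedness of \<open>y\<close> bounds
  \<open>D0 i * y i\<close>, so \<open>y i\<close> decays like the inverse square of
  \<open>i\<close> and is summable; then the right-hand side is summable, and with it
  \<open>D0 i * y i\<close>.\<close>

lemma sol_strongly_summable:
  assumes "sol z y" "norm z \<le> 1"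
  shows "strongly_summable y"
proof -
  obtain C where C: "\<And>i. norm (y i) \<le> C" using assms(1) by (auto simp: sol_def bounded_iff)
  have C0: "0 \<le> C" using C norm_ge_zero order_trans by blast
  define E where "E = c0 * C + C"
  have E0: "0 \<le> E" using C0 c0 by (auto simp: E_def)
  have DE: "norm (D0 i) * norm (y i) \<le> E" for i
  proof (cases "i = 0 \<or> i = n")
    case False
    have "D0 i * y i = - (a * y (i + 1) + b * y (i - s)) + z * y i"
      using assms False unfolding sol_def T_zero_iff by (auto simp: algebra_simps)
    then have "norm (D0 i * y i) \<le> norm (a * y (i + 1) + b * y (i - s)) + norm (z * y i)"
      by (metis norm_minus_cancel norm_triangle_ineq)
    also have "norm (a * y (i + 1) + b * y (i - s)) \<le> c0 * C" by (intro norm_step C)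
    also have "norm (z * y i) \<le> 1 * C"
      unfolding norm_mult by (intro mult_mono C assms) auto
    finally show ?thesis by (simp add: E_def norm_mult)
  qed (use E0 in \<open>auto simp: D0_def\<close>)
  \<comment> \<open>The first term covers \<open>\<bar>i\<bar> \<le> 2 * n\<close>; beyond that
    \<open>D0 i\<close> is at least the square of \<open>i\<close>, and \<open>E\<close> takes
    over.\<close>
  define K where "K = 4 * (of_int n)\<^sup>2 * C + E"
  have K: "norm (y i) \<le> K * (1 / (of_int i)\<^sup>2)" if "i \<noteq> 0" for i
  proof (cases "\<bar>i\<bar> \<le> 2 * n")
    case True
    then have "\<bar>real_of_int i\<bar> \<le> 2 * of_int n" by linarith
    then have "(real_of_int i)\<^sup>2 \<le> (2 * of_int n)\<^sup>2" using abs_le_square_iff by fastforce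
    then have "(real_of_int i)\<^sup>2 * norm (y i) \<le> (2 * of_int n)\<^sup>2 * C"
      by (intro mult_mono C) auto
    then have "(real_of_int i)\<^sup>2 * norm (y i) \<le> K" using E0 by (simp add: K_def)
    then show ?thesis using that by (simp add: field_simps)
  next
    case False
    then have "\<bar>i\<bar> \<le> 2 * \<bar>i - n\<bar>" using n3 by arith
    then have "\<bar>real_of_int i\<bar> * \<bar>real_of_int i\<bar> \<le> \<bar>of_int i\<bar> * (4 * \<bar>of_int i - of_int n\<bar>)"
    proof (intro mult_left_mono)
      have "real_of_int \<bar>i\<bar> \<le> real_of_int (2 * \<bar>i - n\<bar>)" using \<open>\<bar>i\<bar> \<le> 2 * \<bar>i - n\<bar>\<close> by (simp only: of_int_le_iff)
      then show "\<bar>real_of_int i\<bar> \<le> 4 * \<bar>of_int i - of_int n\<bar>" by simp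
    qed simp
    then have "(real_of_int i)\<^sup>2 \<le> norm (D0 i)"
      by (simp add: norm_D0 power2_eq_square abs_mult[symmetric])
    then have "(real_of_int i)\<^sup>2 * norm (y i) \<le> norm (D0 i) * norm (y i)"
      by (intro mult_right_mono) auto
    then have "(real_of_int i)\<^sup>2 * norm (y i) \<le> E" using DE[of i] by (rule order_trans)
    also have "E \<le> K" using C0 by (simp add: K_def)
    finally have "(real_of_int i)\<^sup>2 * norm (y i) \<le> K" .
    then show ?thesis using that by (simp add: field_simps)
  qed
  have "(\<lambda>i. norm (y i)) summable_on (UNIV - {0})"
  proof (rule Infinite_Sum.abs_summable_on_comparison_test')
    have "(\<lambda>i. K * (1 / (real_of_int i)\<^sup>2)) summable_on UNIV"
      by (intro summable_on_cmult_right summable_on_inverse_square_int)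
    then show "(\<lambda>i. K * (1 / (real_of_int i)\<^sup>2)) summable_on (UNIV - {0})"
      by (rule summable_on_subset_banach) auto
  qed (use K in auto)
  then have y: "(\<lambda>i. norm (y i)) summable_on UNIV"
    using summable_on_insert_iff[of "\<lambda>i. norm (y i)" 0 "UNIV - {0}"] by (simp add: insert_UNIV)
  have "(\<lambda>i. c0 * (norm (y (i + 1)) + norm (y (i + - s))) + norm (y i)) summable_on UNIV"
    by (intro summable_on_add summable_on_cmult_right summable_on_shift_int[where f = "\<lambda>i. norm (y i)"] y)
  then have "(\<lambda>i. norm (D0 i * y i)) summable_on UNIV"
  proof (rule Infinite_Sum.abs_summable_on_comparison_test')
    fix i
    show "norm (D0 i * y i) \<le> c0 * (norm (y (i + 1)) + norm (y (i + - s))) + norm (y i)"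
    proof (cases "i = 0 \<or> i = n")
      case False
      have "D0 i * y i = - (a * y (i + 1) + b * y (i - s)) + z * y i"
        using assms False unfolding sol_def T_zero_iff by (auto simp: algebra_simps)
      then have "norm (D0 i * y i) \<le> norm (a * y (i + 1) + b * y (i - s)) + norm (z * y i)"
        by (metis norm_minus_cancel norm_triangle_ineq)
      also have "norm (a * y (i + 1) + b * y (i - s)) \<le> c0 * (norm (y (i + 1)) + norm (y (i + - s)))"
        by (intro norm_step) auto
      also have "norm (z * y i) \<le> 1 * norm (y i)"
        unfolding norm_mult by (intro mult_right_mono assms) auto
      finally show ?thesis by simp
    qed (use c0 in \<open>auto simp: D0_def\<close>)
  qed
  then show ?thesis using y by (simp add: strongly_summable_def D0_def)
qed

end

section \<open>Paths from n to 0\<close>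

lemma infsum_single:
  assumes "\<And>i. i \<noteq> j \<Longrightarrow> f i = 0"
  shows "infsum f UNIV = f j"
  using infsum_cong_neutral[of "{j}" UNIV f f] assms by auto

context hill_sequence_large
begin

text \<open>\<open>P z i\<close> is the sum over the paths from \<open>n\<close> to \<open>i\<close>
  that meet neither \<open>0\<close> nor \<open>n\<close> after the start, and \<open>R z i\<close>
  is the same for paths starting at \<open>0\<close>. By \<open>sol_eq_0\<close> the choice is
  unique in the unit disc.\<close>

definition P :: "complex \<Rightarrow> int \<Rightarrow> complex" where
  "P z = (SOME y. sol z y \<and> y 0 = 0 \<and> y n = 1)"

definition R :: "complex \<Rightarrow> int \<Rightarrow> complex" where
  "R z = (SOME y. sol z y \<and> y 0 = 1 \<and> y n = 0)"

lemma P: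
  assumes "norm z \<le> 1"
  shows "sol z (P z)" "P z 0 = 0" "P z n = 1"
  using someI_ex[OF sol_exists[OF assms, of 0 1]] unfolding P_def by blast+

lemma R:
  assumes "norm z \<le> 1"
  shows "sol z (R z)" "R z 0 = 1" "R z n = 0"
  using someI_ex[OF sol_exists[OF assms, of 1 0]] unfolding R_def by blast+

lemma P_le:
  assumes "norm z \<le> 1"
  shows "norm (P z i) \<le> 1" "i \<noteq> 0 \<Longrightarrow> i \<noteq> n \<Longrightarrow> norm (P z i) \<le> c0 / (2 * of_int n)"
  using sol_bound[OF P(1)[OF assms] assms, of 1 i] sol_bound_off[OF P(1)[OF assms] assms, of 1 i] P[OF assms]
  by auto

lemma R_le:
  assumes "norm z \<le> 1"
  shows "norm (R z i) \<le> 1" "i \<noteq> 0 \<Longrightarrow> i \<noteq> n \<Longrightarrow> norm (R z i) \<le> c0 / (2 * of_int n)"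
  using sol_bound[OF R(1)[OF assms] assms, of 1 i] sol_bound_off[OF R(1)[OF assms] assms, of 1 i] R[OF assms]
  by auto

lemma continuous_on_sol:
  assumes "\<And>z. norm z \<le> 1 \<Longrightarrow> sol z (Y z)" "\<And>z. norm z \<le> 1 \<Longrightarrow> Y z 0 = \<eta>"
    "\<And>z. norm z \<le> 1 \<Longrightarrow> Y z n = \<xi>" "\<And>z i. norm z \<le> 1 \<Longrightarrow> norm (Y z i) \<le> 1"
  shows "continuous_on (cball 0 1) (\<lambda>z. Y z i)"
proof (rule continuous_onI)
  fix z :: complex and e :: real assume z: "z \<in> cball 0 1" and "e > 0"
  have "dist (Y w i) (Y z i) \<le> e" if "w \<in> cball 0 1" "dist w z < e" for w
    using sol_lipschitz[of w "Y w" z "Y z" 1 i] assms z that by (auto simp: dist_norm)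
  then show "\<exists>d>0. \<forall>w\<in>cball 0 1. dist w z < d \<longrightarrow> dist (Y w i) (Y z i) \<le> e"
    using \<open>e > 0\<close> by blast
qed

lemma continuous_P: "continuous_on (cball 0 1) (\<lambda>z. P z i)"
  by (rule continuous_on_sol) (auto simp: P P_le)

lemma continuous_R: "continuous_on (cball 0 1) (\<lambda>z. R z i)"
  by (rule continuous_on_sol) (auto simp: R R_le)

text \<open>
  Eliminating all entries except those at \<open>0\<close> and \<open>n\<close> leaves, for \<open>y = \<xi> P + \<eta> R\<close>, the system
  \<open>(z - \<alpha>) \<xi> = bp \<eta>\<close>, \<open>(z - \<alpha>) \<eta> = bm \<xi>\<close>.
\<close>

definition \<alpha> :: "complex \<Rightarrow> complex" where "\<alpha> z = a * P z (n + 1) + b * P z (n - s)"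
definition bm :: "complex \<Rightarrow> complex" where "bm z = a * P z 1 + b * P z (- s)"
definition bp :: "complex \<Rightarrow> complex" where "bp z = a * R z (n + 1) + b * R z (n - s)"

text \<open>The indices next to \<open>0\<close> and \<open>n\<close> are themselves different from
  \<open>0\<close> and \<open>n\<close>, hence the second factor \<open>c0 / (2 * n)\<close>. The
  \<open>2\<close> matters: the diagonal and the off-diagonal contribution together must fit into a
  disc of radius \<open>c0\<^sup>2 / n\<close>.\<close>

lemma coeff_bounds:
  assumes "norm z \<le> 1"
  shows "norm (\<alpha> z) \<le> c0\<^sup>2 / (2 * of_int n)" "norm (bm z) \<le> c0\<^sup>2 / (2 * of_int n)"
    "norm (bp z) \<le> c0\<^sup>2 / (2 * of_int n)"
proof -
  have *: "c0\<^sup>2 / (2 * of_int n) = c0 * (c0 / (2 * of_int n))" by (simp add: power2_eq_square)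
  show "norm (bm z) \<le> c0\<^sup>2 / (2 * of_int n)" "norm (\<alpha> z) \<le> c0\<^sup>2 / (2 * of_int n)"
    "norm (bp z) \<le> c0\<^sup>2 / (2 * of_int n)"
    unfolding * bm_def \<alpha>_def bp_def using s2 n3 sn by (intro norm_step P_le R_le assms; simp)+
qed

lemma continuous_coeff:
  "continuous_on (cball 0 1) \<alpha>" "continuous_on (cball 0 1) bm" "continuous_on (cball 0 1) bp"
  unfolding \<alpha>_def bm_def bp_def by (intro continuous_intros continuous_P continuous_R)+

lemma T_P_R:
  assumes "norm z \<le> 1"
  shows "T z (P z) 0 = bm z" "T z (P z) n = \<alpha> z - z" "T z (R z) n = bp z"
    "T z (R z) 0 = a * R z 1 + b * R z (- s) - z"
  using P[OF assms] R[OF assms] by (simp_all add: T_def bm_def bp_def \<alpha>_def)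

text \<open>Applying \<open>T_symmetric\<close> to \<open>P z\<close> and \<open>R z\<close> leaves
  one nonzero term on each side: the residual of \<open>P z\<close> at \<open>n\<close> and that of
  \<open>R z\<close> at \<open>0\<close>. So the reduced two by two system has equal diagonal
  entries.\<close>

lemma \<alpha>_symmetric:
  assumes "norm z \<le> 1"
  shows "a * R z 1 + b * R z (- s) = \<alpha> z"
proof -
  have "(\<Sum>\<^sub>\<infinity>i. T z (P z) i * R z (n - i)) = T z (P z) n * R z (n - n)"
  proof (rule infsum_single)
    fix i assume "i \<noteq> n"
    then show "T z (P z) i * R z (n - i) = 0"
      using P[OF assms] R[OF assms] by (cases "i = 0") (auto simp: sol_def)
  qed
  moreover have "(\<Sum>\<^sub>\<infinity>i. P z i * T z (R z) (n - i)) = P z n * T z (R z) (n - n)"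
  proof (rule infsum_single)
    fix i assume "i \<noteq> n"
    then show "P z i * T z (R z) (n - i) = 0"
      using P[OF assms] R[OF assms] by (cases "i = 0") (auto simp: sol_def)
  qed
  ultimately have "T z (P z) n * R z 0 = P z n * T z (R z) 0"
    using T_symmetric[of "P z" "R z" z] sol_strongly_summable[OF R(1)] P R assms
    by (simp add: sol_def)
  then show ?thesis
    using P[OF assms] R[OF assms] by (simp add: T_P_R assms)
qed

text \<open>Descending steps have length one, so a path from \<open>n\<close> cannot pass below
  \<open>0\<close> without visiting \<open>0\<close>, where \<open>P z\<close> vanishes. Formally,
  the restriction to the nonpositive indices is closed under both steps and satisfies the maximum
  principle with bound \<open>0\<close>.\<close>

lemma P_nonpos:
  assumes "norm z \<le> 1" "i \<le> 0"
  shows "P z i = 0"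
proof -
  define f where "f i = (if i \<le> 0 then P z i else 0)" for i
  have "norm (f i) \<le> 0"
  proof (rule norm_le_if_self_improving[where f = f])
    show "bounded (range f)"
      using P_le(1)[OF assms(1)] by (auto simp: bounded_iff f_def intro!: exI[of _ 1])
    fix C i assume C: "\<And>j. norm (f j) \<le> C"
    have C0: "0 \<le> C" using C norm_ge_zero order_trans by blast
    show "norm (f i) \<le> max 0 ((0 + C) / 2)"
    proof (cases "i < 0")
      case True
      have "norm (P z (i + 1)) \<le> C" "norm (P z (i - s)) \<le> C"
        using C[of "i + 1"] C[of "i - s"] True s2 by (auto simp: f_def)
      then have "norm (P z i) \<le> C / 2"
        using P(1)[OF assms(1)] True n3 assms by (intro norm_step_div(2)[of i z]) (auto simp: sol_def)
      then show ?thesis using True by (simp add: f_def)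
    next
      case False
      then show ?thesis using P(2)[OF assms(1)] C0 by (cases "i = 0") (auto simp: f_def)
    qed
  qed
  then show ?thesis using assms(2) by (simp add: f_def)
qed

text \<open>The contribution of the path that descends from \<open>n\<close> to \<open>i\<close> in steps of length one.\<close>

definition p :: "complex \<Rightarrow> int \<Rightarrow> complex" where
  "p z i = (\<Prod>l\<in>{i..n - 1}. - a / (D0 l - z))"

lemma p_n: "p z n = 1"
  by (simp add: p_def)

lemma p_rec:
  assumes "i < n"
  shows "p z i = - a / (D0 i - z) * p z (i + 1)"
proof -
  have "{i..n - 1} = insert i {i + 1..n - 1}" using assms by auto
  then show ?thesis by (simp add: p_def)
qed

lemma D_nz: "norm z \<le> 1 \<Longrightarrow> i \<noteq> 0 \<Longrightarrow> i \<noteq> n \<Longrightarrow> D0 i - z \<noteq> 0"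
  using norm_D_ge[of i z] n_pos by auto

lemma p_nonzero: "norm z \<le> 1 \<Longrightarrow> 1 \<le> i \<Longrightarrow> p z i \<noteq> 0"
  using a0 D_nz[of z] by (fastforce simp: p_def)

lemma p_step_le:
  assumes "norm z \<le> 1" "1 \<le> i" "i < n"
  shows "norm (p z i) \<le> c0 / (2 * of_int n) * norm (p z (i + 1))"
proof -
  have "norm (- a / (D0 i - z)) \<le> c0 / (2 * of_int n)"
    using norm_D_ge[of i z] assms c0 n_pos by (auto simp: norm_divide intro!: frac_le)
  then show ?thesis
    unfolding p_rec[OF assms(3)] norm_mult by (intro mult_right_mono) auto
qed

lemma p_mono:
  assumes "norm z \<le> 1" "1 \<le> i" "i \<le> j" "j \<le> n"
  shows "norm (p z i) \<le> norm (p z j)"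
  using assms(3,4)
proof (induction j rule: int_ge_induct)
  case (step k)
  have "norm (p z k) \<le> c0 / (2 * of_int n) * norm (p z (k + 1))"
    using step assms by (intro p_step_le) auto
  also have "\<dots> \<le> 1 * norm (p z (k + 1))"
    using c0 n_pos by (intro mult_right_mono) (auto simp: field_simps)
  finally show ?case using step by auto
qed simp

lemma p_shift_le:
  assumes "norm z \<le> 1" "1 \<le> i" "i < j" "j \<le> n"
  shows "norm (p z i) \<le> c0 / (2 * of_int n) * norm (p z j)"
proof -
  have "norm (p z i) \<le> c0 / (2 * of_int n) * norm (p z (i + 1))"
    using assms by (intro p_step_le) auto
  also have "\<dots> \<le> c0 / (2 * of_int n) * norm (p z j)"
    using assms c0 n_pos by (intro mult_left_mono p_mono) auto
  finally show ?thesis .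
qed

text \<open>A \<open>b\<close>-step on the way down must be undone by \<open>s\<close> further
  \<open>a\<close>-steps, which costs a factor of order \<open>1 / n\<close>. With \<open>M\<close>
  the maximum of the quotient, one index changes it by at most \<open>M / (4 n)\<close>, so all of
  them by \<open>M / 4\<close>; then \<open>M \<le> 1 + M / 4\<close> gives
  \<open>M \<le> 4 / 3\<close> and the deviation \<open>1 / 3\<close>.\<close>

lemma P_asymptotic:
  assumes z: "norm z \<le> 1" and i: "1 \<le> i" "i \<le> n"
  shows "norm (P z i / p z i - 1) \<le> 1 / 3"
proof -
  define x where "x i = P z i / p z i" for i
  define M where "M = Max ((\<lambda>i. norm (x i)) ` {1..n})"
  have xM: "norm (x i) \<le> M" if "1 \<le> i" "i \<le> n" for i
    unfolding M_def using that by (intro Max_ge) auto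
  have M0: "0 \<le> M" using xM[of 1] n3 norm_ge_zero[of "x 1"] by linarith
  have Px: "P z i = p z i * x i" if "1 \<le> i" for i
    using p_nonzero[OF z that] by (simp add: x_def)
  have step: "norm (x i - x (i + 1)) \<le> M / (4 * of_int n)" if i: "1 \<le> i" "i < n" for i
  proof -
    have nz: "D0 i - z \<noteq> 0" "p z i \<noteq> 0" using D_nz[OF z] p_nonzero[OF z] i by auto
    have "(D0 i - z) * P z i = - (a * P z (i + 1) + b * P z (i - s))"
      using P(1)[OF z] i unfolding sol_def T_zero_iff by auto
    then have "(D0 i - z) * (p z i * x i) = - a * (p z (i + 1) * x (i + 1)) - b * P z (i - s)"
      using i by (simp add: Px)
    moreover have "- a * p z (i + 1) = (D0 i - z) * p z i"
      using p_rec[OF i(2)] nz by simp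
    ultimately have "(D0 i - z) * p z i * (x i - x (i + 1)) = - b * P z (i - s)"
      by algebra
    then have "norm (D0 i - z) * norm (p z i) * norm (x i - x (i + 1)) = norm b * norm (P z (i - s))"
      by (metis norm_minus_cancel norm_mult)
    also have "\<dots> \<le> c0 * (c0 / (2 * of_int n) * norm (p z i) * M)"
    proof (intro mult_mono c0)
      show "norm (P z (i - s)) \<le> c0 / (2 * of_int n) * norm (p z i) * M"
      proof (cases "i - s \<le> 0")
        case True
        then show ?thesis using P_nonpos[OF z] M0 c0 n_pos by auto
      next
        case False
        then have "norm (P z (i - s)) = norm (p z (i - s)) * norm (x (i - s))"
          by (simp add: Px norm_mult)
        also have "\<dots> \<le> (c0 / (2 * of_int n) * norm (p z i)) * M"
          using False i s2 M0 c0 n_pos by (intro mult_mono p_shift_le z xM) auto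
        finally show ?thesis .
      qed
    qed (use c0 in auto)
    finally have "(norm (D0 i - z) * norm (x i - x (i + 1))) * norm (p z i) \<le> (c0\<^sup>2 * M / (2 * of_int n)) * norm (p z i)"
      by (simp add: power2_eq_square mult_ac)
    then have "norm (D0 i - z) * norm (x i - x (i + 1)) \<le> c0\<^sup>2 * M / (2 * of_int n)"
      using nz by (subst (asm) mult_le_cancel_right_pos) auto
    also have "\<dots> \<le> of_int n * M / (2 * of_int n)"
      using c0 M0 n_pos by (intro divide_right_mono mult_right_mono) auto
    also have "\<dots> = M / 2" using n_pos by simp
    finally have "norm (D0 i - z) * norm (x i - x (i + 1)) \<le> M / 2" .
    moreover have "2 * of_int n * norm (x i - x (i + 1)) \<le> norm (D0 i - z) * norm (x i - x (i + 1))"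
      using i by (intro mult_right_mono norm_D_ge z) auto
    ultimately show ?thesis using n_pos by (simp add: field_simps)
  qed
  have dist: "norm (x (n - int j) - 1) \<le> real j * (M / (4 * of_int n))" if "int j < n" for j
    using that
  proof (induction j)
    case 0
    then show ?case using P(3)[OF z] by (simp add: x_def p_n)
  next
    case (Suc j)
    have "norm (x (n - int (Suc j)) - 1) \<le> norm (x (n - int (Suc j)) - x (n - int (Suc j) + 1)) + norm (x (n - int j) - 1)"
      using norm_triangle_ineq[of "x (n - int (Suc j)) - x (n - int (Suc j) + 1)" "x (n - int j) - 1"]
      by (simp add: algebra_simps)
    also have "\<dots> \<le> M / (4 * of_int n) + real j * (M / (4 * of_int n))"
      using Suc by (intro add_mono step) auto
    also have "\<dots> = real (Suc j) * (M / (4 * of_int n))"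
      by (simp only: of_nat_Suc distrib_right mult_1_left)
    finally show ?case .
  qed
  have dist': "norm (x i - 1) \<le> M / 4" if "1 \<le> i" "i \<le> n" for i
  proof -
    have "norm (x i - 1) \<le> real (nat (n - i)) * (M / (4 * of_int n))"
      using dist[of "nat (n - i)"] that by simp
    also have "\<dots> \<le> of_int n * (M / (4 * of_int n))"
      using that M0 n_pos by (intro mult_right_mono) auto
    also have "\<dots> = M / 4" using n_pos by simp
    finally show ?thesis .
  qed
  have "M \<le> 1 + M / 4"
    unfolding M_def
  proof (rule Max.boundedI)
    fix t assume "t \<in> (\<lambda>i. norm (x i)) ` {1..n}"
    then obtain i where i: "1 \<le> i" "i \<le> n" "t = norm (x i)" by auto
    then show "t \<le> 1 + Max ((\<lambda>i. norm (x i)) ` {1..n}) / 4"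
      using dist'[OF i(1,2)] norm_triangle_ineq2[of "x i" 1] unfolding M_def by simp
  qed (use n3 in auto)
  then show ?thesis using dist'[OF i] unfolding x_def by linarith
qed

lemma P_bounds:
  assumes "norm z \<le> 1" "1 \<le> i" "i \<le> n"
  shows "norm (P z i) \<le> 4 / 3 * norm (p z i)" "2 / 3 * norm (p z i) \<le> norm (P z i)"
proof -
  have "norm (P z i / p z i) \<le> 4 / 3" "2 / 3 \<le> norm (P z i / p z i)"
    using P_asymptotic[OF assms] norm_triangle_ineq2[of "P z i / p z i" 1]
      norm_triangle_ineq2[of 1 "P z i / p z i"] by (auto simp: norm_minus_commute)
  then show "norm (P z i) \<le> 4 / 3 * norm (p z i)" "2 / 3 * norm (p z i) \<le> norm (P z i)"
    using p_nonzero[OF assms(1,2)] by (auto simp: norm_divide field_simps)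
qed

lemma bm_eq: "norm z \<le> 1 \<Longrightarrow> bm z = a * P z 1"
  using P_nonpos[of z "- s"] s2 by (simp add: bm_def)

lemma bm_nonzero: "norm z \<le> 1 \<Longrightarrow> bm z \<noteq> 0"
  using P_bounds(2)[of z 1] p_nonzero[of z 1] a0 n3 by (auto simp: bm_eq)

text \<open>Since \<open>D0\<close> is invariant under \<open>l \<mapsto> n - l\<close>, the product
  for \<open>n - i\<close> runs over \<open>{1..i}\<close>. Together with \<open>{i..n - 1}\<close>
  this covers every index once and \<open>i\<close> twice.\<close>

lemma p_mult_reflect:
  assumes "1 \<le> i" "i < n"
  shows "p z i * p z (n - i) = p z 1 * (- a / (D0 i - z))"
proof -
  have "p z (n - i) = (\<Prod>l\<in>{1..i}. - a / (D0 l - z))"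
    unfolding p_def
    by (rule prod.reindex_bij_witness[of _ "\<lambda>l. n - l" "\<lambda>l. n - l"]) (auto simp: D0_def algebra_simps)
  also have "{1..i} = insert i {1..i - 1}" using assms by auto
  finally have "p z (n - i) = (- a / (D0 i - z)) * (\<Prod>l\<in>{1..i - 1}. - a / (D0 l - z))" by simp
  moreover have "p z 1 = (\<Prod>l\<in>{1..i - 1}. - a / (D0 l - z)) * p z i"
  proof -
    have "{1..n - 1} = {1..i - 1} \<union> {i..n - 1}" using assms by auto
    then show ?thesis unfolding p_def by (simp add: prod.union_disjoint)
  qed
  ultimately show ?thesis by simp
qed

text \<open>These are the terms of the bilinear form of \<open>P z\<close> with itself. A bound
  proportional to \<open>bm z\<close> is essential: the general estimate of \<open>P z\<close> would
  only give powers of \<open>1 / n\<close>, which need not be small compared with the coefficient at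
  \<open>0\<close> of the eigenvector.\<close>

lemma P_mult_reflect_le:
  assumes z: "norm z \<le> 1" and i: "i \<noteq> 0" "i \<noteq> n"
  shows "norm (P z i * P z (n - i)) \<le> 2 * norm (bm z) / of_int n"
proof (cases "1 \<le> i \<and> i < n")
  case False
  then have "P z i = 0 \<or> P z (n - i) = 0" using P_nonpos[OF z] i by (cases "i \<le> 0") auto
  then show ?thesis using n_pos by auto
next
  case True
  have "norm (P z i * P z (n - i)) \<le> (4 / 3 * norm (p z i)) * (4 / 3 * norm (p z (n - i)))"
    unfolding norm_mult using True by (intro mult_mono P_bounds z) auto
  also have "\<dots> = 16 / 9 * norm (p z i * p z (n - i))" by (simp add: norm_mult)
  also have "p z i * p z (n - i) = p z 1 * (- a / (D0 i - z))" using True by (intro p_mult_reflect) auto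
  also have "16 / 9 * norm (p z 1 * (- a / (D0 i - z))) = 16 / 9 * norm (p z 1) * norm a / norm (D0 i - z)"
    by (simp add: norm_mult norm_divide)
  also have "\<dots> \<le> 16 / 9 * norm (p z 1) * norm a / (2 * of_int n)"
    using norm_D_ge[OF i z] n_pos D_nz[OF z i] by (intro divide_left_mono) auto
  also have "\<dots> \<le> 2 * (norm (P z 1) * norm a) / of_int n"
  proof -
    have "16 / 9 * norm (p z 1) \<le> 4 * norm (P z 1)"
      using P_bounds(2)[OF z, of 1] n3 norm_ge_zero[of "P z 1"] by linarith
    then have "16 / 9 * norm (p z 1) * norm a \<le> 4 * norm (P z 1) * norm a"
      by (intro mult_right_mono) auto
    then show ?thesis using n_pos by (simp add: field_simps)
  qed
  finally show ?thesis using bm_eq[OF z] by (simp add: norm_mult mult.commute)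
qed

end

section \<open>Paths from 0 to n\<close>

text \<open>Only the first factor, \<open>- x\<close>, is negative.\<close>

lemma pochhammer_neg_fraction_less_0:
  fixes x :: real
  assumes "0 < x" "x < 1" "j \<ge> 1"
  shows "pochhammer (- x) j < 0"
  using \<open>j \<ge> 1\<close>
proof (induction j rule: dec_induct)
  case base
  then show ?case using assms by simp
next
  case (step j)
  then have "- x + real j > 0" using assms by linarith
  then show ?case using step by (simp add: pochhammer_Suc mult_neg_pos)
qed

text \<open>The quotient decays like the power \<open>- x\<close> of \<open>q\<close>; comparing its
  square with \<open>1 / (q - 1)\<close> is crude but inductive, since the squared factor of each
  step is at least \<open>(q - 1) / q\<close>. The start \<open>F 2 \<ge> 1\<close> is equivalent to
  \<open>x \<le> 1 / 3\<close>, that is, to \<open>s \<ge> 3\<close> for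
  \<open>x = 1 / s\<close>.\<close>

lemma pochhammer_ratio_lower_bound:
  fixes x :: real
  assumes x: "0 < x" "x \<le> 1 / 3" and "q \<ge> 2"
  defines "F \<equiv> \<lambda>q. pochhammer (- 2 * x) q / pochhammer (- x) q"
  shows "F q > 0 \<and> (F q)\<^sup>2 * (real q - 1) \<ge> 1"
  using \<open>q \<ge> 2\<close>
proof (induction q rule: dec_induct)
  case base
  have "F 2 = 2 * (1 - 2 * x) / (1 - x)"
    using x by (simp add: F_def numeral_2_eq_2 pochhammer_Suc)
  moreover have "2 * (1 - 2 * x) / (1 - x) \<ge> 1" using x by (simp add: field_simps)
  ultimately have "F 2 \<ge> 1" by simp
  then show ?case by (simp add: one_le_power)
next
  case (step q)
  define r where "r = (real q - 2 * x) / (real q - x)"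
  have q: "real q \<ge> 2" using step by simp
  have F: "F (Suc q) = F q * r"
    by (simp add: F_def r_def pochhammer_Suc)
  have r: "r > 0" using q x by (auto simp: r_def)
  have "r\<^sup>2 \<ge> (real q - 1) / real q"
  proof -
    have r_eq: "r = 1 - x / (real q - x)" using q x by (simp add: r_def field_simps)
    have "2 * (x / (real q - x)) \<le> 1 / real q"
    proof -
      have "2 * x * real q \<le> 1 * (real q - x)"
      proof -
        have "2 * x * real q \<le> 2 * (1/3) * real q" using x q by (intro mult_right_mono) auto
        also have "\<dots> \<le> real q - x" using x q by simp
        finally show ?thesis by simp
      qed
      then show ?thesis using q x by (simp add: field_simps)
    qed
    then have "1 - 1 / real q \<le> 1 - 2 * (x / (real q - x))" by simp
    also have "\<dots> \<le> r\<^sup>2" by (simp add: r_eq power2_diff)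
    finally show ?thesis using q by (simp add: field_simps)
  qed
  then have "r\<^sup>2 * real q \<ge> real q - 1" using q by (simp add: field_simps)
  then have "(F q)\<^sup>2 * (real q - 1) \<le> (F q)\<^sup>2 * (r\<^sup>2 * real q)" by (intro mult_left_mono) auto
  then have "1 \<le> (F q)\<^sup>2 * (r\<^sup>2 * real q)" using step.IH by linarith
  then show ?case using step.IH r by (simp add: F power_mult_distrib mult_ac)
qed

locale hill_sequence_q = hill_sequence_large +
  fixes q :: nat
  assumes s3: "s \<ge> 3" and q3: "q \<ge> 3" and n_eq: "n = s * int q - 1"
begin

text \<open>\<open>\<kappa>\<close> is the loss per \<open>a\<close>-step in the bounds on
  \<open>R\<close>, so the class of \<open>- c\<close> modulo \<open>s\<close> carries the power
  \<open>c\<close>. \<open>S\<close> is the largest such \<open>c\<close>; it belongs to the indices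
  \<open>s * j + 1\<close>.\<close>

definition \<kappa> :: real where "\<kappa> = 1 + of_int s * c0"
definition S :: nat where "S = nat (s - 1)"
text \<open>
  Contributions of the paths with \<open>b\<close>-steps only: from \<open>0\<close> to \<open>s j\<close> for \<open>Q\<close>, from \<open>- s - 1\<close> to
  \<open>s j - s - 1\<close> for \<open>G\<close>.
\<close>

definition Q :: "nat \<Rightarrow> complex" where "Q j = (\<Prod>l\<in>{1..j}. - b / D0 (s * int l))"
definition G :: "nat \<Rightarrow> complex" where "G j = (\<Prod>l<j. - b / D0 (s * int l - 1))"

lemma s_real: "real_of_int s \<ge> 3" using s3 by linarith

lemma \<kappa>: "1 \<le> \<kappa>" "of_int s * c0 \<le> \<kappa>" "c0 \<le> \<kappa>"
proof -
  have "1 * c0 \<le> of_int s * c0" using c0 s_real by (intro mult_right_mono) auto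
  then show "c0 \<le> \<kappa>" by (simp add: \<kappa>_def)
qed (use c0 s_real in \<open>auto simp: \<kappa>_def\<close>)

lemma S: "int S = s - 1" using s3 by (simp add: S_def)

lemma \<kappa>_power: "1 \<le> \<kappa> ^ c" "c \<le> d \<Longrightarrow> \<kappa> ^ c \<le> \<kappa> ^ d"
  using \<kappa>(1) by (auto intro: power_increasing)

lemma n_less: "s * int q = n + 1" "int q \<le> n"
proof -
  show "s * int q = n + 1" using n_eq by simp
  have "3 * int q \<le> s * int q" using s3 by (intro mult_right_mono) auto
  then show "int q \<le> n" using n_eq q3 by simp
qed

lemma pos_less:
  assumes "j < q" shows "s * int j \<le> n + 1 - s"
proof -
  have "s * int j \<le> s * (int q - 1)" using assms s3 by (intro mult_left_mono) auto
  then show ?thesis using n_less by (simp add: algebra_simps)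
qed

lemma pos_ge: "j \<ge> 1 \<Longrightarrow> s \<le> s * int j"
  using mult_left_mono[of 1 "int j" s] s3 by simp

lemma D0_nz: "i \<noteq> 0 \<Longrightarrow> i \<noteq> n \<Longrightarrow> D0 i \<noteq> 0"
  by (simp add: D0_def)

lemma pos_neq:
  assumes "1 \<le> j" "j \<le> q" shows "s * int j \<noteq> 0" "s * int j \<noteq> n"
proof -
  show "s * int j \<noteq> 0" using assms s3 by simp
  show "s * int j \<noteq> n"
  proof (cases "j = q")
    case False
    then have "s * int j \<le> n + 1 - s" using assms by (intro pos_less) simp
    then show ?thesis using s3 by linarith
  qed (use n_less(1) in simp)
qed

lemma pos'_neq:
  assumes "j < q" shows "s * int j - 1 \<noteq> 0" "s * int j - 1 \<noteq> n"
proof -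
  show "s * int j - 1 \<noteq> n" using pos_less[OF assms] s3 by linarith
  show "s * int j - 1 \<noteq> 0"
  proof (cases "j = 0")
    case False
    then have "s \<le> s * int j" by (intro pos_ge) simp
    then show ?thesis using s3 by linarith
  qed simp
qed

lemma D0_pos_nz: "1 \<le> j \<Longrightarrow> j \<le> q \<Longrightarrow> D0 (s * int j) \<noteq> 0"
  by (rule D0_nz[OF pos_neq])

lemma D0_pos'_nz: "j < q \<Longrightarrow> D0 (s * int j - 1) \<noteq> 0"
  by (rule D0_nz[OF pos'_neq])

lemma Q_Suc: "Q (Suc j) = - b / D0 (s * int (Suc j)) * Q j"
proof -
  have "{1..Suc j} = insert (Suc j) {1..j}" by auto
  then show ?thesis by (simp add: Q_def)
qed

lemma Q_0: "Q 0 = 1" by (simp add: Q_def)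

lemma Q_nz: "j \<le> q \<Longrightarrow> Q j \<noteq> 0"
  unfolding Q_def using b0 D0_pos_nz by (subst prod_zero_iff) (simp_all add: Ball_def)

lemma D0_Q: "1 \<le> j \<Longrightarrow> j \<le> q \<Longrightarrow> D0 (s * int j) * Q j = - b * Q (j - 1)"
  using D0_pos_nz[of j] Q_Suc[of "j - 1"] by simp

lemma G_Suc: "G (Suc j) = - b / D0 (s * int j - 1) * G j"
  by (simp add: G_def)

lemma G_nz: "j \<le> q \<Longrightarrow> G j \<noteq> 0"
  unfolding G_def using b0 D0_pos'_nz by (subst prod_zero_iff) (simp_all add: Ball_def)

text \<open>Because \<open>n + 1 = s q\<close>, the diagonal entries at \<open>s j - 1\<close> and
  \<open>s (j + 1)\<close> split into factors linear in \<open>j\<close> and shifted by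
  \<open>1 / s\<close> at most. Their quotient is the ratio of consecutive summands of the
  Chu--Vandermonde sum.\<close>

lemma Q_over_G:
  assumes "j \<le> q"
  shows "Q j / G j = of_real (real (q choose j) * pochhammer (- (1 / of_int s)) j
      * pochhammer (- (1 / of_int s)) (q - j) / pochhammer (- (1 / of_int s)) q)"
  using assms
proof (induction j)
  case 0
  have "pochhammer (- (1 / of_int s)) q \<noteq> (0::real)"
    using pochhammer_neg_fraction_less_0[of "1 / of_int s" q] s_real q3 by (auto simp: field_simps)
  then show ?case by (simp add: Q_def G_def)
next
  case (Suc j)
  define x :: real where "x = 1 / of_int s"
  have x: "0 < x" "x < 1" using s_real by (auto simp: x_def)
  have sx: "real_of_int s * x = 1" using s_real by (simp add: x_def)
  have jq: "j < q" using Suc by simp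
  have nr: "real_of_int n = of_int s * real q - 1"
    using n_eq by simp
  have "Q (Suc j) / G (Suc j) = (D0 (s * int j - 1) / D0 (s * int (Suc j))) * (Q j / G j)"
    using b0 by (simp add: Q_Suc G_Suc)
  also have "D0 (s * int j - 1) / D0 (s * int (Suc j))
     = of_real ((real q - real j) * (real j - x) / ((real j + 1) * (real q - real j - 1 - x)))"
  proof -
    have 1: "D0 (s * int j - 1) = of_real (4 * of_int s * of_int s * (real j - x) * (real j - real q))"
    proof -
      have "D0 (s * int j - 1) = of_real (4 * (of_int s * real j - 1) * (of_int s * real j - 1 - of_int n))"
        by (simp add: D0_def)
      also have "4 * (of_int s * real j - 1) * (of_int s * real j - 1 - of_int n)
          = 4 * of_int s * of_int s * (real j - x) * (real j - real q)"
        using sx unfolding nr by algebra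
      finally show ?thesis .
    qed
    have 2: "D0 (s * int (Suc j)) = of_real (4 * of_int s * of_int s * (real j + 1) * (real j + 1 - real q + x))"
    proof -
      have "D0 (s * int (Suc j)) = of_real (4 * (of_int s * (real j + 1)) * (of_int s * (real j + 1) - of_int n))"
        by (simp add: D0_def algebra_simps)
      also have "4 * (of_int s * (real j + 1)) * (of_int s * (real j + 1) - of_int n)
          = 4 * of_int s * of_int s * (real j + 1) * (real j + 1 - real q + x)"
        using sx unfolding nr by algebra
      finally show ?thesis .
    qed
    have nz: "real q - real j - 1 - x \<noteq> 0"
    proof (cases "Suc j = q")
      case False
      then have "real q - real j - 1 \<ge> 1" using jq by linarith
      then show ?thesis using x by linarith
    qed (use x in auto)
    have "4 * of_int s * of_int s * (real j - x) * (real j - real q) /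
        (4 * of_int s * of_int s * (real j + 1) * (real j + 1 - real q + x))
      = (real q - real j) * (real j - x) / ((real j + 1) * (real q - real j - 1 - x))"
    proof -
      define u v w t where "u = real q - real j" and "v = real j - x"
        and "w = real q - real j - 1 - x" and "t = real j + 1"
      have e: "real j - real q = - u" "real j + 1 - real q + x = - w"
        by (simp_all add: u_def w_def)
      show ?thesis
        unfolding e w_def[symmetric] unfolding u_def[symmetric] v_def[symmetric] t_def[symmetric]
        using s_real by (simp add: mult.commute)
    qed
    then show ?thesis by (simp only: 1 2 of_real_divide[symmetric])
  qed
  also have "Q j / G j = of_real (real (q choose j) * pochhammer (- x) j
      * pochhammer (- x) (q - j) / pochhammer (- x) q)"
    using Suc by (simp add: x_def)
  also have "of_real ((real q - real j) * (real j - x) / ((real j + 1) * (real q - real j - 1 - x))) *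
     (of_real (real (q choose j) * pochhammer (- x) j * pochhammer (- x) (q - j) / pochhammer (- x) q) :: complex)
     = of_real (real (q choose Suc j) * pochhammer (- x) (Suc j) * pochhammer (- x) (q - Suc j) / pochhammer (- x) q)"
  proof -
    have c: "real (q choose Suc j) * (real j + 1) = real (q choose j) * (real q - real j)"
    proof -
      have "(q choose j) * (q - j) = (q choose Suc j) * Suc j"
        using binomial_absorb_comp[of q j] times_binomial_minus1_eq[of "Suc j" q]
        by (simp add: mult.commute)
      then have "real ((q choose j) * (q - j)) = real ((q choose Suc j) * Suc j)" by simp
      then show ?thesis using jq by (simp add: of_nat_diff algebra_simps)
    qed
    have qj: "q - j = Suc (q - Suc j)" using jq by simp
    have p1: "pochhammer (- x) (q - j) = pochhammer (- x) (q - Suc j) * (real q - real j - 1 - x)"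
      unfolding qj pochhammer_Suc using jq by (simp add: of_nat_diff algebra_simps)
    have nz: "real q - real j - 1 - x \<noteq> 0"
    proof (cases "Suc j = q")
      case False
      then have "real q - real j - 1 \<ge> 1" using jq by linarith
      then show ?thesis using x by linarith
    qed (use x in auto)
    have "(real q - real j) * (real j - x) / ((real j + 1) * (real q - real j - 1 - x)) *
     (real (q choose j) * pochhammer (- x) j * pochhammer (- x) (q - j) / pochhammer (- x) q)
     = ((real (q choose j) * (real q - real j)) / (real j + 1)) * (pochhammer (- x) j * (real j - x))
        * pochhammer (- x) (q - Suc j) / pochhammer (- x) q"
      unfolding p1 using nz by simp
    also have "(real (q choose j) * (real q - real j)) / (real j + 1) = real (q choose Suc j)"
      unfolding c[symmetric] by simp
    also have "pochhammer (- x) j * (real j - x) = pochhammer (- x) (Suc j)"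
      by (simp add: pochhammer_Suc)
    finally show ?thesis by (simp only: of_real_mult[symmetric])
  qed
  finally show ?case by (simp only: x_def)
qed

text \<open>Relative to the common factor \<open>G q\<close>, this is the weight of the leading path
  whose \<open>a\<close>-step follows \<open>j\<close> \<open>b\<close>-steps. The powers of
  \<open>b\<close> in \<open>Q j\<close> and \<open>G j\<close> cancel, so it is real.\<close>

definition \<tau> :: "nat \<Rightarrow> real" where
  "\<tau> j = real (q choose j) * pochhammer (- (1 / of_int s)) j
      * pochhammer (- (1 / of_int s)) (q - j) / pochhammer (- (1 / of_int s)) q"

lemma Q_eq: "j \<le> q \<Longrightarrow> Q j = of_real (\<tau> j) * G j"
  using Q_over_G[of j] G_nz[of j] by (simp add: \<tau>_def field_simps)

text \<open>
  By the Chu--Vandermonde identity the sum is \<open>(- 2 / s)\<^sub>q / (- 1 / s)\<^sub>q\<close>; it would vanish for \<open>s = 2\<close>.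
\<close>

lemma sum_\<tau>: "(\<Sum>j\<le>q. \<tau> j) \<ge> 1 / sqrt (real q)" "(\<Sum>j\<le>q. \<bar>\<tau> j\<bar>) \<le> 4"
proof -
  define x :: real where "x = 1 / of_int s"
  have x: "0 < x" "x \<le> 1 / 3" "x < 1" using s_real by (auto simp: x_def field_simps)
  define F where "F = pochhammer (- 2 * x) q / pochhammer (- x) q"
  have \<tau>: "\<tau> j = real (q choose j) * pochhammer (- x) j * pochhammer (- x) (q - j) / pochhammer (- x) q" for j
    by (simp add: \<tau>_def x_def)
  have sum: "(\<Sum>j\<le>q. \<tau> j) = F"
    unfolding \<tau> F_def sum_divide_distrib[symmetric]
    using pochhammer_binomial_sum[of "- x" "- x" q] by simp
  have F: "F > 0" "F\<^sup>2 * (real q - 1) \<ge> 1"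
    using pochhammer_ratio_lower_bound[OF x(1,2), of q] q3 by (auto simp: F_def)
  have "1 \<le> F\<^sup>2 * real q"
    using F(2) zero_le_power2[of F] unfolding right_diff_distrib by linarith
  then have "1 \<le> sqrt (F\<^sup>2 * real q)" by simp
  also have "\<dots> = F * sqrt (real q)" using F by (simp add: real_sqrt_mult)
  finally show "(\<Sum>j\<le>q. \<tau> j) \<ge> 1 / sqrt (real q)"
    unfolding sum using q3 by (simp add: field_simps)
  have neg: "pochhammer (- x) j < 0" if "j \<ge> 1" for j
    using pochhammer_neg_fraction_less_0[OF x(1,3) that] .
  have \<tau>_neg: "\<tau> j \<le> 0" if "1 \<le> j" "j < q" for j
  proof -
    have "0 < pochhammer (- x) j * pochhammer (- x) (q - j)"
      using neg[of j] neg[of "q - j"] that by (intro mult_neg_neg) auto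
    then have "0 \<le> real (q choose j) * (pochhammer (- x) j * pochhammer (- x) (q - j))"
      by (intro mult_nonneg_nonneg[OF of_nat_0_le_iff less_imp_le])
    then show ?thesis unfolding \<tau> using neg[of q] that by (simp add: divide_nonneg_neg mult.assoc)
  qed
  have ends: "\<tau> 0 = 1" "\<tau> q = 1" using neg[of q] q3 by (auto simp: \<tau>)
  have split: "{..q} = insert 0 (insert q {1..<q})" using q3 by auto
  \<comment> \<open>Both end terms are \<open>1\<close> and all inner terms are at most
    \<open>0\<close>, so the absolute values add up to \<open>4\<close> minus the sum
    itself.\<close>
  have "(\<Sum>j\<le>q. \<bar>\<tau> j\<bar>) = 2 + (\<Sum>j\<in>{1..<q}. \<bar>\<tau> j\<bar>)"
    unfolding split using q3 ends by simp
  also have "(\<Sum>j\<in>{1..<q}. \<bar>\<tau> j\<bar>) = (\<Sum>j\<in>{1..<q}. - \<tau> j)"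
    using \<tau>_neg by (intro sum.cong) auto
  also have "\<dots> = 2 - (\<Sum>j\<le>q. \<tau> j)"
    unfolding split using q3 ends by (simp add: sum_negf)
  finally show "(\<Sum>j\<le>q. \<bar>\<tau> j\<bar>) \<le> 4" using F sum by simp
qed

section \<open>Growth of \<open>R z\<close> along the ascending paths\<close>

context
  fixes z :: complex
  assumes z: "norm z \<le> c0\<^sup>2 / of_int n"
begin

text \<open>An a priori constant: all bounds on \<open>R z\<close> are first stated in terms of
  \<open>M\<close> and then lead back to \<open>M \<le> 2\<close>.\<close>

definition M :: real where "M = Max ((\<lambda>j. norm (R z (s * int j) / Q j)) ` {..<q})"

lemma z1: "norm z \<le> 1"
proof -
  have "c0\<^sup>2 / of_int n \<le> 1" using c0 n_pos by simp
  then show ?thesis using z by linarith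
qed

lemma R_pos_le: "j < q \<Longrightarrow> norm (R z (s * int j)) \<le> M * norm (Q j)"
proof -
  assume "j < q"
  then have "norm (R z (s * int j) / Q j) \<le> M" unfolding M_def by (intro Max_ge) auto
  then show ?thesis using Q_nz[of j] \<open>j < q\<close> by (simp add: norm_divide field_simps)
qed

lemma M1: "1 \<le> M"
  using R_pos_le[of 0] q3 R[OF z1] by (simp add: Q_0)

lemma R_eq:
  assumes "i \<noteq> 0" "i \<noteq> n"
  shows "(D0 i - z) * R z i = - (a * R z (i + 1) + b * R z (i - s))"
  using R(1)[OF z1] assms unfolding sol_def T_zero_iff by auto

lemma norm_R_eq_le:
  assumes "i \<noteq> 0" "i \<noteq> n"
  shows "norm (D0 i - z) * norm (R z i) \<le> norm a * norm (R z (i + 1)) + norm b * norm (R z (i - s))"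
  unfolding norm_mult[symmetric] R_eq[OF assms] norm_minus_cancel by (rule norm_triangle_ineq)

text \<open>Moving from \<open>s j\<close> down by \<open>c\<close> lowers the factor
  \<open>i\<close> of the diagonal entry and enlarges the factor \<open>n - i\<close>, so the entry
  shrinks at most in the ratio of the first factors. The gain in the second factor is at least
  \<open>4\<close> in total and pays for \<open>z\<close>.\<close>

lemma D0_quotient_le:
  assumes j: "1 \<le> j" "j < q" and c: "1 \<le> c" "int c < s"
  shows "norm (D0 (s * int j)) * (of_int s * real j - real c) \<le> of_int s * real j * norm (D0 (s * int j - int c) - z)"
proof -
  define u where "u = of_int s * real j"
  define N where "N = real_of_int n"
  have "of_int s * (real j + 1) \<le> of_int s * real q"
    using j s_real by (intro mult_left_mono) auto
  moreover have "N = of_int s * real q - 1"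
    using n_eq by (simp add: N_def)
  ultimately have Nu: "0 \<le> N - u" using s_real by (simp add: algebra_simps u_def)
  have "of_int s * 1 \<le> of_int s * real j" using j s_real by (intro mult_left_mono) auto
  moreover have "real c + 1 \<le> of_int s" using c by linarith
  ultimately have uc: "1 \<le> u - real c" unfolding u_def by linarith
  have c1: "1 \<le> real c" using c by simp
  have 1: "norm (D0 (s * int j)) = 4 * u * (N - u)"
    using Nu uc c1 by (simp add: norm_D0 u_def[symmetric] N_def[symmetric])
  have "norm (D0 (s * int j - int c)) = 4 * (u - real c) * (N - u + real c)"
    using Nu uc c1 by (simp add: norm_D0 u_def[symmetric] N_def[symmetric])
  then have 2: "norm (D0 (s * int j - int c) - z) \<ge> 4 * (u - real c) * (N - u + real c) - 1"
    using norm_triangle_ineq2[of "D0 (s * int j - int c)" z] z1 by linarith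
  have "1 * 1 \<le> (u - real c) * real c" using uc c1 by (intro mult_mono) auto
  then have "(u - real c) * (4 * (N - u)) \<le> 4 * (u - real c) * (N - u + real c) - 1"
    by (simp add: algebra_simps)
  also have "\<dots> \<le> norm (D0 (s * int j - int c) - z)" by (rule 2)
  finally have "u * ((u - real c) * (4 * (N - u))) \<le> u * norm (D0 (s * int j - int c) - z)"
    using uc c1 by (intro mult_left_mono) auto
  then show ?thesis unfolding 1 u_def[symmetric] by (simp add: mult_ac)
qed

text \<open>
  On the residue class of \<open>- c\<close> modulo \<open>s\<close> the solution grows at most like \<open>j Q j\<close>; as \<open>c < s\<close>, the
  quotient of consecutive bounds leaves room for the \<open>a\<close>-steps coming from the previous class.
\<close>

lemma R_chain_le:
  assumes "int c < s" "1 \<le> j" "j < q"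
  shows "norm (R z (s * int j - int c)) \<le> \<kappa> ^ c * M * norm (Q j)"
    and "1 \<le> c \<Longrightarrow> norm (R z (s * int j - int c)) \<le> \<kappa> ^ c * M * (real j / of_int n) * norm (Q j)"
proof -
  have weak: "norm (R z (s * int j - int c)) \<le> \<kappa> ^ c * M * norm (Q j)"
    if "norm (R z (s * int j - int c)) \<le> \<kappa> ^ c * M * (real j / of_int n) * norm (Q j)" "j < q" for j c
  proof -
    have "int j \<le> n" using that(2) n_less by simp
    then have "real_of_int (int j) \<le> of_int n" by (simp only: of_int_le_iff)
    then have "real j / of_int n \<le> 1" using n_pos by simp
    then have "\<kappa> ^ c * M * (real j / of_int n) * norm (Q j) \<le> \<kappa> ^ c * M * 1 * norm (Q j)"
      using M1 \<kappa>_power[of c] by (intro mult_right_mono mult_left_mono) auto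
    then show ?thesis using that by simp
  qed
  \<comment> \<open>The class of \<open>- Suc c\<close> is fed by the previous class through
    \<open>a\<close>-steps and by itself through \<open>b\<close>-steps; hence the induction on
    \<open>j\<close> with the class held fixed.\<close>
  have main: "norm (R z (s * int j - int (Suc c))) \<le> \<kappa> ^ Suc c * M * (real j / of_int n) * norm (Q j)"
    if c: "int (Suc c) < s" and IH: "\<And>j. 1 \<le> j \<Longrightarrow> j < q \<Longrightarrow> norm (R z (s * int j - int c)) \<le> \<kappa> ^ c * M * norm (Q j)"
      and j: "1 \<le> j" "j < q" for c j
    using j
  proof (induction j rule: dec_induct)
    case base
    \<comment> \<open>For \<open>j = 1\<close> the \<open>b\<close>-step starts at the negative
      index \<open>- Suc c\<close>. Only the general bound \<open>c0 / (2 * n)\<close> is available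
      there, and it already has the required factor \<open>1 / n\<close>.\<close>
    define i where "i = s * int 1 - int (Suc c)"
    define d where "d = norm (D0 i - z)"
    have i: "i \<noteq> 0" "i \<noteq> n" "- int (Suc c) \<noteq> 0" "- int (Suc c) \<noteq> n"
      using c sn n3 by (auto simp: i_def)
    have d: "2 * of_int n \<le> d" unfolding d_def using i z1 by (intro norm_D_ge) auto
    have "norm (D0 (s * int 1)) * (of_int s * real 1 - real (Suc c)) \<le> of_int s * real 1 * d"
      unfolding d_def i_def using c q3 by (intro D0_quotient_le) auto
    moreover have "1 \<le> of_int s - real (Suc c)" using c by linarith
    then have "norm (D0 (s * int 1)) * 1 \<le> norm (D0 (s * int 1)) * (of_int s * real 1 - real (Suc c))"
      by (intro mult_left_mono) auto
    ultimately have D: "norm (D0 (s * int 1)) \<le> of_int s * d" by simp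
    have b: "norm b = norm (D0 (s * int 1)) * norm (Q 1)"
      using D0_Q[of 1] q3 by (simp add: Q_0 flip: norm_mult)
    have "d * norm (R z i) \<le> norm a * norm (R z (i + 1)) + norm b * norm (R z (i - s))"
      unfolding d_def using i by (intro norm_R_eq_le)
    also have "\<dots> \<le> c0 * (\<kappa> ^ c * M * norm (Q 1)) + (of_int s * d * norm (Q 1)) * (c0 / (2 * of_int n))"
    proof (intro add_mono mult_mono)
      show "norm (R z (i + 1)) \<le> \<kappa> ^ c * M * norm (Q 1)"
        using IH[of 1] q3 by (simp add: i_def)
      show "norm b \<le> of_int s * d * norm (Q 1)"
        unfolding b using D by (intro mult_right_mono) auto
      show "norm (R z (i - s)) \<le> c0 / (2 * of_int n)"
        using R_le(2)[OF z1 i(3,4)] by (simp add: i_def algebra_simps)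
    qed (use c0 s_real d n_pos in auto)
    also have "\<dots> \<le> (\<kappa> ^ Suc c * M) * norm (Q 1) + (d * norm (Q 1)) * ((\<kappa> ^ Suc c * M) / (2 * of_int n))"
    proof (intro add_mono)
      have "c0 * \<kappa> ^ c * (M * norm (Q 1)) \<le> \<kappa> * \<kappa> ^ c * (M * norm (Q 1))"
        using \<kappa> M1 by (intro mult_right_mono) auto
      then show "c0 * (\<kappa> ^ c * M * norm (Q 1)) \<le> (\<kappa> ^ Suc c * M) * norm (Q 1)" by (simp add: mult_ac)
      have "\<kappa> \<le> \<kappa> ^ Suc c" by (rule \<kappa>_power(2)[of 1 "Suc c", unfolded power_one_right]) simp
      then have "of_int s * c0 \<le> \<kappa> ^ Suc c" by (rule order_trans[OF \<kappa>(2)])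
      also have "\<kappa> ^ Suc c = \<kappa> ^ Suc c * 1" by simp
      also have "\<dots> \<le> \<kappa> ^ Suc c * M" using \<kappa>_power[of "Suc c"] M1 by (intro mult_left_mono) auto
      finally have "(d * norm (Q 1)) * ((of_int s * c0) / (2 * of_int n)) \<le> (d * norm (Q 1)) * ((\<kappa> ^ Suc c * M) / (2 * of_int n))"
        using d n_pos by (intro mult_left_mono divide_right_mono) auto
      then show "(of_int s * d * norm (Q 1)) * (c0 / (2 * of_int n)) \<le> (d * norm (Q 1)) * ((\<kappa> ^ Suc c * M) / (2 * of_int n))"
        by (simp add: mult_ac)
    qed
    also have "\<dots> \<le> (d / (2 * of_int n)) * ((\<kappa> ^ Suc c * M) * norm (Q 1)) + (d * norm (Q 1)) * ((\<kappa> ^ Suc c * M) / (2 * of_int n))"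
    proof (rule add_right_mono)
      show "(\<kappa> ^ Suc c * M) * norm (Q 1) \<le> (d / (2 * of_int n)) * ((\<kappa> ^ Suc c * M) * norm (Q 1))"
        using d n_pos M1 \<kappa>_power(1)[of "Suc c"]
          mult_right_mono[of 1 "d / (2 * of_int n)" "(\<kappa> ^ Suc c * M) * norm (Q 1)"] by simp
    qed
    also have "(d / (2 * of_int n)) * ((\<kappa> ^ Suc c * M) * norm (Q 1)) + (d * norm (Q 1)) * ((\<kappa> ^ Suc c * M) / (2 * of_int n))
        = d * (\<kappa> ^ Suc c * M * (real 1 / of_int n) * norm (Q 1))"
      using n_pos by (simp add: field_simps)
    finally show ?case
      unfolding i_def[symmetric] using d n_pos by (subst (asm) mult_le_cancel_left_pos) auto
  next
    case (step j)
    define i where "i = s * int (Suc j) - int (Suc c)"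
    define d where "d = norm (D0 i - z)"
    define K where "K = \<kappa> ^ Suc c * M * norm (Q (Suc j))"
    have K0: "0 \<le> K" using \<kappa>_power[of "Suc c"] M1 by (simp add: K_def)
    have "s * int (Suc j) \<le> n + 1 - s" using step by (intro pos_less) auto
    moreover have "s \<le> s * int (Suc j)" by (intro pos_ge) auto
    ultimately have i: "i \<noteq> 0" "i \<noteq> n" using c s3 unfolding i_def by linarith+
    have d: "2 * of_int n \<le> d" unfolding d_def using i z1 by (intro norm_D_ge) auto
    define u where "u = of_int s * real (Suc j) - real (Suc c)"
    have Du: "norm (D0 (s * int (Suc j))) * u \<le> of_int s * real (Suc j) * d"
      unfolding d_def i_def u_def using c step by (intro D0_quotient_le) auto
    have sc: "1 \<le> of_int s - real (Suc c)" using c by linarith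
    have "of_int s * 1 \<le> of_int s * real (Suc j)" using s_real by (intro mult_left_mono) auto
    then have u1: "1 \<le> u" using sc unfolding u_def by linarith
    \<comment> \<open>The deficit \<open>1 / s\<close> exists because \<open>Suc c < s\<close>. The
      \<open>a\<close>-step consumes \<open>1 / (2 * s)\<close> of it in the same unit, so the sum
      stays below \<open>real (Suc j)\<close>.\<close>
    have D: "norm (D0 (s * int (Suc j))) * real j \<le> d * (real (Suc j) - 1 / of_int s)"
    proof -
      have "real j * (of_int s * real (Suc j)) \<le> (real (Suc j) - 1 / of_int s) * u"
      proof -
        have "0 \<le> (of_int s - real (Suc c) - 1) * real (Suc j) + real (Suc c) / of_int s"
          using sc s_real by (intro add_nonneg_nonneg mult_nonneg_nonneg divide_nonneg_nonneg) linarith+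
        also have "\<dots> = (real (Suc j) - 1 / of_int s) * u - real j * (of_int s * real (Suc j))"
          using s_real by (simp add: u_def field_simps)
        finally show ?thesis by simp
      qed
      then have "d * (real j * (of_int s * real (Suc j))) \<le> d * ((real (Suc j) - 1 / of_int s) * u)"
        using d n_pos by (intro mult_left_mono) auto
      moreover have "(norm (D0 (s * int (Suc j))) * real j) * u \<le> d * (real j * (of_int s * real (Suc j)))"
        using mult_left_mono[OF Du, of "real j"] by (simp add: mult_ac)
      ultimately have "(norm (D0 (s * int (Suc j))) * real j) * u \<le> (d * (real (Suc j) - 1 / of_int s)) * u"
        by (simp add: mult_ac)
      then show ?thesis using u1 by (subst (asm) mult_le_cancel_right_pos) auto
    qed
    have b: "norm b * norm (Q j) = norm (D0 (s * int (Suc j))) * norm (Q (Suc j))"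
      using D0_Q[of "Suc j"] step(4) by (simp flip: norm_mult)
    have "d * norm (R z i) \<le> norm a * norm (R z (i + 1)) + norm b * norm (R z (i - s))"
      unfolding d_def using i by (intro norm_R_eq_le)
    also have "\<dots> \<le> c0 * (\<kappa> ^ c * M * norm (Q (Suc j))) + norm b * (\<kappa> ^ Suc c * M * (real j / of_int n) * norm (Q j))"
    proof (intro add_mono mult_mono)
      show "norm (R z (i + 1)) \<le> \<kappa> ^ c * M * norm (Q (Suc j))"
        using IH[of "Suc j"] step by (simp add: i_def algebra_simps)
      show "norm (R z (i - s)) \<le> \<kappa> ^ Suc c * M * (real j / of_int n) * norm (Q j)"
        using step by (simp add: i_def algebra_simps)
    qed (use c0 in auto)
    also have "\<dots> \<le> d / (2 * of_int n) * (K / of_int s) + (d * (real (Suc j) - 1 / of_int s)) * (K / of_int n)"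
    proof (intro add_mono)
      have "(of_int s * c0) * (\<kappa> ^ c * M * norm (Q (Suc j))) \<le> \<kappa> * (\<kappa> ^ c * M * norm (Q (Suc j)))"
        using \<kappa> M1 \<kappa>_power[of c] by (intro mult_right_mono) auto
      then have "c0 * (\<kappa> ^ c * M * norm (Q (Suc j))) \<le> 1 * (K / of_int s)"
        using s_real by (simp add: K_def field_simps)
      also have "\<dots> \<le> d / (2 * of_int n) * (K / of_int s)"
        using d n_pos K0 s_real by (intro mult_right_mono) auto
      finally show "c0 * (\<kappa> ^ c * M * norm (Q (Suc j))) \<le> d / (2 * of_int n) * (K / of_int s)" .
      have "norm b * (\<kappa> ^ Suc c * M * (real j / of_int n) * norm (Q j))
        = (norm (D0 (s * int (Suc j))) * real j) * (K / of_int n)"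
        using b by (simp add: K_def field_simps)
      also have "\<dots> \<le> (d * (real (Suc j) - 1 / of_int s)) * (K / of_int n)"
        using D K0 n_pos by (intro mult_right_mono) auto
      finally show "norm b * (\<kappa> ^ Suc c * M * (real j / of_int n) * norm (Q j))
        \<le> (d * (real (Suc j) - 1 / of_int s)) * (K / of_int n)" .
    qed
    also have "d / (2 * of_int n) * (K / of_int s) + (d * (real (Suc j) - 1 / of_int s)) * (K / of_int n)
       = (d * (K / of_int n)) * (real (Suc j) - 1 / (2 * of_int s))"
      using n_pos s_real by (simp add: field_simps)
    also have "\<dots> \<le> (d * (K / of_int n)) * real (Suc j)"
      using d n_pos s_real K0 by (intro mult_left_mono) auto
    also have "\<dots> = d * (\<kappa> ^ Suc c * M * (real (Suc j) / of_int n) * norm (Q (Suc j)))"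
      by (simp add: K_def)
    finally show ?case
      unfolding i_def[symmetric] using d n_pos by (subst (asm) mult_le_cancel_left_pos) auto
  qed
  have *: "\<forall>j. 1 \<le> j \<longrightarrow> j < q \<longrightarrow> norm (R z (s * int j - int c)) \<le> \<kappa> ^ c * M * norm (Q j)"
    if "int c < s" for c
    using that
  proof (induction c)
    case 0
    then show ?case using R_pos_le by auto
  next
    case (Suc c)
    then show ?case using main[of c] weak[of _ "Suc c"] by auto
  qed
  show "norm (R z (s * int j - int c)) \<le> \<kappa> ^ c * M * norm (Q j)" using * assms by blast
  show "norm (R z (s * int j - int c)) \<le> \<kappa> ^ c * M * (real j / of_int n) * norm (Q j)" if "1 \<le> c"
    using main[of "c - 1" j] *[of "c - 1"] assms that by auto
qed

text \<open>The chain for \<open>j = q\<close> starts at \<open>n = s q - 1\<close>, where the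
  recurrence is not imposed but \<open>R z\<close> vanishes. Descending from there, the
  \<open>a\<close>-term is already small and the \<open>b\<close>-term comes from the chain for
  \<open>q - 1\<close>.\<close>

lemma R_top_le:
  assumes "1 \<le> c" "int c < s"
  shows "norm (R z (s * int q - int c)) \<le> c0 * (\<kappa> ^ S * M * norm (Q (q - 1))) / (2 * of_int n)"
  using assms
proof (induction c rule: dec_induct)
  case base
  have "0 \<le> c0 * (\<kappa> ^ S * M * norm (Q (q - 1))) / (2 * of_int n)"
    using c0 n_pos M1 \<kappa>_power[of S] by simp
  then show ?case using R(3)[OF z1] n_less by simp
next
  case (step c)
  define V where "V = \<kappa> ^ S * M * norm (Q (q - 1))"
  define i where "i = s * int q - int (Suc c)"
  have V0: "0 \<le> V" using M1 \<kappa>_power[of S] by (simp add: V_def)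
  have i: "i \<noteq> 0" "i \<noteq> n" using step n_less sn by (auto simp: i_def)
  have "norm (R z (i + 1)) \<le> c0 * V / (2 * of_int n)"
    using step by (simp add: V_def i_def algebra_simps)
  also have "\<dots> \<le> of_int n * V / (2 * of_int n)"
    using c0 V0 n_pos by (intro divide_right_mono mult_right_mono) auto
  also have "\<dots> \<le> V" using n_pos V0 by simp
  finally have 1: "norm (R z (i + 1)) \<le> V" .
  have "norm (R z (s * int (q - 1) - int (Suc c))) \<le> \<kappa> ^ Suc c * M * norm (Q (q - 1))"
    using step q3 by (intro R_chain_le) auto
  also have "\<dots> \<le> V"
    unfolding V_def using step S M1 by (intro mult_right_mono \<kappa>_power(2)) auto
  also have "s * int (q - 1) - int (Suc c) = i - s"
    using q3 by (simp add: i_def of_nat_diff algebra_simps)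
  finally have 2: "norm (R z (i - s)) \<le> V" .
  have "T z (R z) i = 0" using R(1)[OF z1] i by (auto simp: sol_def)
  then show ?case
    using norm_step_div(1)[OF i z1 _ 1 2] unfolding i_def V_def by blast
qed

text \<open>Maximum principle on the half-line above \<open>n\<close>, with the boundary values
  below it bounded by \<open>V\<close>.\<close>

lemma R_above_le:
  assumes "i > n"
  shows "norm (R z i) \<le> c0 * (\<kappa> ^ S * M * norm (Q (q - 1))) / (2 * of_int n)"
proof -
  define V where "V = \<kappa> ^ S * M * norm (Q (q - 1))"
  define m where "m = c0 * V / (2 * of_int n)"
  have V0: "0 \<le> V" using M1 \<kappa>_power[of S] by (simp add: V_def)
  have m0: "0 \<le> m" using V0 c0 n_pos by (simp add: m_def)
  have mV: "m \<le> V"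
  proof -
    have "m \<le> of_int n * V / (2 * of_int n)"
      unfolding m_def using c0 V0 n_pos by (intro divide_right_mono mult_right_mono) auto
    also have "\<dots> \<le> V" using n_pos V0 by simp
    finally show ?thesis .
  qed
  define f where "f i = (if i > n then R z i else 0)" for i
  have "norm (f i) \<le> m"
  proof (rule norm_le_if_self_improving[where f = f])
    show "bounded (range f)"
      using R_le(1)[OF z1] by (auto simp: bounded_iff f_def intro!: exI[of _ 1])
    fix C i assume C: "\<And>j. norm (f j) \<le> C"
    have C0: "0 \<le> C" using C norm_ge_zero order_trans by blast
    show "norm (f i) \<le> max m ((m + C) / 2)"
    proof (cases "i > n")
      case True
      have T: "T z (R z) i = 0" and i: "i \<noteq> 0" "i \<noteq> n"
        using R(1)[OF z1] True n3 by (auto simp: sol_def)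
      \<comment> \<open>The step back either stays above \<open>n\<close> or lands on some
        \<open>s q - c\<close> with \<open>1 \<le> c \<le> s\<close>. The case \<open>c = s\<close>
        is the multiple \<open>s (q - 1)\<close>, the other cases are covered by
        \<open>R_top_le\<close>.\<close>
      have "norm (R z (i - s)) \<le> max C V"
      proof (cases "i - s > n")
        case True
        then show ?thesis using C[of "i - s"] by (simp add: f_def le_max_iff_disj)
      next
        case False
        define c where "c = nat (n + 1 - (i - s))"
        have c: "i - s = s * int q - int c" "1 \<le> c" "int c \<le> s"
          using False True n_less by (auto simp: c_def)
        show ?thesis
        proof (cases "int c = s")
          case True
          have "norm (R z (s * int (q - 1))) \<le> M * norm (Q (q - 1))"
            using q3 by (intro R_pos_le) simp
          also have "\<dots> \<le> V" unfolding V_def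
            using \<kappa>_power(1)[of S] M1 mult_right_mono[of 1 "\<kappa> ^ S" "M * norm (Q (q - 1))"] by (simp add: mult_ac)
          also have "s * int (q - 1) = i - s" using True c(1) q3 by (simp add: of_nat_diff algebra_simps)
          finally show ?thesis by (simp add: le_max_iff_disj)
        next
          case False
          then have "norm (R z (i - s)) \<le> m"
            unfolding c(1) m_def V_def using c by (intro R_top_le) auto
          then show ?thesis using mV by (simp add: le_max_iff_disj)
        qed
      qed
      moreover have "norm (R z (i + 1)) \<le> max C V"
        using C[of "i + 1"] True by (simp add: f_def le_max_iff_disj)
      ultimately have "norm (R z i) \<le> c0 * max C V / (2 * of_int n)" "norm (R z i) \<le> max C V / 2"
        using norm_step_div[OF i z1 T] by blast+
      then have "norm (R z i) \<le> max m (C / 2)"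
        by (cases "C \<le> V") (simp_all add: le_max_iff_disj m_def max_absorb1 max_absorb2)
      then show ?thesis using True m0 C0 by (auto simp: f_def max_def split: if_splits)
    qed (use m0 in \<open>simp add: f_def le_max_iff_disj\<close>)
  qed
  then show ?thesis using assms by (simp add: f_def m_def V_def)
qed

section \<open>The quotient of \<open>R z\<close> by its leading path\<close>

definition X :: "nat \<Rightarrow> complex" where "X j = R z (s * int j) / Q j"
definition K1 :: real where "K1 = c0\<^sup>2 * \<kappa> ^ S"
definition K2 :: real where "K2 = (1 + c0) * c0 * \<kappa> ^ S / norm b"

lemma R_X: "j \<le> q \<Longrightarrow> R z (s * int j) = Q j * X j"
  using Q_nz[of j] by (simp add: X_def)

lemma X_0: "X 0 = 1"
  using R[OF z1] by (simp add: X_def Q_0)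

text \<open>Variation of constants: dividing by \<open>Q\<close> removes the \<open>b\<close>-steps,
  and only \<open>z\<close> and the \<open>a\<close>-step drive the change of
  \<open>X\<close>.\<close>

lemma X_diff_eq:
  assumes "1 \<le> j" "j \<le> q"
  shows "D0 (s * int j) * Q j * (X j - X (j - 1)) = z * R z (s * int j) - a * R z (s * int j + 1)"
proof -
  have "s * int j - s = s * int (j - 1)"
    using assms by (simp add: of_nat_diff algebra_simps)
  then have "(D0 (s * int j) - z) * R z (s * int j) = - (a * R z (s * int j + 1) + b * R z (s * int (j - 1)))"
    using R_eq[OF pos_neq[OF assms]] by simp
  moreover have eq1: "D0 (s * int j) * Q j * X (j - 1) = - b * R z (s * int (j - 1))"
  proof -
    have "R z (s * int (j - 1)) = Q (j - 1) * X (j - 1)" using assms by (intro R_X) simp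
    then show ?thesis by (simp only: D0_Q[OF assms] mult.assoc)
  qed
  moreover have eq2: "D0 (s * int j) * Q j * X j = D0 (s * int j) * R z (s * int j)"
    using assms by (simp add: R_X)
  ultimately show ?thesis unfolding right_diff_distrib eq1 eq2 by (simp add: algebra_simps)
qed

text \<open>As \<open>s j + 1 = s (j + 1) - S\<close>, this index belongs to the last residue class
  of the next multiple of \<open>s\<close>, and passing from \<open>Q j\<close> to
  \<open>Q (Suc j)\<close> contributes the factor \<open>c0 / (2 * n)\<close>.\<close>

lemma R_next_le:
  assumes "1 \<le> j" "j < q"
  shows "norm (R z (s * int j + 1)) \<le> c0 * (\<kappa> ^ S * M * norm (Q j)) / (2 * of_int n)"
proof (cases "Suc j < q")
  case True
  have "norm (R z (s * int (Suc j) - int S)) \<le> \<kappa> ^ S * M * norm (Q (Suc j))"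
    using True S by (intro R_chain_le) auto
  also have "norm (Q (Suc j)) \<le> c0 / (2 * of_int n) * norm (Q j)"
    unfolding Q_Suc norm_mult norm_divide norm_minus_cancel
    using c0 n_pos True by (intro mult_right_mono frac_le norm_D0_ge2 pos_neq) auto
  finally show ?thesis
    using S M1 \<kappa>_power(1)[of S] by (simp add: algebra_simps)
next
  case False
  then have "q = Suc j" using assms by simp
  then show ?thesis using R_top_le[of S] S s3 by (simp add: algebra_simps)
qed

lemma X_step:
  assumes "1 \<le> j" "j < q"
  shows "norm (X j - X (j - 1)) \<le> M * K1 / (of_int n)\<^sup>2"
proof -
  define d where "d = norm (D0 (s * int j))"
  have d: "2 * of_int n \<le> d" unfolding d_def using assms by (intro norm_D0_ge2 pos_neq) auto
  have Qp: "0 < norm (Q j)" using Q_nz[of j] assms by simp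
  have "d * norm (Q j) * norm (X j - X (j - 1)) = norm (z * R z (s * int j) - a * R z (s * int j + 1))"
    using X_diff_eq[of j] assms unfolding d_def norm_mult[symmetric] by simp
  also have "\<dots> \<le> norm z * norm (R z (s * int j)) + norm a * norm (R z (s * int j + 1))"
    using norm_triangle_ineq4[of "z * R z (s * int j)" "a * R z (s * int j + 1)"] by (simp add: norm_mult)
  also have "\<dots> \<le> (c0\<^sup>2 / of_int n) * (M * norm (Q j)) + c0 * (c0 * (\<kappa> ^ S * M * norm (Q j)) / (2 * of_int n))"
    using assms c0 n_pos by (intro add_mono mult_mono z R_pos_le R_next_le) auto
  also have "\<dots> = norm (Q j) * (M * c0\<^sup>2 * (2 + \<kappa> ^ S) / (2 * of_int n))"
    using n_pos by (simp add: field_simps power2_eq_square)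
  finally have "norm (Q j) * (d * norm (X j - X (j - 1))) \<le> norm (Q j) * (M * c0\<^sup>2 * (2 + \<kappa> ^ S) / (2 * of_int n))"
    by (simp add: mult_ac)
  then have "d * norm (X j - X (j - 1)) \<le> M * c0\<^sup>2 * (2 + \<kappa> ^ S) / (2 * of_int n)"
    using Qp by (subst (asm) mult_le_cancel_left_pos) auto
  also have "\<dots> \<le> M * c0\<^sup>2 * (4 * \<kappa> ^ S) / (2 * of_int n)"
    using \<kappa>_power(1)[of S] M1 n_pos by (intro divide_right_mono mult_left_mono) auto
  also have "\<dots> = 2 * of_int n * (M * K1 / (of_int n)\<^sup>2)"
    using n_pos by (simp add: K1_def power2_eq_square)
  finally have "2 * of_int n * norm (X j - X (j - 1)) \<le> 2 * of_int n * (M * K1 / (of_int n)\<^sup>2)"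
    using mult_right_mono[OF d norm_ge_zero[of "X j - X (j - 1)"]] by linarith
  then show ?thesis using n_pos by (subst (asm) mult_le_cancel_left_pos) auto
qed

lemma K1_nonneg: "0 \<le> K1" "0 \<le> K2"
  using \<kappa>_power(1)[of S] c0 by (simp_all add: K1_def K2_def)

text \<open>There are at most \<open>n\<close> steps, each of size \<open>O(1 / n ^ 2)\<close>: the
  source is \<open>O(1 / n)\<close> and the diagonal entry contributes another
  \<open>1 / n\<close>.\<close>

lemma X_close_M:
  assumes "j < q"
  shows "norm (X j - 1) \<le> M * K1 / of_int n"
proof -
  have "norm (X j - 1) \<le> real j * (M * K1 / (of_int n)\<^sup>2)"
    using assms
  proof (induction j)
    case (Suc j)
    have "norm (X (Suc j) - 1) \<le> norm (X (Suc j) - X j) + norm (X j - 1)"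
      using norm_triangle_ineq[of "X (Suc j) - X j" "X j - 1"] by simp
    also have "\<dots> \<le> M * K1 / (of_int n)\<^sup>2 + real j * (M * K1 / (of_int n)\<^sup>2)"
      using X_step[of "Suc j"] Suc by (intro add_mono) auto
    also have "\<dots> = real (Suc j) * (M * K1 / (of_int n)\<^sup>2)"
      by (simp only: of_nat_Suc distrib_right mult_1_left)
    finally show ?case .
  qed (simp add: X_0)
  also have "\<dots> \<le> of_int n * (M * K1 / (of_int n)\<^sup>2)"
  proof (rule mult_right_mono)
    have "int j \<le> n" using assms n_less by simp
    then have "real_of_int (int j) \<le> of_int n" by (simp only: of_int_le_iff)
    then show "real j \<le> of_int n" by simp
  qed (use M1 K1_nonneg n_pos in simp)
  also have "\<dots> = M * K1 / of_int n" using n_pos by (simp add: power2_eq_square)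
  finally show ?thesis .
qed

context
  assumes large: "2 * K1 \<le> of_int n"
begin

text \<open>The bootstrap closes: \<open>X_close_M\<close> yields
  \<open>M \<le> 1 + M * K1 / n\<close>, and \<open>K1 / n\<close> is at most
  \<open>1 / 2\<close>.\<close>

lemma M_le_2: "M \<le> 2"
proof -
  have "M \<le> 1 + M * (K1 / of_int n)"
    unfolding M_def
  proof (rule Max.boundedI)
    fix t assume "t \<in> (\<lambda>j. norm (R z (s * int j) / Q j)) ` {..<q}"
    then obtain j where j: "j < q" "t = norm (X j)" by (auto simp: X_def)
    then show "t \<le> 1 + Max ((\<lambda>j. norm (R z (s * int j) / Q j)) ` {..<q}) * (K1 / of_int n)"
      using X_close_M[of j] norm_triangle_ineq2[of "X j" 1] unfolding M_def by simp
  qed (use q3 in \<open>auto simp: lessThan_empty_iff\<close>)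
  also have "M * (K1 / of_int n) \<le> M * (1 / 2)"
    using large n_pos M1 by (intro mult_left_mono) (auto simp: field_simps)
  finally show ?thesis by simp
qed

lemma X_close_less:
  assumes "j < q"
  shows "norm (X j - 1) \<le> 2 * K1 / of_int n"
proof -
  have "M * K1 / of_int n \<le> 2 * K1 / of_int n"
    using M_le_2 K1_nonneg n_pos by (intro divide_right_mono mult_right_mono) auto
  then show ?thesis using X_close_M[OF assms] by linarith
qed

text \<open>At \<open>s q = n + 1\<close> the estimates for \<open>j < q\<close> give way to
  \<open>R_above_le\<close>. The change is \<open>O(1 / n)\<close> instead of
  \<open>O(1 / n ^ 2)\<close>, which is harmless for a single step.\<close>

lemma X_last_step: "norm (X q - X (q - 1)) \<le> K2 / of_int n"
proof -
  define V where "V = c0 * (\<kappa> ^ S * M * norm (Q (q - 1))) / (2 * of_int n)"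
  have V0: "0 \<le> V" using M1 \<kappa>_power(1)[of S] c0 n_pos by (simp add: V_def)
  have Qp: "0 < norm (Q (q - 1))" using Q_nz[of "q - 1"] q3 by simp
  have "norm b * norm (Q (q - 1)) * norm (X q - X (q - 1)) = norm (D0 (s * int q) * Q q * (X q - X (q - 1)))"
    using D0_Q[of q] q3 by (simp add: norm_mult)
  also have "\<dots> = norm (z * R z (s * int q) - a * R z (s * int q + 1))"
    using X_diff_eq[of q] q3 by simp
  also have "\<dots> \<le> norm z * norm (R z (s * int q)) + norm a * norm (R z (s * int q + 1))"
    using norm_triangle_ineq4[of "z * R z (s * int q)" "a * R z (s * int q + 1)"] by (simp add: norm_mult)
  also have "\<dots> \<le> 1 * V + c0 * V"
    unfolding V_def using z1 c0 n_less by (intro add_mono mult_mono R_above_le) auto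
  also have "\<dots> \<le> (1 + c0) * (c0 * (\<kappa> ^ S * 2 * norm (Q (q - 1))) / (2 * of_int n))"
  proof -
    have "V \<le> c0 * (\<kappa> ^ S * 2 * norm (Q (q - 1))) / (2 * of_int n)"
      unfolding V_def using M_le_2 c0 \<kappa>_power(1)[of S] n_pos
      by (intro divide_right_mono mult_left_mono mult_right_mono) auto
    then have "(1 + c0) * V \<le> (1 + c0) * (c0 * (\<kappa> ^ S * 2 * norm (Q (q - 1))) / (2 * of_int n))"
      using c0 by (intro mult_left_mono) auto
    then show ?thesis by (simp add: algebra_simps)
  qed
  also have "\<dots> = norm b * norm (Q (q - 1)) * (K2 / of_int n)"
    using b0 n_pos by (simp add: K2_def field_simps)
  finally show ?thesis
    using Qp b0 by (subst (asm) mult_le_cancel_left_pos) auto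
qed

lemma X_close:
  assumes "j \<le> q"
  shows "norm (X j - 1) \<le> (2 * K1 + K2) / of_int n"
proof (cases "j = q")
  case True
  have "norm (X q - 1) \<le> norm (X q - X (q - 1)) + norm (X (q - 1) - 1)"
    using norm_triangle_ineq[of "X q - X (q - 1)" "X (q - 1) - 1"] by simp
  also have "\<dots> \<le> K2 / of_int n + 2 * K1 / of_int n"
    using X_last_step X_close_less[of "q - 1"] q3 by (intro add_mono) auto
  finally show ?thesis using True by (simp add: add_divide_distrib)
next
  case False
  have "0 \<le> K2 / of_int n" using K1_nonneg n_pos by simp
  then show ?thesis using X_close_less[of j] False assms by (simp add: add_divide_distrib)
qed

text \<open>
  The summation index \<open>j\<close> counts the \<open>b\<close>-steps that precede the only \<open>a\<close>-step of a leading path.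
\<close>

lemma bp_expansion:
  "bp z / (b * G q) = a / b * (\<Sum>j\<le>q. of_real (\<tau> j) * X j) + R z (- s - 1)
     - (\<Sum>j<q. z * R z (s * int j - 1) / (b * G j))"
proof -
  \<comment> \<open>Along the class of \<open>- 1\<close> division by \<open>G\<close> again removes
    the \<open>b\<close>-steps, so \<open>r\<close> telescopes. It ends at
    \<open>n - s = s q - s - 1\<close>, the entry occurring in \<open>bp\<close>, and starts at
    \<open>- s - 1\<close>, reached by descending from \<open>0\<close>.\<close>
  define r where "r j = R z (s * int j - s - 1) / G j" for j
  have r_Suc: "r (Suc j) = r j + a / b * (of_real (\<tau> j) * X j) - z * R z (s * int j - 1) / (b * G j)"
    if "j < q" for j
  proof -
    have nz: "G j \<noteq> 0" "G (Suc j) \<noteq> 0" "D0 (s * int j - 1) \<noteq> 0"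
      using that G_nz[of j] G_nz[of "Suc j"] D0_pos'_nz by auto
    define Y where "Y = R z (s * int j - 1)"
    have "(D0 (s * int j - 1) - z) * Y = - (a * R z (s * int j) + b * R z (s * int j - s - 1))"
      using R_eq[OF pos'_neq[OF that]] by (simp add: Y_def algebra_simps)
    moreover have "R z (s * int j) = G j * (of_real (\<tau> j) * X j)"
      using that by (simp add: R_X Q_eq)
    moreover have "R z (s * int j - s - 1) = G j * r j" using nz by (simp add: r_def)
    ultimately have "D0 (s * int j - 1) * Y = z * Y - G j * (a * (of_real (\<tau> j) * X j) + b * r j)"
      by (simp add: algebra_simps)
    moreover have "r (Suc j) = - (D0 (s * int j - 1) * Y) / (b * G j)"
      using nz b0 by (simp add: r_def G_Suc Y_def field_simps)
    ultimately have r_eq: "r (Suc j) = - (z * Y - G j * (a * (of_real (\<tau> j) * X j) + b * r j)) / (b * G j)"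
      by simp
    show ?thesis
      unfolding r_eq Y_def[symmetric] using nz b0 by (simp add: field_simps)
  qed
  have r_sum: "r m = r 0 + (\<Sum>j<m. a / b * (of_real (\<tau> j) * X j)) - (\<Sum>j<m. z * R z (s * int j - 1) / (b * G j))"
    if "m \<le> q" for m
    using that by (induction m) (simp_all add: r_Suc)
  have "bp z = a * (G q * (of_real (\<tau> q) * X q)) + b * (G q * r q)"
  proof -
    have "n + 1 = s * int q" "n - s = s * int q - s - 1" using n_less(1) by linarith+
    then have "bp z = a * R z (s * int q) + b * R z (s * int q - s - 1)"
      by (simp only: bp_def)
    then show ?thesis
      using G_nz[of q] by (simp add: R_X Q_eq r_def)
  qed
  then have "bp z / (b * G q) = a / b * (of_real (\<tau> q) * X q) + r q"
    using G_nz[of q] b0 by (simp add: field_simps)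
  also have "\<dots> = a / b * (\<Sum>j\<le>q. of_real (\<tau> j) * X j) + r 0 - (\<Sum>j<q. z * R z (s * int j - 1) / (b * G j))"
    unfolding lessThan_Suc_atMost[symmetric] sum.lessThan_Suc r_sum[OF order_refl]
    by (simp add: sum_distrib_left algebra_simps)
  also have "r 0 = R z (- s - 1)" by (simp add: r_def G_def)
  finally show ?thesis .
qed

text \<open>Three sources of error: the deviation of \<open>X\<close> from \<open>1\<close>, the
  initial value \<open>R z (- s - 1)\<close>, and the terms containing \<open>z\<close>.\<close>

definition K4 :: real where
  "K4 = norm (a / b) * 4 * (2 * K1 + K2) + c0 / 2 + 8 * \<kappa> * c0\<^sup>2 / norm b"

text \<open>The factor \<open>\<bar>\<tau> j\<bar>\<close> is what counts: the terms with
  \<open>z\<close> then sum to a constant times \<open>norm z\<close> instead of \<open>q\<close>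
  times it.\<close>

lemma R_over_G_le:
  assumes "j < q"
  shows "norm (R z (s * int j - 1) / G j) \<le> 2 * \<kappa> * \<bar>\<tau> j\<bar>"
proof (cases "j = 0")
  case True
  have "norm (R z (- 1)) \<le> 1" by (rule R_le(1)[OF z1])
  moreover have "complex_of_real (\<tau> 0) = 1" using Q_eq[of 0] by (simp add: Q_0 G_def)
  then have "\<tau> 0 = 1" by (simp only: of_real_eq_1_iff)
  ultimately show ?thesis using True \<kappa> by (simp add: G_def)
next
  case False
  have "norm (R z (s * int j - int 1)) \<le> \<kappa> ^ 1 * M * norm (Q j)"
    using False assms s3 by (intro R_chain_le) auto
  also have "\<dots> \<le> \<kappa> * 2 * norm (Q j)"
    using \<kappa> M_le_2 M1 by (intro mult_right_mono mult_mono) auto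
  also have "\<dots> = 2 * \<kappa> * \<bar>\<tau> j\<bar> * norm (G j)"
    using assms by (simp add: Q_eq norm_mult)
  finally show ?thesis using G_nz[of j] assms by (simp add: norm_divide field_simps)
qed

lemma bp_approx: "norm (bp z / (b * G q) - a / b * of_real (\<Sum>j\<le>q. \<tau> j)) \<le> K4 / of_int n"
proof -
  define N where "N = real_of_int n"
  have N: "0 < N" using n_pos by (simp add: N_def)
  have eq: "bp z / (b * G q) - a / b * of_real (\<Sum>j\<le>q. \<tau> j)
     = a / b * (\<Sum>j\<le>q. of_real (\<tau> j) * (X j - 1)) + R z (- s - 1)
     - (\<Sum>j<q. z * R z (s * int j - 1) / (b * G j))"
    unfolding bp_expansion by (simp add: sum_subtractf right_diff_distrib algebra_simps)
  have triangle: "norm (u + v - w) \<le> norm u + norm v + norm w" for u v w :: complex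
    using norm_triangle_ineq4[of "u + v" w] norm_triangle_ineq[of u v] by linarith
  have "norm (bp z / (b * G q) - a / b * of_real (\<Sum>j\<le>q. \<tau> j))
    \<le> norm (a / b * (\<Sum>j\<le>q. of_real (\<tau> j) * (X j - 1))) + norm (R z (- s - 1))
     + norm (\<Sum>j<q. z * R z (s * int j - 1) / (b * G j))"
    unfolding eq by (rule triangle)
  also have "\<dots> \<le> norm (a / b) * (4 * ((2 * K1 + K2) / N)) + c0 / (2 * N)
     + (c0\<^sup>2 / N) * (2 * \<kappa>) * 4 / norm b"
  proof (intro add_mono)
    have "norm (\<Sum>j\<le>q. of_real (\<tau> j) * (X j - 1)) \<le> (\<Sum>j\<le>q. \<bar>\<tau> j\<bar> * ((2 * K1 + K2) / N))"
    proof (rule sum_norm_le)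
      fix j assume "j \<in> {..q}"
      then show "norm (of_real (\<tau> j) * (X j - 1)) \<le> \<bar>\<tau> j\<bar> * ((2 * K1 + K2) / N)"
        using mult_left_mono[OF X_close[of j], of "\<bar>\<tau> j\<bar>"] by (simp add: norm_mult N_def)
    qed
    also have "\<dots> \<le> 4 * ((2 * K1 + K2) / N)"
      unfolding sum_distrib_right[symmetric] using sum_\<tau>(2) K1_nonneg N by (intro mult_right_mono) auto
    finally show "norm (a / b * (\<Sum>j\<le>q. of_real (\<tau> j) * (X j - 1))) \<le> norm (a / b) * (4 * ((2 * K1 + K2) / N))"
      unfolding norm_mult by (intro mult_left_mono) auto
    show "norm (R z (- s - 1)) \<le> c0 / (2 * N)"
      unfolding N_def using s3 n3 by (intro R_le(2) z1) auto
    have "norm (\<Sum>j<q. z * R z (s * int j - 1) / (b * G j)) \<le> (\<Sum>j<q. (c0\<^sup>2 / N) * (2 * \<kappa> * \<bar>\<tau> j\<bar>) / norm b)"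
    proof (rule sum_norm_le)
      fix j assume "j \<in> {..<q}"
      have "norm (z * R z (s * int j - 1) / (b * G j)) = norm z * norm (R z (s * int j - 1) / G j) / norm b"
        by (simp add: norm_mult norm_divide)
      also have "\<dots> \<le> (c0\<^sup>2 / N) * (2 * \<kappa> * \<bar>\<tau> j\<bar>) / norm b"
        using z R_over_G_le[of j] \<open>j \<in> {..<q}\<close> N
        by (intro divide_right_mono mult_mono) (auto simp: N_def)
      finally show "norm (z * R z (s * int j - 1) / (b * G j)) \<le> (c0\<^sup>2 / N) * (2 * \<kappa> * \<bar>\<tau> j\<bar>) / norm b" .
    qed
    also have "\<dots> = (c0\<^sup>2 / N) * (2 * \<kappa>) * (\<Sum>j<q. \<bar>\<tau> j\<bar>) / norm b"
      by (simp add: sum_distrib_left sum_divide_distrib mult_ac)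
    also have "\<dots> \<le> (c0\<^sup>2 / N) * (2 * \<kappa>) * 4 / norm b"
    proof -
      have "(\<Sum>j<q. \<bar>\<tau> j\<bar>) \<le> (\<Sum>j\<le>q. \<bar>\<tau> j\<bar>)" by (intro sum_mono2) auto
      then have "(\<Sum>j<q. \<bar>\<tau> j\<bar>) \<le> 4" using sum_\<tau>(2) by linarith
      then show ?thesis using \<kappa> N by (intro divide_right_mono mult_left_mono) auto
    qed
    finally show "norm (\<Sum>j<q. z * R z (s * int j - 1) / (b * G j)) \<le> (c0\<^sup>2 / N) * (2 * \<kappa>) * 4 / norm b" .
  qed
  also have "\<dots> = K4 / N" using N b0 by (simp add: K4_def field_simps)
  finally show ?thesis by (simp add: N_def)
qed

text \<open>The main term is at least \<open>norm (a / b) / sqrt n\<close>, since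
  \<open>q \<le> n\<close>; for large \<open>n\<close> the error \<open>K4 / n\<close> is at most
  half of it.\<close>

lemma bp_lower_bound:
  assumes "2 * K4 * norm b / norm a \<le> sqrt (of_int n)"
  shows "norm (bp z) \<ge> norm a * norm (G q) / (2 * sqrt (of_int n))"
proof -
  define N where "N = real_of_int n"
  have N: "0 < N" using n_pos by (simp add: N_def)
  have "real_of_int (int q) \<le> of_int n" using n_less(2) by (simp only: of_int_le_iff)
  then have qN: "real q \<le> N" by (simp add: N_def)
  have "1 / sqrt N \<le> 1 / sqrt (real q)"
    using qN q3 N by (intro divide_left_mono) auto
  also have "\<dots> \<le> (\<Sum>j\<le>q. \<tau> j)" by (rule sum_\<tau>)
  finally have \<tau>: "1 / sqrt N \<le> (\<Sum>j\<le>q. \<tau> j)" .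
  have K: "K4 / N \<le> norm (a / b) * (1 / (2 * sqrt N))"
  proof -
    have "2 * K4 * norm b \<le> norm a * sqrt N"
      using assms a0 by (simp add: N_def field_simps)
    then have "2 * K4 * norm b * sqrt N \<le> norm a * sqrt N * sqrt N"
      using N by (intro mult_right_mono) auto
    also have "\<dots> = norm a * N" using N by simp
    finally show ?thesis using N b0 by (simp add: norm_divide field_simps)
  qed
  have "norm (a / b) * (1 / sqrt N) \<le> norm (a / b * of_real (\<Sum>j\<le>q. \<tau> j))"
    unfolding norm_mult norm_of_real using \<tau> by (intro mult_left_mono) auto
  also have "\<dots> \<le> norm (bp z / (b * G q)) + K4 / N"
    using bp_approx norm_triangle_ineq2[of "a / b * of_real (\<Sum>j\<le>q. \<tau> j)" "bp z / (b * G q)"]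
      norm_minus_commute[of "a / b * of_real (\<Sum>j\<le>q. \<tau> j)" "bp z / (b * G q)"]
    unfolding N_def by linarith
  finally have "norm (a / b) * (1 / sqrt N) \<le> norm (bp z / (b * G q)) + K4 / N" .
  moreover have "norm (a / b) * (1 / sqrt N) = 2 * (norm (a / b) * (1 / (2 * sqrt N)))" by simp
  ultimately have "norm (a / b) * (1 / (2 * sqrt N)) \<le> norm (bp z / (b * G q))"
    using K by linarith
  then have "norm (a / b) * (1 / (2 * sqrt N)) \<le> norm (bp z) / (norm b * norm (G q))"
    by (simp add: norm_divide norm_mult)
  then show ?thesis
    using b0 G_nz[of q] N by (simp add: N_def[symmetric] norm_divide field_simps)
qed

end

end

end

section \<open>Existence of the eigenvectors\<close>

context hill_sequence_large
begin

definition off :: "int set" where "off = UNIV - {0, n}"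

lemma infsum_split_off:
  fixes f :: "int \<Rightarrow> 'b::banach"
  assumes "f summable_on UNIV"
  shows "infsum f UNIV = f 0 + (f n + infsum f off)"
proof -
  have f: "f summable_on A" for A using summable_on_subset_banach[OF assms] by simp
  have "UNIV = insert 0 (insert n off)" by (auto simp: off_def)
  then have "infsum f UNIV = infsum f (insert 0 (insert n off))" by (rule arg_cong)
  also have "\<dots> = f 0 + infsum f (insert n off)"
    using n3 f by (subst infsum_insert) (auto simp: off_def)
  also have "infsum f (insert n off) = f n + infsum f off"
    using f by (subst infsum_insert) (auto simp: off_def)
  finally show ?thesis .
qed

text \<open>The summed form of \<open>sol_bound_off\<close>: adding up the recurrence bounds the
  off-resonant sum by \<open>c0 / (2 * n)\<close> times the full sum, and its own share, at most one
  half, is absorbed.\<close>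

lemma sol_sum_off:
  assumes y: "sol z y" and z: "norm z \<le> 1"
  shows "infsum (\<lambda>i. norm (y i)) off \<le> c0 / of_int n * (norm (y 0) + norm (y n))"
proof -
  have su: "(\<lambda>i. norm (y i)) summable_on UNIV"
    using sol_strongly_summable[OF y z] by (simp add: strongly_summable_def)
  have sA: "(\<lambda>i. norm (y i)) summable_on A" for A
    using summable_on_subset_banach[OF su] by simp
  define E where "E = infsum (\<lambda>i. norm (y i)) UNIV"
  define F where "F = infsum (\<lambda>i. norm (y i)) off"
  have F0: "0 \<le> F" unfolding F_def by (intro infsum_nonneg) auto
  have sh: "(\<lambda>i. norm (y (i + c))) summable_on A" for c A
    using summable_on_subset_banach[OF summable_on_shift_int[OF su]] by simp
  have sh_le: "infsum (\<lambda>i. norm (y (i + c))) off \<le> E" for c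
  proof -
    have "infsum (\<lambda>i. norm (y (i + c))) off \<le> infsum (\<lambda>i. norm (y (i + c))) UNIV"
      by (rule infsum_mono2[OF sh sh]) auto
    also have "\<dots> = E" unfolding E_def by (rule infsum_shift_int)
    finally show ?thesis .
  qed
  define G where "G i = (norm a / (2 * of_int n)) * norm (y (i + 1)) + (norm b / (2 * of_int n)) * norm (y (i + - s))" for i
  have sG: "G summable_on off"
    unfolding G_def by (intro summable_on_add summable_on_cmult_right sh)
  have "F \<le> infsum G off"
    unfolding F_def
  proof (rule infsum_mono[OF sA sG])
    fix i assume "i \<in> off"
    then have i: "i \<noteq> 0" "i \<noteq> n" by (auto simp: off_def)
    have "2 * of_int n * norm (y i) \<le> norm (D0 i - z) * norm (y i)"
      by (intro mult_right_mono norm_D_ge i z) auto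
    also have "\<dots> = norm (a * y (i + 1) + b * y (i - s))"
      using y i unfolding sol_def T_zero_iff by (metis norm_minus_cancel norm_mult)
    also have "\<dots> \<le> norm a * norm (y (i + 1)) + norm b * norm (y (i - s))"
      using norm_triangle_ineq[of "a * y (i + 1)" "b * y (i - s)"] by (simp add: norm_mult)
    finally show "norm (y i) \<le> G i"
      using n_pos by (simp add: G_def field_simps)
  qed
  also have "infsum G off = (norm a / (2 * of_int n)) * infsum (\<lambda>i. norm (y (i + 1))) off
      + (norm b / (2 * of_int n)) * infsum (\<lambda>i. norm (y (i + - s))) off"
    unfolding G_def by (simp only: infsum_add summable_on_cmult_right sh infsum_cmult_right')
  also have "\<dots> \<le> (norm a / (2 * of_int n)) * E + (norm b / (2 * of_int n)) * E"
    using n_pos by (intro add_mono mult_left_mono sh_le) auto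
  also have "\<dots> = c0 / (2 * of_int n) * E"
    by (simp add: c0_def add_divide_distrib distrib_right)
  finally have "F \<le> c0 / (2 * of_int n) * E" .
  moreover have E: "E = norm (y 0) + (norm (y n) + F)"
    unfolding E_def F_def by (rule infsum_split_off[OF su])
  moreover have "c0 / (2 * of_int n) * F \<le> 1 / 2 * F"
    using c0 n_pos F0 by (intro mult_right_mono) (auto simp: field_simps)
  moreover have "c0 / (2 * of_int n) * E = c0 / (2 * of_int n) * (norm (y 0) + norm (y n)) + c0 / (2 * of_int n) * F"
    unfolding E by (simp only: distrib_left add.assoc)
  ultimately have "F \<le> c0 / (2 * of_int n) * (norm (y 0) + norm (y n)) + F / 2"
    by linarith
  then have "F / 2 \<le> (c0 / of_int n * (norm (y 0) + norm (y n))) / 2" by simp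
  then show ?thesis unfolding F_def by simp
qed

text \<open>Subtracting a multiple of \<open>y\<close> makes the solution vanish at
  \<open>n\<close>, so the rest is a multiple of \<open>R z\<close>. The equation at
  \<open>n\<close> then says that this multiple times \<open>bp z\<close> is zero.\<close>

lemma sol_solution_multiple:
  assumes z: "norm z \<le> 1" and bp: "bp z \<noteq> 0"
    and y: "bounded (range y)" "\<And>i. T z y i = 0" "y n = 1"
    and u: "bounded (range u)" "\<And>i. T z u i = 0"
  shows "u i = u n * y i"
proof -
  define d where "d i = u i - u n * y i" for i
  have Td: "T z d i = 0" for i
    using y u unfolding d_def by (simp add: T_diff)
  have d: "sol z d"
    unfolding sol_def using bounded_lincomb[OF u(1) y(1), of "u n"] Td by (simp add: d_def[abs_def])
  have dn: "d n = 0" by (simp add: d_def y)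
  have "sol z (\<lambda>i. d i - d 0 * R z i)" by (rule sol_diff[OF d R(1)[OF z]])
  then have dR: "d i = d 0 * R z i" for i
    using sol_eq_0[of z "\<lambda>i. d i - d 0 * R z i" i] z R[OF z] dn by simp
  have "T z d n = d 0 * T z (R z) n"
    unfolding T_def by (subst (1 2 3) dR) (simp add: algebra_simps)
  then have "d 0 = 0" using Td T_P_R(3)[OF z] bp by simp
  then show ?thesis using dR[of i] by (simp add: d_def)
qed

end

context hill_sequence_q
begin

text \<open>The factors of the long product at the indices \<open>s j - 1\<close>,
  \<open>1 \<le> j < q\<close>, are matched with those of \<open>G q\<close>, at the cost of
  \<open>2 * c0 / norm b\<close> each. At least \<open>q + 2\<close> factors \<open>\<theta>\<close>
  remain: \<open>q - 1\<close> of them absorb that cost, the other three beat the unmatched factor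
  of \<open>G q\<close> at \<open>- 1\<close>, whose inverse is of order \<open>n\<close>, and leave
  the inverse square of \<open>n\<close>.\<close>

lemma p_le_G:
  assumes z: "norm z \<le> 1" and large: "c0\<^sup>2 \<le> norm b * of_int n"
  shows "norm (p z 1) \<le> norm (G q) * (c0 ^ 3 / (norm b * (of_int n)\<^sup>2))"
proof -
  define g where "g l = norm (- a / (D0 l - z))" for l
  define I where "I = {1..<q}"
  have I: "finite I" "card I = q - 1" "{..<q} = insert 0 I" "0 \<notin> I" "\<And>j. j \<in> I \<Longrightarrow> j < q"
    using q3 unfolding I_def by (simp, simp, auto)
  define A where "A = (\<lambda>j. s * int j - 1) ` I"
  define \<theta> where "\<theta> = c0 / (2 * of_int n)"
  have \<theta>: "0 \<le> \<theta>" "\<theta> \<le> 1" using c0 n_pos by (auto simp: \<theta>_def field_simps)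
  have inj: "inj_on (\<lambda>j. s * int j - 1) I" using s3 by (auto simp: inj_on_def)
  have sub: "A \<subseteq> {1..n - 1}"
  proof
    fix l assume "l \<in> A"
    then obtain j where j: "1 \<le> j" "j < q" "l = s * int j - 1" by (auto simp: A_def I_def)
    have "1 \<le> l" "l \<le> n - 1" using pos_ge[OF j(1)] pos_less[OF j(2)] s3 j(3) by linarith+
    then show "l \<in> {1..n - 1}" by simp
  qed
  have g: "0 \<le> g l" "1 \<le> l \<Longrightarrow> l \<le> n - 1 \<Longrightarrow> g l \<le> \<theta>" for l
    using norm_D_ge[of l z] z c0 n_pos by (auto simp: g_def \<theta>_def norm_divide intro!: frac_le)
  have "norm (p z 1) = prod g {1..n - 1}"
    by (simp only: p_def prod_norm[symmetric] g_def[abs_def])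
  also have "\<dots> = prod g ({1..n - 1} - A) * prod g A"
    by (rule prod.subset_diff[OF sub]) simp
  also have "\<dots> \<le> \<theta> ^ (q + 2) * ((2 * c0 / norm b) ^ (q - 1) * (norm (G q) * (8 * of_int n / norm b)))"
  proof (rule mult_mono)
    have "prod g ({1..n - 1} - A) \<le> (\<Prod>l\<in>{1..n - 1} - A. \<theta>)"
      using g by (intro prod_mono) auto
    also have "\<dots> = \<theta> ^ (nat (n - 1) - (q - 1))"
      using sub card_image[OF inj] I(1,2) by (simp add: card_Diff_subset A_def)
    also have "\<dots> \<le> \<theta> ^ (q + 2)"
    proof (rule power_decreasing)
      have "3 * int q \<le> s * int q" using s3 by (intro mult_right_mono) auto
      then show "q + 2 \<le> nat (n - 1) - (q - 1)" using n_less(1) q3 by linarith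
    qed (use \<theta> in auto)
    finally show "prod g ({1..n - 1} - A) \<le> \<theta> ^ (q + 2)" .
    have G_split: "norm (G q) = norm b / norm (D0 (- 1)) * (\<Prod>j\<in>I. norm b / norm (D0 (s * int j - 1)))"
      unfolding G_def I(3) prod.insert[OF I(1,4)] norm_mult prod_norm[symmetric] norm_divide norm_minus_cancel
      by simp
    have "prod g A = (\<Prod>j\<in>I. g (s * int j - 1))"
      unfolding A_def by (subst prod.reindex[OF inj]) simp
    also have "\<dots> \<le> (\<Prod>j\<in>I. (2 * c0 / norm b) * (norm b / norm (D0 (s * int j - 1))))"
    proof (intro prod_mono conjI g)
      fix j assume "j \<in> I"
      define d where "d = norm (D0 (s * int j - 1))"
      have d: "2 * of_int n \<le> d"
        unfolding d_def using pos'_neq[of j] I(5) \<open>j \<in> I\<close> by (intro norm_D0_ge2) auto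
      have "d / 2 \<le> norm (D0 (s * int j - 1) - z)"
        using norm_triangle_ineq2[of "D0 (s * int j - 1)" z] z d n_pos unfolding d_def by linarith
      then have "norm a / norm (D0 (s * int j - 1) - z) \<le> c0 / (d / 2)"
        using d n_pos c0 by (intro frac_le) auto
      then show "g (s * int j - 1) \<le> (2 * c0 / norm b) * (norm b / norm (D0 (s * int j - 1)))"
        using b0 by (simp add: g_def norm_divide d_def mult.commute)
    qed
    also have "\<dots> = (2 * c0 / norm b) ^ (q - 1) * (\<Prod>j\<in>I. norm b / norm (D0 (s * int j - 1)))"
      by (simp only: prod.distrib prod_constant I(2))
    also have "(\<Prod>j\<in>I. norm b / norm (D0 (s * int j - 1))) = norm (G q) * (norm (D0 (- 1)) / norm b)"
      unfolding G_split using b0 D0_pos'_nz[of 0] q3 by simp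
    also have "norm (D0 (- 1)) = 4 * (of_int n + 1)"
      using n_pos by (simp add: norm_D0)
    also have "(2 * c0 / norm b) ^ (q - 1) * (norm (G q) * (4 * (of_int n + 1) / norm b))
      \<le> (2 * c0 / norm b) ^ (q - 1) * (norm (G q) * (8 * of_int n / norm b))"
      using c0 n_pos by (intro mult_left_mono divide_right_mono) auto
    finally show "prod g A \<le> (2 * c0 / norm b) ^ (q - 1) * (norm (G q) * (8 * of_int n / norm b))" .
  qed (use g \<theta> in \<open>auto intro: prod_nonneg\<close>)
  also have "\<dots> = (\<theta> * (2 * c0 / norm b)) ^ (q - 1) * (\<theta> ^ 3 * (norm (G q) * (8 * of_int n / norm b)))"
  proof -
    have "q + 2 = (q - 1) + 3" using q3 by simp
    then have "\<theta> ^ (q + 2) = \<theta> ^ (q - 1) * \<theta> ^ 3" by (metis power_add)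
    then show ?thesis by (simp only: power_mult_distrib mult_ac)
  qed
  also have "\<dots> \<le> 1 * (\<theta> ^ 3 * (norm (G q) * (8 * of_int n / norm b)))"
  proof (rule mult_right_mono)
    have "\<theta> * (2 * c0 / norm b) \<le> 1"
      using large b0 n_pos by (simp add: \<theta>_def field_simps power2_eq_square)
    then show "(\<theta> * (2 * c0 / norm b)) ^ (q - 1) \<le> 1"
      using \<theta> c0 by (intro power_le_one) auto
  qed (use \<theta> n_pos in auto)
  also have "\<dots> = norm (G q) * (c0 ^ 3 / (norm b * (of_int n)\<^sup>2))"
    using n_pos b0 by (simp add: \<theta>_def power3_eq_cube power2_eq_square field_simps)
  finally show ?thesis .
qed

text \<open>Relative to \<open>G q\<close>, \<open>bm\<close> is of order \<open>n ^ (- 2)\<close>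
  by \<open>p_le_G\<close>, while \<open>bp\<close> loses at most \<open>sqrt n\<close>; the
  quotient of order \<open>n ^ (- 3 / 2)\<close> is rounded up to \<open>1 / n\<close>.\<close>

lemma coefficient_ratio:
  assumes z: "norm z \<le> c0\<^sup>2 / of_int n"
    and large: "2 * K1 \<le> of_int n" "2 * K4 * norm b / norm a \<le> sqrt (of_int n)" "c0\<^sup>2 \<le> norm b * of_int n"
  shows "bp z \<noteq> 0" "norm (bm z) \<le> 3 * c0 ^ 3 / (norm b * of_int n) * norm (bp z)"
proof -
  define N where "N = real_of_int n"
  have N: "0 < N" "1 \<le> N" using n_pos by (simp_all add: N_def)
  have z1: "norm z \<le> 1" by (rule z1[OF z])
  have lb: "norm a * norm (G q) / (2 * sqrt N) \<le> norm (bp z)"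
    using bp_lower_bound[OF z large(1,2)] by (simp add: N_def)
  moreover have "0 < norm a * norm (G q) / (2 * sqrt N)" using a0 G_nz[of q] N by simp
  ultimately show "bp z \<noteq> 0" by auto
  have "norm (bm z) \<le> norm a * (4 / 3 * norm (p z 1))"
    unfolding bm_eq[OF z1] norm_mult using P_bounds(1)[OF z1, of 1] n3 by (intro mult_left_mono) auto
  also have "\<dots> \<le> norm a * (4 / 3 * (norm (G q) * (c0 ^ 3 / (norm b * N\<^sup>2))))"
    using p_le_G[OF z1 large(3)] by (intro mult_left_mono) (auto simp: N_def)
  also have "\<dots> = (norm a * norm (G q) / (2 * sqrt N)) * (8 / 3 * c0 ^ 3 / norm b * (sqrt N / N\<^sup>2))"
    using N by (simp add: field_simps)
  also have "\<dots> \<le> norm (bp z) * (3 * c0 ^ 3 / norm b * (1 / N))"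
  proof (rule mult_mono[OF lb mult_mono])
    have "sqrt N \<le> N" using N real_sqrt_le_mono[of N "N\<^sup>2"] self_le_power[of N 2] by simp
    then have "sqrt N / N\<^sup>2 \<le> N / N\<^sup>2" by (intro divide_right_mono) auto
    then show "sqrt N / N\<^sup>2 \<le> 1 / N" using N by (simp add: power2_eq_square)
    show "8 / 3 * c0 ^ 3 / norm b \<le> 3 * c0 ^ 3 / norm b"
      using c0 by (intro divide_right_mono mult_right_mono) auto
  qed (use c0 N in auto)
  finally show "norm (bm z) \<le> 3 * c0 ^ 3 / (norm b * of_int n) * norm (bp z)"
    by (simp add: N_def mult_ac)
qed

text \<open>
  Eliminating \<open>\<eta>\<close> with \<open>\<xi> = 1\<close> gives \<open>z = \<alpha> + bp \<eta>\<close> and \<open>\<eta>\<^sup>2 = bm / bp\<close>; a continuous branch of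
  the square root exists on the disc, so Brouwer's theorem yields a solution.
\<close>

lemma eigenvector_exists:
  assumes large: "2 * K1 \<le> of_int n" "2 * K4 * norm b / norm a \<le> sqrt (of_int n)" "c0\<^sup>2 \<le> norm b * of_int n"
    "48 * c0 ^ 3 \<le> norm b * of_int n" "4 * c0 \<le> of_int n"
    and \<epsilon>: "3 * c0 ^ 3 / (norm b * of_int n) \<le> (\<epsilon> / 2)\<^sup>2" "4 * c0 / of_int n \<le> \<epsilon>" "0 < \<epsilon>"
  shows "\<exists>z y. norm z \<le> 1 \<and> y n = 1 \<and> strongly_summable y \<and> (\<forall>i. T z y i = 0)
    \<and> infsum (\<lambda>i. norm (y i)) (UNIV - {n}) \<le> \<epsilon> \<and> (\<Sum>\<^sub>\<infinity>i. y i * y (n - i)) \<noteq> 0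
    \<and> (\<forall>u. bounded (range u) \<longrightarrow> (\<forall>i. T z u i = 0) \<longrightarrow> (\<forall>i. u i = u n * y i))"
proof -
  define r where "r = c0\<^sup>2 / of_int n"
  have r: "0 \<le> r" "r \<le> 1" using c0 n_pos by (simp_all add: r_def)
  have sub: "cball 0 r \<subseteq> (cball 0 1 :: complex set)" using r by auto
  have le1: "norm z \<le> 1" if "norm z \<le> r" for z :: complex using that r by simp
  have bp: "bp z \<noteq> 0" "norm (bm z) \<le> 3 * c0 ^ 3 / (norm b * of_int n) * norm (bp z)" if "norm z \<le> r" for z
    using coefficient_ratio[OF that[unfolded r_def] large(1-3)] by auto
  have cont: "continuous_on (cball 0 r) (\<lambda>z. bm z / bp z)"
    using bp by (intro continuous_on_divide continuous_on_subset[OF continuous_coeff(2) sub]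
      continuous_on_subset[OF continuous_coeff(3) sub]) auto
  have contr: "contractible (cball 0 r :: complex set)"
    by (intro convex_imp_contractible convex_cball)
  have nz: "bm z / bp z \<noteq> 0" if "z \<in> cball 0 r" for z
    using that bp(1)[of z] bm_nonzero[OF le1, of z] by simp
  obtain h where h: "continuous_on (cball 0 r) h" "\<And>z. z \<in> cball 0 r \<Longrightarrow> bm z / bp z = (h z)\<^sup>2"
  proof (rule continuous_sqrt_on_contractible[OF cont contr nz])
    fix g assume "continuous_on (cball 0 r) g" "\<And>z. z \<in> cball 0 r \<Longrightarrow> bm z / bp z = (g z)\<^sup>2"
    then show thesis by (rule that)
  qed
  obtain z where z: "z \<in> cball 0 r" "\<alpha> z + bp z * h z = z"
  proof (rule brouwer[of "cball 0 r" "\<lambda>z. \<alpha> z + bp z * h z"])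
    show "continuous_on (cball 0 r) (\<lambda>z. \<alpha> z + bp z * h z)"
      by (intro continuous_intros h continuous_on_subset[OF continuous_coeff(1) sub]
        continuous_on_subset[OF continuous_coeff(3) sub])
    show "(\<lambda>z. \<alpha> z + bp z * h z) \<in> cball 0 r \<rightarrow> cball 0 r"
    proof
      fix z :: complex assume z: "z \<in> cball 0 r"
      then have z': "norm z \<le> r" by simp
      \<comment> \<open>The product is a square root of \<open>bp z * bm z\<close>, so its norm is
        at most the common bound \<open>c0\<^sup>2 / (2 * n)\<close>. The diagonal term has the same
        bound, and the map stays in the disc of radius \<open>r\<close>.\<close>
      have "(bp z * h z)\<^sup>2 = bp z * bm z"
        using h(2)[OF z] bp(1)[OF z'] by (simp add: power_mult_distrib power2_eq_square field_simps)
      then have "(norm (bp z * h z))\<^sup>2 = norm (bp z) * norm (bm z)"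
        by (metis norm_mult norm_power)
      also have "\<dots> \<le> (c0\<^sup>2 / (2 * of_int n)) * (c0\<^sup>2 / (2 * of_int n))"
        using coeff_bounds[OF le1[OF z']] n_pos by (intro mult_mono) auto
      finally have "(norm (bp z * h z))\<^sup>2 \<le> (c0\<^sup>2 / (2 * of_int n))\<^sup>2" by (simp add: power2_eq_square)
      then have "norm (bp z * h z) \<le> c0\<^sup>2 / (2 * of_int n)"
        by (rule power2_le_imp_le) (use n_pos in simp)
      then have "norm (\<alpha> z + bp z * h z) \<le> c0\<^sup>2 / (2 * of_int n) + c0\<^sup>2 / (2 * of_int n)"
        using coeff_bounds(1)[OF le1[OF z']] norm_triangle_ineq[of "\<alpha> z" "bp z * h z"] by linarith
      also have "\<dots> = r" using n_pos by (simp add: r_def field_simps)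
      finally show "\<alpha> z + bp z * h z \<in> cball 0 r" by simp
    qed
  qed (use r in auto)
  have zr: "norm z \<le> r" using z by simp
  note z1 = le1[OF zr]
  note P = P[OF z1] and R = R[OF z1]
  define \<eta> where "\<eta> = h z"
  have bm: "bm z = bp z * \<eta>\<^sup>2"
    using h(2)[OF z(1)] bp(1)[OF zr] by (simp add: \<eta>_def field_simps)
  have \<eta>0: "\<eta> \<noteq> 0" using bm bm_nonzero[OF z1] by auto
  have \<eta>2: "(norm \<eta>)\<^sup>2 \<le> 3 * c0 ^ 3 / (norm b * of_int n)"
  proof -
    have "norm (bp z) * (norm \<eta>)\<^sup>2 \<le> norm (bp z) * (3 * c0 ^ 3 / (norm b * of_int n))"
      using bp(2)[OF zr] unfolding bm by (simp add: norm_mult norm_power mult.commute)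
    then show ?thesis using bp(1)[OF zr] by (subst (asm) mult_le_cancel_left_pos) auto
  qed
  have \<eta>4: "norm \<eta> \<le> 1 / 4"
  proof (rule power2_le_imp_le)
    have "3 * c0 ^ 3 / (norm b * of_int n) \<le> (1 / 4)\<^sup>2"
      using large(4) b0 n_pos by (simp add: power2_eq_square field_simps)
    then show "(norm \<eta>)\<^sup>2 \<le> (1 / 4)\<^sup>2" using \<eta>2 by linarith
  qed simp
  have \<eta>\<epsilon>: "norm \<eta> \<le> \<epsilon> / 2"
    by (rule power2_le_imp_le[OF order_trans[OF \<eta>2 \<epsilon>(1)]]) (use \<epsilon> in simp)
  define y where "y i = P z i + \<eta> * R z i" for i
  have yn: "y n = 1" and y0: "y 0 = \<eta>" using P R by (simp_all add: y_def)
  have Ty: "T z y i = T z (P z) i + \<eta> * T z (R z) i" for i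
    unfolding y_def by (rule T_add)
  have T0: "T z y i = 0" for i
  proof -
    consider "i = 0" | "i = n" | "i \<noteq> 0" "i \<noteq> n" by blast
    then show ?thesis
    proof cases
      case 1
      have "T z y 0 = bm z + \<eta> * (\<alpha> z - z)"
        unfolding Ty T_P_R[OF z1] \<alpha>_symmetric[OF z1] ..
      also have "\<alpha> z - z = - (bp z * \<eta>)" using z(2) by (simp add: \<eta>_def algebra_simps)
      finally show ?thesis using 1 by (simp add: bm power2_eq_square)
    next
      case 2
      then show ?thesis
        unfolding Ty using z(2) by (simp add: T_P_R[OF z1] \<eta>_def algebra_simps)
    next
      case 3
      then show ?thesis using P R by (simp add: Ty sol_def)
    qed
  qed
  have "sol z (\<lambda>i. P z i - (- \<eta>) * R z i)" by (rule sol_diff[OF P(1) R(1)])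
  then have ysol: "sol z y" by (simp add: y_def[abs_def])
  have ss: "strongly_summable y" by (rule sol_strongly_summable[OF ysol z1])
  have su: "(\<lambda>i. norm (y i)) summable_on A" for A
    using ss summable_on_subset_banach unfolding strongly_summable_def by blast
  have c0n: "0 \<le> c0 / of_int n" "c0 / of_int n \<le> 1 / 4"
    using large(5) n_pos c0 by (auto simp: field_simps)
  have off_sum: "infsum (\<lambda>i. norm (y i)) (UNIV - {n}) \<le> \<epsilon>"
  proof -
    have "UNIV - {n} = insert 0 off" using n3 by (auto simp: off_def)
    then have "infsum (\<lambda>i. norm (y i)) (UNIV - {n}) = infsum (\<lambda>i. norm (y i)) (insert 0 off)"
      by (rule arg_cong)
    also have "\<dots> = norm (y 0) + infsum (\<lambda>i. norm (y i)) off"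
      by (rule infsum_insert[OF su]) (simp add: off_def)
    also have "\<dots> = norm \<eta> + infsum (\<lambda>i. norm (y i)) off"
      by (simp only: y0)
    also have "\<dots> \<le> \<epsilon> / 2 + c0 / of_int n * (norm (y 0) + norm (y n))"
      using \<eta>\<epsilon> by (intro add_mono sol_sum_off[OF ysol z1]) auto
    also have "\<dots> \<le> \<epsilon> / 2 + c0 / of_int n * 2"
      using \<eta>4 c0n by (intro add_mono mult_left_mono) (auto simp: y0 yn)
    also have "\<dots> \<le> \<epsilon>" using \<epsilon>(2) by simp
    finally show ?thesis .
  qed
  \<comment> \<open>The indices \<open>0\<close> and \<open>n\<close> contribute
    \<open>2 * \<eta>\<close>. The rest has norm at most \<open>norm \<eta>\<close>: the
    \<open>P\<close>-\<open>P\<close> terms sum to at most \<open>2 * norm (bm z)\<close>, hence to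
    the square of \<open>norm \<eta>\<close> because \<open>bm z = bp z * \<eta>\<^sup>2\<close>,
    and in the other terms one factor is at most \<open>1\<close> and the other sums to at most
    \<open>1 / 4\<close>.\<close>
  have B: "(\<Sum>\<^sub>\<infinity>i. y i * y (n - i)) \<noteq> 0"
  proof -
    have sP: "(\<lambda>i. norm (P z i)) summable_on A" for A
      using sol_strongly_summable[OF P(1) z1] summable_on_subset_banach unfolding strongly_summable_def by blast
    have sR: "(\<lambda>i. norm (R z i)) summable_on A" for A
      using sol_strongly_summable[OF R(1) z1] summable_on_subset_banach unfolding strongly_summable_def by blast
    have ybd: "bounded (range y)" using ysol by (simp add: sol_def)
    have sy: "(\<lambda>i. norm (y i * y (n - i))) summable_on UNIV" "(\<lambda>i. y i * y (n - i)) summable_on UNIV"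
      using summable_on_bounded_mult[OF ybd summable_on_reflect_int[OF su]] by auto
    define p where "p i = (if i \<in> {1..n - 1} then 2 * norm (bm z) / of_int n else 0)" for i
    have p_sum: "(p has_sum 2 * norm (bm z) * (of_int n - 1) / of_int n) off"
    proof -
      have "(p has_sum (\<Sum>i\<in>{1..n - 1}. p i)) {1..n - 1}" by (rule has_sum_finite) simp
      also have "(\<Sum>i\<in>{1..n - 1}. p i) = 2 * norm (bm z) * (of_int n - 1) / of_int n"
        using n3 by (simp add: p_def)
      finally show ?thesis
        by (rule has_sum_cong_neutral[THEN iffD1, rotated -1]) (auto simp: p_def off_def)
    qed
    define g where "g i = p i + (norm \<eta> * norm (P z i) + (norm \<eta> + (norm \<eta>)\<^sup>2) * norm (R z i))" for i
    have PRs: "(\<lambda>i. norm \<eta> * norm (P z i)) summable_on off" "(\<lambda>i. (norm \<eta> + (norm \<eta>)\<^sup>2) * norm (R z i)) summable_on off"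
      by (intro summable_on_cmult_right sP sR)+
    have g_sum: "(g has_sum (2 * norm (bm z) * (of_int n - 1) / of_int n
       + (norm \<eta> * infsum (\<lambda>i. norm (P z i)) off + (norm \<eta> + (norm \<eta>)\<^sup>2) * infsum (\<lambda>i. norm (R z i)) off))) off"
      unfolding g_def infsum_cmult_right'[symmetric]
      by (intro has_sum_add p_sum has_sum_infsum PRs)
    have "norm (infsum (\<lambda>i. y i * y (n - i)) off) \<le> 2 * norm (bm z) * (of_int n - 1) / of_int n
       + (norm \<eta> * infsum (\<lambda>i. norm (P z i)) off + (norm \<eta> + (norm \<eta>)\<^sup>2) * infsum (\<lambda>i. norm (R z i)) off)"
    proof (rule norm_infsum_le[OF has_sum_infsum g_sum])
      show "(\<lambda>i. y i * y (n - i)) summable_on off"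
        using summable_on_subset_banach[OF sy(2)] by simp
      fix i assume "i \<in> off"
      then have i: "i \<noteq> 0" "i \<noteq> n" by (auto simp: off_def)
      have 1: "norm (P z i * P z (n - i)) \<le> p i"
      proof (cases "i \<in> {1..n - 1}")
        case True
        then show ?thesis using P_mult_reflect_le[OF z1 i] by (simp add: p_def)
      next
        case False
        then have "P z i = 0 \<or> P z (n - i) = 0" using P_nonpos[OF z1] i by (cases "i \<le> 0") auto
        then show ?thesis using False by (auto simp: p_def)
      qed
      have m1: "norm (P z i * R z (n - i)) \<le> norm (P z i) * 1"
        unfolding norm_mult by (intro mult_left_mono R_le z1) auto
      have m2: "norm (R z i * P z (n - i)) \<le> norm (R z i) * 1"
        unfolding norm_mult by (intro mult_left_mono P_le z1) auto
      have m3: "norm (R z i * R z (n - i)) \<le> norm (R z i) * 1"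
        unfolding norm_mult by (intro mult_left_mono R_le z1) auto
      have eq: "y i * y (n - i) = P z i * P z (n - i) + (\<eta> * (P z i * R z (n - i)) + (\<eta> * (R z i * P z (n - i)) + \<eta>\<^sup>2 * (R z i * R z (n - i))))"
        by (simp add: y_def algebra_simps power2_eq_square)
      have "norm (y i * y (n - i)) \<le> norm (P z i * P z (n - i)) + (norm (\<eta> * (P z i * R z (n - i))) + (norm (\<eta> * (R z i * P z (n - i))) + norm (\<eta>\<^sup>2 * (R z i * R z (n - i)))))"
        unfolding eq by (intro order_trans[OF norm_triangle_ineq] add_left_mono order_refl)
      also have "\<dots> \<le> p i + (norm \<eta> * (norm (P z i) * 1) + (norm \<eta> * (norm (R z i) * 1) + (norm \<eta>)\<^sup>2 * (norm (R z i) * 1)))"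
        unfolding norm_mult[of \<eta>] norm_mult[of "\<eta>\<^sup>2"] norm_power
        by (intro add_mono 1 mult_left_mono[OF m1] mult_left_mono[OF m2] mult_left_mono[OF m3]) simp_all
      also have "\<dots> = g i" by (simp add: g_def algebra_simps)
      finally show "norm (y i * y (n - i)) \<le> g i" .
    qed
    also have "\<dots> \<le> (norm \<eta>)\<^sup>2 + (norm \<eta> * (1 / 4) + (norm \<eta> + (norm \<eta>)\<^sup>2) * (1 / 4))"
    proof (intro add_mono mult_left_mono)
      have "2 * norm (bm z) * (of_int n - 1) / of_int n \<le> 2 * norm (bm z)"
        using n_pos by (simp add: field_simps)
      also have "\<dots> = 2 * norm (bp z) * (norm \<eta>)\<^sup>2" by (simp add: bm norm_mult norm_power)
      also have "\<dots> \<le> 1 * (norm \<eta>)\<^sup>2"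
      proof (rule mult_right_mono)
        have "c0\<^sup>2 / (2 * of_int n) \<le> 1 / 2" using c0 n_pos by (simp add: field_simps)
        then show "2 * norm (bp z) \<le> 1" using coeff_bounds(3)[OF z1] by linarith
      qed simp
      finally show "2 * norm (bm z) * (of_int n - 1) / of_int n \<le> (norm \<eta>)\<^sup>2" by simp
      show "infsum (\<lambda>i. norm (P z i)) off \<le> 1 / 4" "infsum (\<lambda>i. norm (R z i)) off \<le> 1 / 4"
        by (rule order_trans[OF _ c0n(2)], use sol_sum_off[OF P(1) z1] P in simp,
          rule order_trans[OF _ c0n(2)], use sol_sum_off[OF R(1) z1] R in simp)
    qed auto
    also have "\<dots> \<le> norm \<eta>"
    proof -
      have "(norm \<eta>)\<^sup>2 \<le> 1 / 4 * norm \<eta>"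
        unfolding power2_eq_square using \<eta>4 by (intro mult_right_mono) auto
      moreover have "e + (x * (1 / 4) + (x + e) * (1 / 4)) \<le> x" if "e \<le> 1 / 4 * x" "0 \<le> x" for e x :: real
        using that by (simp add: field_simps)
      ultimately show ?thesis using norm_ge_zero[of \<eta>] by blast
    qed
    finally have *: "norm (infsum (\<lambda>i. y i * y (n - i)) off) \<le> norm \<eta>" .
    have eq: "(\<Sum>\<^sub>\<infinity>i. y i * y (n - i)) = 2 * \<eta> + infsum (\<lambda>i. y i * y (n - i)) off"
      using infsum_split_off[OF sy(2)] by (simp add: y0 yn)
    show ?thesis
    proof
      assume "(\<Sum>\<^sub>\<infinity>i. y i * y (n - i)) = 0"
      then have "infsum (\<lambda>i. y i * y (n - i)) off = - (2 * \<eta>)" using eq by (simp add: add_eq_0_iff2)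
      then have "2 * norm \<eta> \<le> norm \<eta>" using * by (simp add: norm_mult)
      then show False using \<eta>0 by simp
    qed
  qed
  have "\<forall>u. bounded (range u) \<longrightarrow> (\<forall>i. T z u i = 0) \<longrightarrow> (\<forall>i. u i = u n * y i)"
    using sol_solution_multiple[OF z1 bp(1)[OF zr] _ T0 yn] ysol by (auto simp: sol_def)
  then show ?thesis using z1 yn ss T0 off_sum B by blast
qed

end

theorem eigenvector_sequence:
  fixes a b :: complex and s :: nat and \<epsilon> :: real
  assumes "a \<noteq> 0" "b \<noteq> 0" "s \<ge> 3" "0 < \<epsilon>"
  shows "\<exists>n z y. n > N \<and> odd n \<and> norm z \<le> 1 \<and> y n = 1 \<and> hill_sequence.strongly_summable n y
    \<and> (\<forall>i. hill_sequence.T a b (int s) n z y i = 0)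
    \<and> infsum (\<lambda>i. norm (y i)) (UNIV - {n}) \<le> \<epsilon> \<and> (\<Sum>\<^sub>\<infinity>i. y i * y (n - i)) \<noteq> 0
    \<and> (\<forall>u. bounded (range u) \<longrightarrow> (\<forall>i. hill_sequence.T a b (int s) n z u i = 0) \<longrightarrow> (\<forall>i. u i = u n * y i))"
proof -
  define c where "c = norm a + norm b"
  have c_eq: "c = hill_sequence_large.c0 a b" if "hill_sequence_large a b (int s) n" for n
    using hill_sequence_large.c0_def[OF that] by (simp add: c_def)
  \<comment> \<open>\<open>K1\<close> and \<open>K4\<close> depend only on \<open>a\<close>,
    \<open>b\<close> and \<open>s\<close>, so they are available before \<open>n\<close> is
    chosen.\<close>
  define k1 where "k1 = hill_sequence_q.K1 a b (int s)"
  define k4 where "k4 = hill_sequence_q.K4 a b (int s)"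
  define m where "m = max (max (max (max 3 c) (max (c\<^sup>2) (2 * k1))) (max ((2 * k4 * norm b / norm a)\<^sup>2) (c\<^sup>2 / norm b)))
    (max (max (48 * c ^ 3 / norm b) (4 * c)) (max (max (3 * c ^ 3 / norm b / (\<epsilon> / 2)\<^sup>2) (4 * c / \<epsilon>)) (real_of_int N + 1)))"
  obtain k where k: "m < real k" using reals_Archimedean2 by blast
  \<comment> \<open>An even \<open>q\<close> makes \<open>n = s q - 1\<close> odd, whatever the
    parity of \<open>s\<close>.\<close>
  define q where "q = 2 * k"
  define n where "n = int s * int q - 1"
  have "m \<ge> 3" by (simp add: m_def le_max_iff_disj)
  then have k3: "k \<ge> 4" using k by linarith
  have "3 * int q \<le> int s * int q" using assms by (intro mult_right_mono) auto
  then have qn: "int q \<le> n" using k3 by (simp add: n_def q_def)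
  have "int k \<le> n" using qn by (simp add: q_def)
  then have "real k \<le> of_int n" by linarith
  then have mn: "m < of_int n" using k by linarith
  have le: "x \<le> of_int n" if "x \<le> m" for x using that mn by simp
  have n_ge: "c \<le> of_int n" "c\<^sup>2 \<le> of_int n" "2 * k1 \<le> of_int n" "(2 * k4 * norm b / norm a)\<^sup>2 \<le> of_int n"
    "c\<^sup>2 / norm b \<le> of_int n" "48 * c ^ 3 / norm b \<le> of_int n" "4 * c \<le> of_int n"
    "3 * c ^ 3 / norm b / (\<epsilon> / 2)\<^sup>2 \<le> of_int n" "4 * c / \<epsilon> \<le> of_int n" "real_of_int N + 1 \<le> of_int n"
    by (rule le, simp add: m_def le_max_iff_disj)+
  have npos: "0 < real_of_int n" using qn k3 by (simp add: q_def)
  have "1 \<le> q" using k3 by (simp add: q_def)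
  have "int s * 3 \<le> int s * int q" using k3 by (intro mult_left_mono) (auto simp: q_def)
  then have sn: "int s < n" using assms(3) unfolding n_def by linarith
  have L: "hill_sequence_large a b (int s) n"
    by unfold_locales (use assms sn n_ge qn k3 in \<open>auto simp: c_def q_def\<close>)
  interpret hill_sequence_q a b "int s" n q
  proof -
    interpret hill_sequence_large a b "int s" n by (rule L)
    show "hill_sequence_q a b (int s) n q"
      by unfold_locales (use assms k3 in \<open>auto simp: n_def q_def\<close>)
  qed
  have c: "c0 = c" using c_eq[OF L] by simp
  have "N < n" using n_ge(10) by linarith
  moreover have "odd n" by (simp add: n_def q_def)
  moreover have "2 * k4 * norm b / norm a \<le> sqrt (of_int n)"
    using n_ge(4) real_le_rsqrt by blast
  moreover have "3 * c ^ 3 / (norm b * of_int n) \<le> (\<epsilon> / 2)\<^sup>2"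
    using n_ge(8) npos assms by (simp add: field_simps)
  moreover have "4 * c / of_int n \<le> \<epsilon>"
    using n_ge(9) npos assms by (simp add: field_simps)
  moreover have "c\<^sup>2 \<le> norm b * of_int n" "48 * c ^ 3 \<le> norm b * of_int n"
    using n_ge(5,6) assms by (simp_all add: field_simps)
  ultimately show ?thesis
    using eigenvector_exists[of \<epsilon>] n_ge(3,7) assms unfolding c k1_def k4_def by blast
qed

section \<open>Fourier coefficients\<close>

lemma measurable_I_continuous:
  fixes h :: "real \<Rightarrow> 'b::topological_space"
  assumes "continuous_on {0..pi} h"
  shows "h \<in> borel_measurable I_meas"
  using assms by (rule continuous_imp_measurable_on_sets_lebesgue) simp

lemma finite_measure_I: "finite_measure I_meas"
  by (rule finite_measure_lebesgue_on) (simp add: lmeasurable_cbox[of 0 pi, simplified])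

lemma measure_I: "measure I_meas {0..pi} = pi"
  by (simp add: measure_restrict_space)

lemma integrable_I_continuous:
  fixes h :: "real \<Rightarrow> 'b::euclidean_space"
  shows "continuous_on {0..pi} h \<Longrightarrow> integrable I_meas h"
  by (rule continuous_imp_integrable_real)

lemma integrable_I_bounded:
  fixes h :: "real \<Rightarrow> 'b::{banach, second_countable_topology}"
  assumes "h \<in> borel_measurable I_meas" "\<And>x. x \<in> {0..pi} \<Longrightarrow> norm (h x) \<le> B"
  shows "integrable I_meas h"
proof -
  interpret finite_measure I_meas by (rule finite_measure_I)
  show ?thesis using assms by (intro integrable_const_bound[of _ B]) (auto intro!: AE_I2)
qed

lemma L2_integrable:
  assumes "f \<in> L2"
  shows "integrable I_meas f"
proof (rule Bochner_Integration.integrable_bound)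
  interpret finite_measure I_meas by (rule finite_measure_I)
  show "integrable I_meas (\<lambda>x. 1 + (norm (f x))\<^sup>2)"
    using assms by (intro Bochner_Integration.integrable_add) (auto simp: L2_def)
  show "f \<in> borel_measurable I_meas" using assms by (simp add: L2_def)
  show "AE x in I_meas. norm (f x) \<le> norm (1 + (norm (f x))\<^sup>2)"
  proof (rule AE_I2)
    fix x
    have "0 \<le> (norm (f x) - 1)\<^sup>2 + (norm (f x))\<^sup>2" by simp
    then show "norm (f x) \<le> norm (1 + (norm (f x))\<^sup>2)" by (simp add: power2_diff)
  qed
qed

lemma integrable_mult_bounded:
  fixes f h :: "real \<Rightarrow> complex"
  assumes "integrable I_meas f" "h \<in> borel_measurable I_meas" "\<And>x. x \<in> {0..pi} \<Longrightarrow> norm (h x) \<le> B"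
  shows "integrable I_meas (\<lambda>x. f x * h x)"
proof (rule Bochner_Integration.integrable_bound)
  show "integrable I_meas (\<lambda>x. B * norm (f x))" using assms(1) by simp
  show "(\<lambda>x. f x * h x) \<in> borel_measurable I_meas" using assms by measurable
  show "AE x in I_meas. norm (f x * h x) \<le> norm (B * norm (f x))"
  proof (rule AE_I2)
    fix x assume "x \<in> space I_meas"
    then have "norm (h x) \<le> B" using assms(3) by simp
    then have "norm (h x) \<le> \<bar>B\<bar>" by linarith
    then show "norm (f x * h x) \<le> norm (B * norm (f x))"
      using mult_left_mono[of "norm (h x)" "\<bar>B\<bar>" "norm (f x)"] by (simp add: norm_mult abs_mult mult.commute)
  qed
qed

lemma integrable_mult_continuous:
  fixes f h :: "real \<Rightarrow> complex"
  assumes "integrable I_meas f" "continuous_on {0..pi} h"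
  shows "integrable I_meas (\<lambda>x. f x * h x)"
proof -
  have "compact (h ` {0..pi})" using assms by (intro compact_continuous_image) auto
  then obtain B where "\<And>x. x \<in> {0..pi} \<Longrightarrow> norm (h x) \<le> B"
    using compact_imp_bounded by (force simp: bounded_iff)
  then show ?thesis
    using assms by (intro integrable_mult_bounded measurable_I_continuous)
qed

text \<open>Cauchy--Schwarz through the integrated inequality
  \<open>2 * norm (f x) \<le> t * (norm (f x))\<^sup>2 + 1 / t\<close>, with \<open>t\<close> the
  inverse of the L2 norm, or arbitrarily large if that norm is zero. The constant \<open>3\<close>
  exceeds \<open>(1 + pi) / 2\<close>.\<close>

lemma integral_norm_le_L2_norm:
  assumes f: "f \<in> L2"
  shows "integral\<^sup>L I_meas (\<lambda>x. norm (f x)) \<le> 3 * L2_norm f"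
proof -
  interpret finite_measure I_meas by (rule finite_measure_I)
  define A where "A = integral\<^sup>L I_meas (\<lambda>x. (norm (f x))\<^sup>2)"
  have A0: "0 \<le> A" unfolding A_def by (intro integral_nonneg_AE) auto
  have i2: "integrable I_meas (\<lambda>x. (norm (f x))\<^sup>2)" using f by (simp add: L2_def)
  have le: "integral\<^sup>L I_meas (\<lambda>x. norm (f x)) \<le> (t * A + pi / t) / 2" if t: "t > 0" for t
  proof -
    have "integral\<^sup>L I_meas (\<lambda>x. norm (f x)) \<le> integral\<^sup>L I_meas (\<lambda>x. (t / 2) * (norm (f x))\<^sup>2 + 1 / (2 * t))"
    proof (rule integral_mono)
      show "integrable I_meas (\<lambda>x. (t / 2) * (norm (f x))\<^sup>2 + 1 / (2 * t))" using i2 by auto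
      fix x
      have "0 \<le> (t * norm (f x) - 1)\<^sup>2 / (2 * t)" using t by simp
      also have "\<dots> = (t / 2) * (norm (f x))\<^sup>2 + 1 / (2 * t) - norm (f x)"
        using t by (simp add: power2_eq_square field_simps)
      finally show "norm (f x) \<le> (t / 2) * (norm (f x))\<^sup>2 + 1 / (2 * t)" by simp
    qed (use L2_integrable[OF f] in auto)
    also have "\<dots> = (t / 2) * A + pi * (1 / (2 * t))"
      using i2 by (subst Bochner_Integration.integral_add) (simp_all add: A_def measure_I)
    finally show ?thesis by (simp add: field_simps)
  qed
  show ?thesis
  proof (cases "A = 0")
    case True
    have "integral\<^sup>L I_meas (\<lambda>x. norm (f x)) \<le> 0 + e" if "e > 0" for e
      using le[of "pi / e"] that True by (simp add: field_simps)
    then have "integral\<^sup>L I_meas (\<lambda>x. norm (f x)) \<le> 0" by (rule field_le_epsilon)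
    then show ?thesis using True by (simp add: L2_norm_def A_def)
  next
    case False
    then have s: "sqrt A > 0" using A0 by simp
    have "integral\<^sup>L I_meas (\<lambda>x. norm (f x)) \<le> (1 / sqrt A * A + pi / (1 / sqrt A)) / 2"
      using s by (intro le) simp
    also have "1 / sqrt A * A = sqrt A" using A0 s by (simp add: field_simps)
    also have "(sqrt A + pi / (1 / sqrt A)) / 2 = sqrt A * ((1 + pi) / 2)" by (simp add: field_simps)
    also have "\<dots> \<le> sqrt A * 3" using pi_less_4 s by (intro mult_left_mono) auto
    finally show ?thesis by (simp add: L2_norm_def A_def)
  qed
qed

lemma L2_add_scaled:
  assumes f: "f \<in> L2" and g: "g \<in> L2"
  shows "(\<lambda>x. f x + c * g x) \<in> L2"
proof -
  have m: "(\<lambda>x. f x + c * g x) \<in> borel_measurable I_meas" using f g by (auto simp: L2_def)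
  have "integrable I_meas (\<lambda>x. (norm (f x + c * g x))\<^sup>2)"
  proof (rule Bochner_Integration.integrable_bound)
    show "integrable I_meas (\<lambda>x. 2 * (norm (f x))\<^sup>2 + 2 * (norm c)\<^sup>2 * (norm (g x))\<^sup>2)"
      using f g by (auto simp: L2_def)
    show "AE x in I_meas. norm ((norm (f x + c * g x))\<^sup>2) \<le> norm (2 * (norm (f x))\<^sup>2 + 2 * (norm c)\<^sup>2 * (norm (g x))\<^sup>2)"
    proof (rule AE_I2)
      fix x
      have "(norm (f x + c * g x))\<^sup>2 \<le> (norm (f x) + norm (c * g x))\<^sup>2"
        by (intro power_mono norm_triangle_ineq) auto
      also have "\<dots> \<le> 2 * (norm (f x))\<^sup>2 + 2 * (norm (c * g x))\<^sup>2"
        using zero_le_power2[of "norm (f x) - norm (c * g x)"] by (simp add: power2_eq_square algebra_simps)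
      finally show "norm ((norm (f x + c * g x))\<^sup>2) \<le> norm (2 * (norm (f x))\<^sup>2 + 2 * (norm c)\<^sup>2 * (norm (g x))\<^sup>2)"
        by (simp add: norm_mult power_mult_distrib mult_ac)
    qed
  qed (use m in measurable)
  then show ?thesis using m by (simp add: L2_def)
qed

lemma L2_zero: "(\<lambda>x. 0) \<in> L2"
  by (simp add: L2_def)

lemma L2_scaled: "g \<in> L2 \<Longrightarrow> (\<lambda>x. c * g x) \<in> L2"
  using L2_add_scaled[OF L2_zero] by simp

lemma L2_sum:
  fixes N :: nat
  shows "(\<And>n. u n \<in> L2) \<Longrightarrow> (\<lambda>x. \<Sum>n<N. c n * u n x) \<in> L2"
proof (induction N)
  case (Suc N)
  then show ?case using L2_add_scaled[of "\<lambda>x. \<Sum>n<N. c n * u n x" "u N" "c N"] by simp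
qed (simp add: L2_zero)

lemma L2_bounded:
  assumes "h \<in> borel_measurable I_meas" "\<And>x. x \<in> {0..pi} \<Longrightarrow> norm (h x) \<le> B"
  shows "h \<in> L2"
proof -
  have "(\<lambda>x. (norm (h x))\<^sup>2) \<in> borel_measurable I_meas" using assms by measurable
  then have "integrable I_meas (\<lambda>x. (norm (h x))\<^sup>2)"
    by (rule integrable_I_bounded[of _ "B\<^sup>2"]) (auto intro!: power_mono assms)
  then show ?thesis using assms by (simp add: L2_def)
qed

definition ex :: "int \<Rightarrow> real \<Rightarrow> complex" where "ex k x = exp (\<i> * of_int k * of_real x)"

lemma norm_ex: "norm (ex k x) = 1"
proof -
  have "ex k x = cis (of_int k * x)" by (simp add: ex_def cis_conv_exp mult_ac)
  then show ?thesis by simp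
qed

lemma ex_add: "ex (j + k) x = ex j x * ex k x"
  by (simp add: ex_def exp_add[symmetric] algebra_simps)

lemma ex_0: "ex 0 x = 1" "ex k 0 = 1" by (simp_all add: ex_def)

lemma ex_pi: "ex k pi = (- 1) ^ nat \<bar>k\<bar>"
proof -
  have "ex k pi = cis (of_int k * pi)" by (simp add: ex_def cis_conv_exp mult_ac)
  also have "\<dots> = (- 1) ^ nat \<bar>k\<bar>"
  proof (cases "even k")
    case True
    then obtain m where m: "k = 2 * m" by (elim evenE)
    have "cis (of_int k * pi) = cis (2 * pi * of_int m)" by (simp add: m mult_ac)
    also have "\<dots> = 1" by (rule cis_multiple_2pi) simp
    finally show ?thesis using True by (simp add: even_nat_iff)
  next
    case False
    then obtain m where m: "k = 2 * m + 1" by (elim oddE)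
    have "of_int k * pi = 2 * pi * of_int m + pi" by (simp add: m algebra_simps)
    then have "cis (of_int k * pi) = cis (2 * pi * of_int m) * cis pi" by (simp only: cis_mult)
    also have "cis (2 * pi * of_int m) = 1" by (rule cis_multiple_2pi) simp
    finally show ?thesis using False by (simp add: even_nat_iff)
  qed
  finally show ?thesis .
qed

lemma ex_odd_pi: "odd k \<Longrightarrow> ex k pi = - 1"
  by (simp add: ex_pi even_nat_iff)

lemma ex_has_vector_derivative: "(ex k has_vector_derivative \<i> * of_int k * ex k x) (at x within A)"
proof -
  have "((\<lambda>t. exp (\<i> * of_int k * of_real t)) has_vector_derivative \<i> * of_int k * exp (\<i> * of_int k * of_real x)) (at x within A)"
    by (rule has_vector_derivative_real_field[THEN has_vector_derivative_at_within])
      (auto intro!: derivative_eq_intros)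
  then show ?thesis by (simp add: ex_def[abs_def])
qed

lemma continuous_ex: "continuous_on A (ex k)"
  unfolding ex_def by (intro continuous_intros)

lemma measurable_ex: "ex k \<in> borel_measurable I_meas"
  by (rule measurable_I_continuous[OF continuous_ex])

text \<open>The factor \<open>1 / pi\<close> is omitted.\<close>

definition fc :: "(real \<Rightarrow> complex) \<Rightarrow> int \<Rightarrow> complex" where
  "fc f k = integral\<^sup>L I_meas (\<lambda>x. f x * ex (- k) x)"

lemma integrable_fc: "f \<in> L2 \<Longrightarrow> integrable I_meas (\<lambda>x. f x * ex k x)"
  by (rule integrable_mult_continuous[OF L2_integrable continuous_ex])

lemma fc_le:
  assumes "f \<in> L2" shows "norm (fc f k) \<le> 3 * L2_norm f"
proof -
  have "norm (fc f k) \<le> integral\<^sup>L I_meas (\<lambda>x. norm (f x * ex (- k) x))"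
    unfolding fc_def by (rule integral_norm_bound)
  also have "\<dots> = integral\<^sup>L I_meas (\<lambda>x. norm (f x))" by (simp add: norm_mult norm_ex)
  finally show ?thesis using integral_norm_le_L2_norm[OF assms] by linarith
qed

lemma fc_add_scaled:
  assumes "f \<in> L2" "g \<in> L2"
  shows "fc (\<lambda>x. f x + c * g x) k = fc f k + c * fc g k"
proof -
  have "fc (\<lambda>x. f x + c * g x) k = integral\<^sup>L I_meas (\<lambda>x. f x * ex (- k) x + c * (g x * ex (- k) x))"
    unfolding fc_def by (simp add: algebra_simps)
  also have "\<dots> = fc f k + c * fc g k"
    unfolding fc_def using integrable_fc[OF assms(1)] integrable_fc[OF assms(2)] by simp
  finally show ?thesis .
qed

lemma fc_zero: "fc (\<lambda>x. 0) k = 0"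
  by (simp add: fc_def)

lemma fc_sum:
  fixes N :: nat
  shows "(\<And>n. u n \<in> L2) \<Longrightarrow> fc (\<lambda>x. \<Sum>n<N. c n * u n x) k = (\<Sum>n<N. c n * fc (u n) k)"
proof (induction N)
  case (Suc N)
  then show ?case
    using fc_add_scaled[OF L2_sum[of u c N] Suc.prems[of N], of "c N" k] by simp
qed (simp add: fc_zero)

lemma fc_cong:
  assumes "f \<in> borel_measurable I_meas" "g \<in> borel_measurable I_meas" "L2_eq f g"
  shows "fc f k = fc g k"
  unfolding fc_def
proof (rule integral_cong_AE)
  show "AE x in I_meas. f x * ex (- k) x = g x * ex (- k) x"
    using assms(3) unfolding L2_eq_def by eventually_elim simp
qed (use assms measurable_ex in measurable)

lemma fc_mult_ex: "fc (\<lambda>x. ex j x * f x) k = fc f (k - j)"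
proof -
  have eq: "ex j x * f x * ex (- k) x = f x * ex (- (k - j)) x" for x
    using ex_add[of j "- k" x] by (simp add: mult_ac)
  show ?thesis by (simp only: fc_def eq)
qed

text \<open>On an interval of length \<open>pi\<close> the exponential of frequency
  \<open>j - k\<close> integrates to zero only if this nonzero difference is even; hence the parity
  hypothesis.\<close>

lemma fc_ex: "even (k - j) \<Longrightarrow> fc (ex j) k = (if j = k then of_real pi else 0)"
proof -
  assume ev: "even (k - j)"
  have "fc (ex j) k = integral\<^sup>L I_meas (ex (j - k))"
    unfolding fc_def using ex_add[of j "- k"] by (intro Bochner_Integration.integral_cong) auto
  also have "\<dots> = integral {0..pi} (ex (j - k))"
    by (rule lebesgue_integral_eq_integral) (auto intro: integrable_I_continuous continuous_ex)
  finally have *: "fc (ex j) k = integral {0..pi} (ex (j - k))" .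
  show ?thesis
  proof (cases "j = k")
    case True
    then show ?thesis unfolding * by (simp add: ex_0[abs_def] scaleR_conv_of_real)
  next
    case False
    define m where "m = j - k"
    have m0: "m \<noteq> 0" "even m" using False ev by (auto simp: m_def)
    define c where "c = \<i> * (of_int m :: complex)"
    have c0: "c \<noteq> 0" using m0 by (simp add: c_def)
    have "((\<lambda>x. \<i> * of_int m * ex m x) has_integral (ex m pi - ex m 0)) {0..pi}"
      by (intro fundamental_theorem_of_calculus ex_has_vector_derivative) auto
    moreover have "ex m pi - ex m 0 = 0" using m0 by (simp add: ex_pi ex_0 even_nat_iff)
    ultimately have "((\<lambda>x. c * ex m x) has_integral 0) {0..pi}" by (simp add: c_def)
    then have "((\<lambda>x. inverse c * (c * ex m x)) has_integral inverse c * 0) {0..pi}"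
      by (rule has_integral_mult_right)
    moreover have "inverse c * (c * w) = w" for w using c0 by (simp add: field_simps)
    ultimately have "(ex m has_integral 0) {0..pi}" by simp
    then show ?thesis unfolding * using False by (simp add: m_def integral_unique)
  qed
qed

section \<open>Weak derivatives\<close>

lemma max_0_square_has_derivative:
  "((\<lambda>t::real. (max 0 t)\<^sup>2) has_real_derivative 2 * max 0 x) (at x)"
proof -
  consider "x > 0" | "x < 0" | "x = 0" by linarith
  then show ?thesis
  proof cases
    case 1
    have "((\<lambda>t::real. t\<^sup>2) has_real_derivative 2 * max 0 x) (at x)"
      using 1 by (auto intro!: derivative_eq_intros)
    then show ?thesis
      by (rule has_field_derivative_transform_within[of _ _ _ _ x]) (use 1 in \<open>auto simp: dist_real_def\<close>)
  next
    case 2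
    have "((\<lambda>t::real. 0) has_real_derivative 2 * max 0 x) (at x)"
      using 2 by (auto intro!: derivative_eq_intros)
    then show ?thesis
      by (rule has_field_derivative_transform_within[of _ _ _ _ "- x"]) (use 2 in \<open>auto simp: dist_real_def\<close>)
  next
    case 3
    have "((\<lambda>h::real. (max 0 h)\<^sup>2 / h) \<longlongrightarrow> 0) (at 0)"
    proof (rule Lim_null_comparison)
      show "\<forall>\<^sub>F h::real in at 0. norm ((max 0 h)\<^sup>2 / h) \<le> \<bar>h\<bar>"
        by (intro always_eventually) (auto simp: max_def power2_eq_square)
      show "((\<lambda>h::real. \<bar>h\<bar>) \<longlongrightarrow> 0) (at 0)" by (intro tendsto_eq_intros) auto
    qed
    then show ?thesis using 3 by (simp add: DERIV_def)
  qed
qed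

text \<open>The quadratic spline that rises from \<open>0\<close> at \<open>1\<close> to
  \<open>1\<close> at \<open>3\<close> and has the triangular function \<open>tent\<close> as
  derivative; its smoothness is exactly that of a test function.\<close>

definition smooth_step :: "real \<Rightarrow> real" where
  "smooth_step t = ((max 0 (t - 1))\<^sup>2 - 2 * (max 0 (t - 2))\<^sup>2 + (max 0 (t - 3))\<^sup>2) / 2"

definition tent :: "real \<Rightarrow> real" where
  "tent t = max 0 (t - 1) - 2 * max 0 (t - 2) + max 0 (t - 3)"

lemma smooth_step_deriv: "(smooth_step has_real_derivative tent t) (at t)"
proof -
  have *: "((\<lambda>t. (max 0 (t - c))\<^sup>2) has_real_derivative 2 * max 0 (t - c)) (at t)" for c
  proof -
    have "((\<lambda>t. (max 0 (t - c))\<^sup>2) has_real_derivative 2 * max 0 (t - c) * 1) (at t)"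
      by (rule DERIV_chain2[where f = "\<lambda>u. (max 0 u)\<^sup>2" and g = "\<lambda>t. t - c"])
        (auto intro!: max_0_square_has_derivative derivative_eq_intros)
    then show ?thesis by simp
  qed
  have "((\<lambda>t. ((max 0 (t - 1))\<^sup>2 - 2 * (max 0 (t - 2))\<^sup>2 + (max 0 (t - 3))\<^sup>2) / 2) has_real_derivative
     (2 * max 0 (t - 1) - 2 * (2 * max 0 (t - 2)) + 2 * max 0 (t - 3)) / 2) (at t)"
    by (intro DERIV_cdivide DERIV_add DERIV_diff DERIV_cmult *)
  moreover have "(2 * max 0 (t - 1) - 2 * (2 * max 0 (t - 2)) + 2 * max 0 (t - 3)) / 2 = tent t"
    by (simp add: tent_def field_simps)
  ultimately show ?thesis by (simp only: smooth_step_def[abs_def])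
qed

lemma tent_props:
  "tent t \<ge> 0" "tent t \<le> 1" "t \<le> 1 \<Longrightarrow> tent t = 0" "3 \<le> t \<Longrightarrow> tent t = 0"
  by (auto simp: tent_def max_def)

lemma continuous_tent: "continuous_on A tent"
  unfolding tent_def by (intro continuous_intros)

lemma smooth_step_props:
  "t \<le> 1 \<Longrightarrow> smooth_step t = 0" "3 \<le> t \<Longrightarrow> smooth_step t = 1"
proof -
  show "t \<le> 1 \<Longrightarrow> smooth_step t = 0" by (simp add: smooth_step_def)
  assume "3 \<le> t"
  then have "smooth_step t = ((t - 1)\<^sup>2 - 2 * (t - 2)\<^sup>2 + (t - 3)\<^sup>2) / 2"
    by (simp add: smooth_step_def)
  also have "\<dots> = 1" by (simp add: power2_eq_square algebra_simps)
  finally show "smooth_step t = 1" .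
qed

lemma smooth_step_mono: "t \<le> u \<Longrightarrow> smooth_step t \<le> smooth_step u"
  by (rule DERIV_nonneg_imp_nondecreasing) (auto intro: smooth_step_deriv tent_props)

lemma smooth_step_bounds: "0 \<le> smooth_step t" "smooth_step t \<le> 1"
proof -
  have "smooth_step (min t 1) = 0" by (rule smooth_step_props) simp
  moreover have "smooth_step (min t 1) \<le> smooth_step t" by (rule smooth_step_mono) simp
  ultimately show "0 \<le> smooth_step t" by simp
  have "smooth_step (max t 3) = 1" by (rule smooth_step_props) simp
  moreover have "smooth_step t \<le> smooth_step (max t 3)" by (rule smooth_step_mono) simp
  ultimately show "smooth_step t \<le> 1" by simp
qed

text \<open>For \<open>m \<ge> 2\<close> the transition zones at the two end points are disjoint, so
  this sum minus one is a cut-off. Its derivative is the difference of two nonnegative kernels of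
  unit mass, one concentrating at each end point.\<close>

definition bump :: "real \<Rightarrow> real \<Rightarrow> real" where
  "bump m x = smooth_step (m * x) + smooth_step (m * (pi - x)) - 1"

definition bump' :: "real \<Rightarrow> real \<Rightarrow> real" where
  "bump' m x = m * tent (m * x) - m * tent (m * (pi - x))"

lemma bump_deriv: "(bump m has_real_derivative bump' m x) (at x)"
proof -
  have "((\<lambda>x. smooth_step (m * x) + smooth_step (m * (pi - x)) - 1) has_real_derivative
     tent (m * x) * m + tent (m * (pi - x)) * (m * (0 - 1)) - 0) (at x)"
    by (intro DERIV_add DERIV_diff DERIV_chain2[OF smooth_step_deriv] DERIV_cmult DERIV_const DERIV_ident)
      (auto intro!: derivative_eq_intros)
  then show ?thesis by (simp add: bump_def[abs_def] bump'_def mult.commute)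
qed

lemma continuous_bump: "continuous_on A (bump m)"
  using DERIV_isCont[OF bump_deriv] by (simp add: continuous_at_imp_continuous_on)

lemma continuous_bump': "continuous_on A (bump' m)"
  unfolding bump'_def by (intro continuous_intros continuous_on_compose2[OF continuous_tent[of UNIV]]) auto

lemma bump_abs_le: "\<bar>bump m x\<bar> \<le> 1"
  using smooth_step_bounds[of "m * x"] smooth_step_bounds[of "m * (pi - x)"] by (auto simp: bump_def)

lemma bump_eq_0:
  assumes "m \<ge> 2" "x \<le> 1 / m \<or> pi - 1 / m \<le> x"
  shows "bump m x = 0"
proof -
  have m6: "6 \<le> m * pi" using mult_mono[of 2 m 3 pi] pi_gt3 assms by simp
  show ?thesis
    using assms(2)
  proof
    assume "x \<le> 1 / m"
    then have 1: "m * x \<le> 1" using assms(1) by (simp add: field_simps)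
    then have "3 \<le> m * (pi - x)" using m6 by (simp add: right_diff_distrib)
    then show ?thesis using 1 by (simp add: bump_def smooth_step_props)
  next
    assume "pi - 1 / m \<le> x"
    then have 1: "m * (pi - x) \<le> 1" using assms(1) by (simp add: field_simps)
    then have "3 \<le> m * x" using m6 by (simp add: right_diff_distrib)
    then show ?thesis using 1 by (simp add: bump_def smooth_step_props)
  qed
qed

lemma bump_tendsto_1:
  assumes "0 < x" "x < pi"
  shows "(\<lambda>m. bump (real m + 2) x) \<longlonglongrightarrow> 1"
proof (rule tendsto_eventually)
  define M where "M = max (3 / x) (3 / (pi - x))"
  have "\<forall>\<^sub>F m in sequentially. M \<le> real m"
    using filterlim_real_sequentially by (simp add: filterlim_at_top)
  then show "\<forall>\<^sub>F m in sequentially. bump (real m + 2) x = 1"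
  proof eventually_elim
    case (elim m)
    then have "3 / x \<le> real m + 2" "3 / (pi - x) \<le> real m + 2" by (auto simp: M_def)
    then have "3 \<le> (real m + 2) * x" "3 \<le> (real m + 2) * (pi - x)"
      using assms by (simp_all add: pos_divide_le_eq)
    then show ?case by (simp add: bump_def smooth_step_props)
  qed
qed

lemma test_function_bump:
  assumes \<phi>: "\<And>x. (\<phi> has_vector_derivative \<phi>' x) (at x)" "continuous_on UNIV \<phi>'" and m: "m \<ge> 2"
  shows "test_function (\<lambda>x. of_real (bump m x) * \<phi> x)"
    and "vector_derivative (\<lambda>x. of_real (bump m x) * \<phi> x) (at x) = of_real (bump m x) * \<phi>' x + of_real (bump' m x) * \<phi> x"
proof -
  have b: "((\<lambda>x. complex_of_real (bump m x)) has_vector_derivative of_real (bump' m x)) (at x)" for x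
    by (rule has_vector_derivative_of_real) (use bump_deriv has_real_derivative_iff_has_vector_derivative in blast)
  have d: "((\<lambda>x. of_real (bump m x) * \<phi> x) has_vector_derivative (of_real (bump m x) * \<phi>' x + of_real (bump' m x) * \<phi> x)) (at x)" for x
    by (rule has_vector_derivative_mult[OF b \<phi>(1)])
  then show "vector_derivative (\<lambda>x. of_real (bump m x) * \<phi> x) (at x) = of_real (bump m x) * \<phi>' x + of_real (bump' m x) * \<phi> x"
    by (rule vector_derivative_at)
  have c\<phi>: "continuous_on UNIV \<phi>"
    by (intro continuous_at_imp_continuous_on ballI has_vector_derivative_continuous[OF \<phi>(1)])
  have "(\<lambda>x. of_real (bump m x) * \<phi> x) C1_differentiable_on UNIV"
    unfolding C1_differentiable_on_def
    by (intro exI[of _ "\<lambda>x. of_real (bump m x) * \<phi>' x + of_real (bump' m x) * \<phi> x"] conjI ballI d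
      continuous_intros continuous_bump continuous_bump' \<phi> c\<phi>)
  moreover have "closure {x. of_real (bump m x) * \<phi> x \<noteq> 0} \<subseteq> {1 / m..pi - 1 / m}"
  proof (rule closure_minimal)
    show "{x. of_real (bump m x) * \<phi> x \<noteq> 0} \<subseteq> {1 / m..pi - 1 / m}"
    proof
      fix x assume "x \<in> {x. of_real (bump m x) * \<phi> x \<noteq> 0}"
      then have "bump m x \<noteq> 0" by auto
      then have "\<not> (x \<le> 1 / m \<or> pi - 1 / m \<le> x)" using bump_eq_0[OF m, of x] by blast
      then show "x \<in> {1 / m..pi - 1 / m}" by auto
    qed
  qed simp
  moreover have "{1 / m..pi - 1 / m} \<subseteq> {0<..<pi}"
  proof -
    have "0 < 1 / m" using m by simp
    then show ?thesis by (auto simp del: zero_less_divide_1_iff)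
  qed
  ultimately show "test_function (\<lambda>x. of_real (bump m x) * \<phi> x)"
    unfolding test_function_def by blast
qed

lemma tent_integral:
  assumes "m \<ge> 1"
  shows "integral\<^sup>L I_meas (\<lambda>x. m * tent (m * x)) = 1"
    and "integral\<^sup>L I_meas (\<lambda>x. m * tent (m * (pi - x))) = 1"
proof -
  have m3: "3 \<le> m * pi" using mult_mono[of 1 m 3 pi] pi_gt3 assms by simp
  have c1: "continuous_on {0..pi} (\<lambda>x. m * tent (m * x))" and c2: "continuous_on {0..pi} (\<lambda>x. m * tent (m * (pi - x)))"
    by (intro continuous_intros continuous_on_compose2[OF continuous_tent[of UNIV]]; simp)+
  have "((\<lambda>x. m * tent (m * x)) has_integral (smooth_step (m * pi) - smooth_step (m * 0))) {0..pi}"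
  proof (rule fundamental_theorem_of_calculus)
    fix x
    have "((\<lambda>x. smooth_step (m * x)) has_real_derivative tent (m * x) * m) (at x)"
      by (rule DERIV_chain2[OF smooth_step_deriv]) (auto intro!: derivative_eq_intros)
    then show "((\<lambda>x. smooth_step (m * x)) has_vector_derivative m * tent (m * x)) (at x within {0..pi})"
      by (simp add: has_real_derivative_iff_has_vector_derivative[symmetric] mult.commute has_field_derivative_at_within)
  qed simp
  then have "((\<lambda>x. m * tent (m * x)) has_integral 1) {0..pi}"
    using m3 by (simp add: smooth_step_props)
  then have "integral {0..pi} (\<lambda>x. m * tent (m * x)) = 1" by (rule integral_unique)
  moreover have "integral\<^sup>L I_meas (\<lambda>x. m * tent (m * x)) = integral {0..pi} (\<lambda>x. m * tent (m * x))"
    by (rule lebesgue_integral_eq_integral[OF integrable_I_continuous[OF c1]]) simp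
  ultimately show "integral\<^sup>L I_meas (\<lambda>x. m * tent (m * x)) = 1" by (simp only:)
  have "((\<lambda>x. m * tent (m * (pi - x))) has_integral (- smooth_step (m * (pi - pi)) - - smooth_step (m * (pi - 0)))) {0..pi}"
  proof (rule fundamental_theorem_of_calculus)
    fix x
    have "((\<lambda>x. smooth_step (m * (pi - x))) has_real_derivative tent (m * (pi - x)) * (- m)) (at x)"
      by (rule DERIV_chain2[OF smooth_step_deriv]) (auto intro!: derivative_eq_intros)
    then have "((\<lambda>x. - smooth_step (m * (pi - x))) has_real_derivative m * tent (m * (pi - x))) (at x)"
      by (auto intro!: derivative_eq_intros)
    then show "((\<lambda>x. - smooth_step (m * (pi - x))) has_vector_derivative m * tent (m * (pi - x))) (at x within {0..pi})"
      by (simp add: has_real_derivative_iff_has_vector_derivative[symmetric] has_field_derivative_at_within)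
  qed simp
  then have "((\<lambda>x. m * tent (m * (pi - x))) has_integral 1) {0..pi}"
    using m3 by (simp add: smooth_step_props)
  then have "integral {0..pi} (\<lambda>x. m * tent (m * (pi - x))) = 1" by (rule integral_unique)
  moreover have "integral\<^sup>L I_meas (\<lambda>x. m * tent (m * (pi - x))) = integral {0..pi} (\<lambda>x. m * tent (m * (pi - x)))"
    by (rule lebesgue_integral_eq_integral[OF integrable_I_continuous[OF c2]]) simp
  ultimately show "integral\<^sup>L I_meas (\<lambda>x. m * tent (m * (pi - x))) = 1" by (simp only:)
qed

lemma concentrating_kernel_limit:
  fixes H :: "real \<Rightarrow> complex" and K :: "nat \<Rightarrow> real \<Rightarrow> real"
  assumes H: "continuous_on {0..pi} H" and p: "p \<in> {0..pi}"
    and K: "\<And>m. continuous_on {0..pi} (K m)" "\<And>m x. 0 \<le> K m x" "\<And>m. integral\<^sup>L I_meas (K m) = 1"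
      "\<And>m x. x \<in> {0..pi} \<Longrightarrow> K m x \<noteq> 0 \<Longrightarrow> \<bar>x - p\<bar> \<le> 3 / (real m + 2)"
  shows "(\<lambda>m. integral\<^sup>L I_meas (\<lambda>x. H x * of_real (K m x))) \<longlonglongrightarrow> H p"
proof (rule LIMSEQ_I)
  fix e :: real assume "e > 0"
  then have e2: "e / 2 > 0" by simp
  obtain d where d: "d > 0" "\<And>x. x \<in> {0..pi} \<Longrightarrow> dist x p < d \<Longrightarrow> dist (H x) (H p) < e / 2"
    using H p e2 unfolding continuous_on_iff by metis
  obtain M :: nat where M: "3 / d < real M" using reals_Archimedean2 by blast
  have "norm (integral\<^sup>L I_meas (\<lambda>x. H x * of_real (K m x)) - H p) < e" if "m \<ge> M" for m
  proof -
    have ci: "integrable I_meas (\<lambda>x. H x * of_real (K m x))" "integrable I_meas (\<lambda>x. complex_of_real (K m x))"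
      by (intro integrable_I_continuous continuous_intros H K)+
    have Ki: "integrable I_meas (K m)" by (intro integrable_I_continuous K)
    have "integral\<^sup>L I_meas (\<lambda>x. complex_of_real (K m x)) = 1"
      using K(3)[of m] by (subst integral_complex_of_real) simp
    then have "integral\<^sup>L I_meas (\<lambda>x. H x * of_real (K m x)) - H p
      = integral\<^sup>L I_meas (\<lambda>x. H x * of_real (K m x)) - integral\<^sup>L I_meas (\<lambda>x. H p * of_real (K m x))"
      by simp
    also have "\<dots> = integral\<^sup>L I_meas (\<lambda>x. H x * of_real (K m x) - H p * of_real (K m x))"
      using ci by (intro Bochner_Integration.integral_diff[symmetric]) auto
    finally have eq: "integral\<^sup>L I_meas (\<lambda>x. H x * of_real (K m x)) - H p
      = integral\<^sup>L I_meas (\<lambda>x. H x * of_real (K m x) - H p * of_real (K m x))" .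
    have "norm (integral\<^sup>L I_meas (\<lambda>x. H x * of_real (K m x) - H p * of_real (K m x)))
      \<le> integral\<^sup>L I_meas (\<lambda>x. (e / 2) * K m x)"
    proof (rule Bochner_Integration.integral_norm_bound_integral)
      show "integrable I_meas (\<lambda>x. H x * of_real (K m x) - H p * of_real (K m x))" using ci by auto
      show "integrable I_meas (\<lambda>x. (e / 2) * K m x)" using Ki by auto
      fix x assume "x \<in> space I_meas"
      then have x: "x \<in> {0..pi}" by simp
      have "norm (H x - H p) * K m x \<le> e / 2 * K m x"
      proof (cases "K m x = 0")
        case False
        have "\<bar>x - p\<bar> \<le> 3 / (real m + 2)" by (rule K(4)[OF x False])
        also have "\<dots> < d"
        proof -
          have "3 / d < real m + 2" using M that by linarith
          then show ?thesis using d(1) by (simp add: field_simps)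
        qed
        finally have "dist (H x) (H p) < e / 2" using d(2)[OF x] by (simp add: dist_real_def)
        then show ?thesis using K(2)[of m x] by (intro mult_right_mono) (auto simp: dist_norm)
      qed simp
      moreover have "H x * of_real (K m x) - H p * of_real (K m x) = (H x - H p) * of_real (K m x)"
        by (simp add: algebra_simps)
      ultimately show "norm (H x * of_real (K m x) - H p * of_real (K m x)) \<le> e / 2 * K m x"
        using K(2)[of m x] by (simp add: norm_mult)
    qed
    also have "\<dots> = e / 2" using K(3)[of m] by simp
    finally show ?thesis using \<open>e > 0\<close> unfolding eq by linarith
  qed
  then show "\<exists>no. \<forall>m\<ge>no. norm (integral\<^sup>L I_meas (\<lambda>x. H x * of_real (K m x)) - H p) < e" by blast
qed

lemma bump_dominated_limit:
  assumes f: "integrable I_meas (f :: real \<Rightarrow> complex)"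
  shows "(\<lambda>m. integral\<^sup>L I_meas (\<lambda>x. f x * of_real (bump (real m + 2) x))) \<longlonglongrightarrow> integral\<^sup>L I_meas f"
proof (rule integral_dominated_convergence[where w = "\<lambda>x. norm (f x)"])
  show "f \<in> borel_measurable I_meas" using f by auto
  have "(\<lambda>x. complex_of_real (bump (real m + 2) x)) \<in> borel_measurable I_meas" for m
    by (intro measurable_I_continuous continuous_intros continuous_bump)
  then show "(\<lambda>x. f x * of_real (bump (real m + 2) x)) \<in> borel_measurable I_meas" for m
    using f by measurable
  show "integrable I_meas (\<lambda>x. norm (f x))" using f by auto
  show "AE x in I_meas. (\<lambda>m. f x * of_real (bump (real m + 2) x)) \<longlonglongrightarrow> f x"
  proof -
    have "AE x in lebesgue. x \<notin> {0, pi}" by (rule AE_not_in) (simp add: negligible_iff_null_sets[symmetric])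
    then have "AE x in I_meas. x \<notin> {0, pi}" by (subst AE_restrict_space_iff) auto
    then show ?thesis
    proof (rule AE_mp, intro AE_I2 impI)
      fix x assume "x \<in> space I_meas" "x \<notin> {0, pi}"
      then have "0 < x" "x < pi" by auto
      then have "(\<lambda>m. f x * of_real (bump (real m + 2) x)) \<longlonglongrightarrow> f x * of_real 1"
        by (intro tendsto_intros bump_tendsto_1)
      then show "(\<lambda>m. f x * of_real (bump (real m + 2) x)) \<longlonglongrightarrow> f x" by simp
    qed
  qed
  show "AE x in I_meas. norm (f x * of_real (bump (real m + 2) x)) \<le> norm (f x)" for m
    using bump_abs_le by (auto simp: norm_mult intro!: AE_I2 mult_left_le)
qed

text \<open>Testing against \<open>bump * \<phi>\<close> and letting the cut-off tend to one, the
  derivative of the cut-off leaves the boundary values of the continuous representative times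
  \<open>\<phi>\<close>. They agree at \<open>0\<close> and \<open>pi\<close>, since both factors
  change sign, and cancel.\<close>

lemma weak_deriv_antiperiodic:
  assumes wd: "weak_deriv f g" and ap: "antiperiodic f"
    and \<phi>: "\<And>x. (\<phi> has_vector_derivative \<phi>' x) (at x)" "continuous_on UNIV \<phi>'" "\<phi> pi = - \<phi> 0"
  shows "integral\<^sup>L I_meas (\<lambda>x. f x * \<phi>' x) = - integral\<^sup>L I_meas (\<lambda>x. g x * \<phi> x)"
proof -
  obtain F where F: "continuous_on {0..pi} F" "L2_eq f F" "F pi = - F 0"
    using ap unfolding antiperiodic_def by blast
  have fg: "f \<in> L2" "g \<in> L2" using wd by (auto simp: weak_deriv_def)
  have c\<phi>: "continuous_on A \<phi>" for A
    by (intro continuous_at_imp_continuous_on ballI has_vector_derivative_continuous[OF \<phi>(1)])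
  have c\<phi>': "continuous_on A \<phi>'" for A using \<phi>(2) continuous_on_subset by blast
  define H where "H x = F x * \<phi> x" for x
  have H: "continuous_on {0..pi} H" unfolding H_def by (intro continuous_intros F c\<phi>)
  define k1 k2 where "k1 m x = (real m + 2) * tent ((real m + 2) * x)"
    and "k2 m x = (real m + 2) * tent ((real m + 2) * (pi - x))" for m :: nat and x
  have ck: "continuous_on A (k1 m)" "continuous_on A (k2 m)" for A m
    unfolding k1_def k2_def by (intro continuous_intros continuous_on_compose2[OF continuous_tent[of UNIV]]; simp)+
  have supp: "\<bar>t\<bar> \<le> 3 / (real m + 2)" if "tent ((real m + 2) * t) \<noteq> 0" for t m
  proof -
    have "1 \<le> (real m + 2) * t" "(real m + 2) * t \<le> 3" using that tent_props(3,4)[of "(real m + 2) * t"] by force+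
    then have "0 \<le> t" "t \<le> 3 / (real m + 2)"
      using zero_less_mult_iff[of "real m + 2" t] by (auto simp: field_simps)
    then show ?thesis by simp
  qed
  have K1: "integral\<^sup>L I_meas (k1 m) = 1" and K2: "integral\<^sup>L I_meas (k2 m) = 1" for m
    unfolding k1_def[abs_def] k2_def[abs_def] by (rule tent_integral; simp)+
  have L1: "(\<lambda>m. integral\<^sup>L I_meas (\<lambda>x. H x * of_real (k1 m x))) \<longlonglongrightarrow> H 0"
  proof (rule concentrating_kernel_limit[OF H _ ck(1) _ K1])
    show "\<bar>x - 0\<bar> \<le> 3 / (real m + 2)" if "k1 m x \<noteq> 0" for m x
      using supp[of m x] that by (simp add: k1_def)
  qed (simp_all add: k1_def tent_props)
  have L2: "(\<lambda>m. integral\<^sup>L I_meas (\<lambda>x. H x * of_real (k2 m x))) \<longlonglongrightarrow> H pi"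
  proof (rule concentrating_kernel_limit[OF H _ ck(2) _ K2])
    show "\<bar>x - pi\<bar> \<le> 3 / (real m + 2)" if "k2 m x \<noteq> 0" for m x
      using supp[of m "pi - x"] that by (simp add: k2_def abs_minus_commute)
  qed (simp_all add: k2_def tent_props)
  have "H pi = H 0" using F(3) \<phi>(3) by (simp add: H_def)
  then have lim0: "(\<lambda>m. integral\<^sup>L I_meas (\<lambda>x. H x * of_real (k1 m x)) - integral\<^sup>L I_meas (\<lambda>x. H x * of_real (k2 m x))) \<longlonglongrightarrow> 0"
    using tendsto_diff[OF L1 L2] by simp
  have if': "integrable I_meas (\<lambda>x. f x * \<phi>' x)" and ig: "integrable I_meas (\<lambda>x. g x * \<phi> x)"
    by (intro integrable_mult_continuous L2_integrable fg c\<phi> c\<phi>')+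
  have eq: "integral\<^sup>L I_meas (\<lambda>x. f x * \<phi>' x * of_real (bump (real m + 2) x))
      + (integral\<^sup>L I_meas (\<lambda>x. H x * of_real (k1 m x)) - integral\<^sup>L I_meas (\<lambda>x. H x * of_real (k2 m x)))
      = - integral\<^sup>L I_meas (\<lambda>x. g x * \<phi> x * of_real (bump (real m + 2) x))" for m
  proof -
    define \<mu> where "\<mu> = real m + 2"
    have \<mu>: "\<mu> \<ge> 2" by (simp add: \<mu>_def)
    note tf = test_function_bump[OF \<phi>(1,2) \<mu>]
    have i1: "integrable I_meas (\<lambda>x. f x * \<phi>' x * of_real (bump \<mu> x))"
      by (intro integrable_mult_continuous if' continuous_intros continuous_bump)
    have i2: "integrable I_meas (\<lambda>x. f x * (of_real (bump' \<mu> x) * \<phi> x))"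
      by (intro integrable_mult_continuous L2_integrable fg continuous_intros continuous_bump' c\<phi>)
    have i3: "integrable I_meas (\<lambda>x. H x * of_real (k1 m x))" "integrable I_meas (\<lambda>x. H x * of_real (k2 m x))"
      by (intro integrable_I_continuous continuous_intros H ck)+
    have "integral\<^sup>L I_meas (\<lambda>x. f x * vector_derivative (\<lambda>x. of_real (bump \<mu> x) * \<phi> x) (at x))
       = - integral\<^sup>L I_meas (\<lambda>x. g x * (of_real (bump \<mu> x) * \<phi> x))"
      using wd tf(1) unfolding weak_deriv_def by blast
    then have "integral\<^sup>L I_meas (\<lambda>x. f x * (of_real (bump \<mu> x) * \<phi>' x + of_real (bump' \<mu> x) * \<phi> x))
       = - integral\<^sup>L I_meas (\<lambda>x. g x * (of_real (bump \<mu> x) * \<phi> x))"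
      by (simp only: tf(2))
    also have "(\<lambda>x. f x * (of_real (bump \<mu> x) * \<phi>' x + of_real (bump' \<mu> x) * \<phi> x))
       = (\<lambda>x. f x * \<phi>' x * of_real (bump \<mu> x) + f x * (of_real (bump' \<mu> x) * \<phi> x))"
      by (simp add: fun_eq_iff algebra_simps)
    also have "integral\<^sup>L I_meas \<dots> = integral\<^sup>L I_meas (\<lambda>x. f x * \<phi>' x * of_real (bump \<mu> x))
       + integral\<^sup>L I_meas (\<lambda>x. f x * (of_real (bump' \<mu> x) * \<phi> x))"
      by (rule Bochner_Integration.integral_add[OF i1 i2])
    also have "integral\<^sup>L I_meas (\<lambda>x. f x * (of_real (bump' \<mu> x) * \<phi> x))
       = integral\<^sup>L I_meas (\<lambda>x. H x * of_real (k1 m x) - H x * of_real (k2 m x))"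
    proof (rule integral_cong_AE)
      show "AE x in I_meas. f x * (of_real (bump' \<mu> x) * \<phi> x) = H x * of_real (k1 m x) - H x * of_real (k2 m x)"
        using F(2) unfolding L2_eq_def
        by eventually_elim (simp add: H_def bump'_def k1_def k2_def \<mu>_def algebra_simps)
    qed (use i2 i3 in auto)
    also have "\<dots> = integral\<^sup>L I_meas (\<lambda>x. H x * of_real (k1 m x)) - integral\<^sup>L I_meas (\<lambda>x. H x * of_real (k2 m x))"
      by (rule Bochner_Integration.integral_diff[OF i3])
    finally show ?thesis by (simp add: \<mu>_def mult_ac)
  qed
  have "(\<lambda>m. integral\<^sup>L I_meas (\<lambda>x. f x * \<phi>' x * of_real (bump (real m + 2) x))
      + (integral\<^sup>L I_meas (\<lambda>x. H x * of_real (k1 m x)) - integral\<^sup>L I_meas (\<lambda>x. H x * of_real (k2 m x))))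
      \<longlonglongrightarrow> integral\<^sup>L I_meas (\<lambda>x. f x * \<phi>' x) + 0"
    by (intro tendsto_add bump_dominated_limit if' lim0)
  moreover have "(\<lambda>m. - integral\<^sup>L I_meas (\<lambda>x. g x * \<phi> x * of_real (bump (real m + 2) x)))
      \<longlonglongrightarrow> - integral\<^sup>L I_meas (\<lambda>x. g x * \<phi> x)"
    by (intro tendsto_minus bump_dominated_limit ig)
  ultimately show ?thesis unfolding eq using LIMSEQ_unique by fastforce
qed

lemma fc_weak_deriv:
  assumes wd: "weak_deriv f g" and ap: "antiperiodic f" and k: "odd k"
  shows "fc g k = \<i> * of_int k * fc f k"
proof -
  have "integral\<^sup>L I_meas (\<lambda>x. f x * (\<i> * of_int (- k) * ex (- k) x)) = - integral\<^sup>L I_meas (\<lambda>x. g x * ex (- k) x)"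
    using k by (intro weak_deriv_antiperiodic[OF wd ap] ex_has_vector_derivative continuous_intros continuous_ex)
      (auto simp: ex_odd_pi ex_0)
  moreover have "integral\<^sup>L I_meas (\<lambda>x. f x * (c * ex (- k) x)) = c * fc f k" for c
    unfolding fc_def integral_mult_right_zero[symmetric] by (simp only: mult.left_commute)
  ultimately have "(\<i> * of_int (- k)) * fc f k = - fc g k"
    unfolding fc_def[of g] by simp
  then show ?thesis by simp
qed

text \<open>Two uses of \<open>fc_weak_deriv\<close>, for \<open>y\<close> and for its derivative,
  turn the second derivative into the square of the frequency, and the two exponentials of the
  potential shift the frequency by \<open>- 2\<close> and \<open>2 s\<close>. For odd
  \<open>k\<close> the exponential is antiperiodic.\<close>

lemma fc_hill_graph:
  fixes a b :: complex and s :: nat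
  assumes v: "v = (\<lambda>x. a * exp (- 2 * \<i> * of_real x) + b * exp (2 * \<i> * of_nat s * of_real x))"
    and yw: "(y, w) \<in> hill_graph v \<mu>"
  shows "y \<in> L2" "w \<in> L2"
    and "odd k \<Longrightarrow> fc w k = ((of_int k)\<^sup>2 - \<mu>) * fc y k + a * fc y (k + 2) + b * fc y (k - 2 * int s)"
proof -
  obtain g h where gh: "w \<in> L2" "weak_deriv y g" "weak_deriv g h" "antiperiodic y" "antiperiodic g"
    "L2_eq w (\<lambda>x. - h x + v x * y x - \<mu> * y x)"
    using yw by (auto simp: hill_graph_def)
  have L: "y \<in> L2" "h \<in> L2" using gh by (auto simp: weak_deriv_def)
  then show "y \<in> L2" "w \<in> L2" using gh by auto
  assume k: "odd k"
  have v_ex: "v x = a * ex (- 2) x + b * ex (2 * int s) x" for x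
    by (simp add: v ex_def mult_ac)
  have exL: "(\<lambda>x. ex j x * y x) \<in> L2" for j
    using L(1) measurable_ex[of j] by (auto simp: L2_def norm_mult norm_ex intro: borel_measurable_times)
  have eq: "- h x + v x * y x - \<mu> * y x
    = (((0 + (- 1) * h x) + a * (ex (- 2) x * y x)) + b * (ex (2 * int s) x * y x)) + (- \<mu>) * y x" for x
    by (simp add: v_ex algebra_simps)
  note LL = L2_add_scaled[OF L2_zero L(2), of "- 1"]
  note LL1 = L2_add_scaled[OF LL exL[of "- 2"], of a]
  note LL2 = L2_add_scaled[OF LL1 exL[of "2 * int s"], of b]
  note LL3 = L2_add_scaled[OF LL2 L(1), of "- \<mu>"]
  have "fc w k = fc (\<lambda>x. - h x + v x * y x - \<mu> * y x) k"
    using gh(1,6) LL3 unfolding eq by (intro fc_cong) (auto simp: L2_def)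
  also have "\<dots> = - fc h k + a * fc y (k + 2) + b * fc y (k - 2 * int s) - \<mu> * fc y k"
    unfolding eq by (simp only: fc_add_scaled LL LL1 LL2 L L2_zero exL fc_zero fc_mult_ex) simp
  also have "fc h k = \<i> * of_int k * (\<i> * of_int k * fc y k)"
    using fc_weak_deriv[OF gh(2,4) k] fc_weak_deriv[OF gh(3,5) k] by simp
  also have "- (\<i> * of_int k * (\<i> * of_int k * fc y k)) = (of_int k)\<^sup>2 * fc y k"
    by (simp add: power2_eq_square mult_ac)
  finally show "fc w k = ((of_int k)\<^sup>2 - \<mu>) * fc y k + a * fc y (k + 2) + b * fc y (k - 2 * int s)"
    by (simp add: algebra_simps)
qed

section \<open>Completeness of the exponentials\<close>

text \<open>
  The circle is the quotient of \<open>[0, pi]\<close> under \<open>x \<mapsto> exp (2 \<i> x)\<close>; the real part of a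
  point determines \<open>x\<close> up to the reflection \<open>x \<mapsto> pi - x\<close>, the sign of the imaginary part decides.
\<close>

lemma periodic_continuous_factors_through_circle:
  fixes h :: "real \<Rightarrow> real"
  assumes h: "continuous_on {0..pi} h" "h 0 = h pi"
  obtains \<psi> :: "complex \<Rightarrow> real" where "continuous_on (sphere 0 1) \<psi>" "\<And>x. x \<in> {0..pi} \<Longrightarrow> \<psi> (ex 2 x) = h x"
proof
  define \<psi> where "\<psi> w = (if - Im w \<le> 0 then h (arccos (Re w) / 2) else h (pi - arccos (Re w) / 2))" for w
  have sub: "w \<in> sphere 0 1 \<Longrightarrow> -1 \<le> Re w \<and> Re w \<le> 1" for w
    using abs_Re_le_cmod[of w] by auto
  have c1: "continuous_on (sphere 0 1) (\<lambda>w. arccos (Re w) / 2)"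
    using sub by (intro continuous_intros) auto
  have r1: "w \<in> sphere 0 1 \<Longrightarrow> arccos (Re w) / 2 \<in> {0..pi / 2}" for w
    using sub[of w] arccos_bounded[of "Re w"] by auto
  show "continuous_on (sphere 0 1) \<psi>"
    unfolding \<psi>_def
  proof (rule continuous_on_cases_le)
    show "continuous_on {t \<in> sphere 0 1. - Im t \<le> 0} (\<lambda>w. h (arccos (Re w) / 2))"
      by (rule continuous_on_compose2[OF h(1) continuous_on_subset[OF c1]]) (use r1 pi_gt_zero in fastforce)+
    show "continuous_on {t \<in> sphere 0 1. 0 \<le> - Im t} (\<lambda>w. h (pi - arccos (Re w) / 2))"
      by (rule continuous_on_compose2[OF h(1) continuous_on_diff[OF continuous_on_const continuous_on_subset[OF c1]]])
        (use r1 pi_gt_zero in fastforce)+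
    show "continuous_on (sphere 0 1) (\<lambda>t. - Im t)" by (intro continuous_intros)
    fix w :: complex assume w: "w \<in> sphere 0 1" "- Im w = 0"
    then have "(Re w)\<^sup>2 = 1" using cmod_power2[of w] by simp
    then have "Re w = 1 \<or> Re w = - 1" by (simp add: power2_eq_1_iff)
    then show "h (arccos (Re w) / 2) = h (pi - arccos (Re w) / 2)"
      using h(2) by auto
  qed
  fix x assume x: "x \<in> {0..pi}"
  have e: "Re (ex 2 x) = cos (2 * x)" "Im (ex 2 x) = sin (2 * x)"
    by (simp_all add: ex_def exp_eq_polar cis.ctr Re_exp Im_exp)
  consider "x \<le> pi / 2" | "pi / 2 < x" "x < pi" | "x = pi" using x by fastforce
  then show "\<psi> (ex 2 x) = h x"
  proof cases
    case 1
    then have "sin (2 * x) \<ge> 0" using x by (intro sin_ge_zero) auto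
    moreover have "arccos (cos (2 * x)) = 2 * x" using 1 x by (intro arccos_cos) auto
    ultimately show ?thesis by (simp add: \<psi>_def e)
  next
    case 2
    have "sin (2 * x) < 0"
      using 2 sin_gt_zero[of "2 * x - pi"] by (simp add: sin_diff)
    moreover have "arccos (cos (2 * x)) = 2 * pi - 2 * x"
    proof -
      have "cos (2 * x) = cos (2 * pi - 2 * x)" by (simp add: cos_diff)
      then show ?thesis using 2 by (simp only:) (intro arccos_cos; simp)
    qed
    moreover have "pi - (2 * pi - 2 * x) / 2 = x" by (simp add: field_simps)
    ultimately show ?thesis by (simp add: \<psi>_def e)
  next
    case 3
    then show ?thesis using h(2) by (simp add: \<psi>_def ex_pi)
  qed
qed

text \<open>The functions \<open>h\<close> for which \<open>g h\<close> is orthogonal to every even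
  exponential form a space closed under multiplication by \<open>ex 2\<close> and
  \<open>ex (- 2)\<close>. Multiplication by any polynomial in the real and imaginary parts of
  \<open>ex 2 x\<close> therefore preserves it; including all shifts \<open>j\<close> makes the
  induction work for products.\<close>

lemma orthogonal_to_polynomials:
  fixes g :: "real \<Rightarrow> complex" and P :: "complex \<Rightarrow> real"
  assumes g: "integrable I_meas g"
    and orth: "\<And>j. integral\<^sup>L I_meas (\<lambda>x. g x * ex (2 * j) x) = 0"
    and P: "real_polynomial_function P"
  shows "integral\<^sup>L I_meas (\<lambda>x. g x * of_real (P (ex 2 x))) = 0"
proof -
  define V where "V = {h :: real \<Rightarrow> complex. continuous_on UNIV h \<and> (\<forall>j. integral\<^sup>L I_meas (\<lambda>x. g x * (h x * ex (2 * j) x)) = 0)}"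
  have int: "integrable I_meas (\<lambda>x. g x * (h x * ex j x))" if "continuous_on UNIV h" for h j
    using g that by (intro integrable_mult_continuous continuous_intros continuous_ex) (auto intro: continuous_on_subset)
  have V_add: "(\<lambda>x. h x + h' x) \<in> V" if "h \<in> V" "h' \<in> V" for h h'
  proof -
    have "g x * ((h x + h' x) * ex (2 * j) x) = g x * (h x * ex (2 * j) x) + g x * (h' x * ex (2 * j) x)" for x j
      by (simp add: algebra_simps)
    then show ?thesis using that int by (auto simp: V_def intro!: continuous_intros)
  qed
  have V_scale: "(\<lambda>x. c * h x) \<in> V" if "h \<in> V" for h c
  proof -
    have eq: "g x * (c * h x * ex (2 * j) x) = c * (g x * (h x * ex (2 * j) x))" for x j by (simp add: mult_ac)
    show ?thesis using that by (auto simp: V_def eq intro!: continuous_intros)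
  qed
  have V_shift: "(\<lambda>x. ex (2 * m) x * h x) \<in> V" if "h \<in> V" for h m
  proof -
    have eq: "g x * (ex (2 * m) x * h x * ex (2 * j) x) = g x * (h x * ex (2 * (m + j)) x)" for x j
      using ex_add[of "2 * m" "2 * j" x] by (simp add: mult_ac distrib_left)
    have "continuous_on UNIV h" "\<And>j. integral\<^sup>L I_meas (\<lambda>x. g x * (h x * ex (2 * j) x)) = 0"
      using that by (auto simp: V_def)
    then show ?thesis unfolding V_def mem_Collect_eq eq
      by (intro conjI allI continuous_on_mult continuous_ex)
  qed
  have "\<forall>h\<in>V. (\<lambda>x. of_real (P (ex 2 x)) * h x) \<in> V"
    using P
  proof induction
    case (linear f)
    show ?case
    proof
      fix h assume h: "h \<in> V"
      interpret bounded_linear f by (rule linear)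
      \<comment> \<open>A real-linear function of \<open>w\<close> is a combination of
        \<open>w\<close> and its conjugate, and on the circle the conjugate of \<open>ex 2 x\<close>
        is \<open>ex (- 2) x\<close>.\<close>
      define u where "u = (of_real (f 1) - \<i> * of_real (f \<i>)) / (2 :: complex)"
      have fw: "complex_of_real (f w) = u * w + cnj u * cnj w" for w
      proof -
        have "w = Re w *\<^sub>R 1 + Im w *\<^sub>R \<i>" by (simp add: complex_eq_iff)
        then have "f w = f (Re w *\<^sub>R 1 + Im w *\<^sub>R \<i>)" by (rule arg_cong)
        also have "\<dots> = Re w * f 1 + Im w * f \<i>" by (simp only: add scaleR real_scaleR_def)
        finally have "f w = Re w * f 1 + Im w * f \<i>" .
        then show ?thesis by (simp add: u_def complex_eq_iff field_simps)
      qed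
      have "cnj (ex 2 x) = ex (- 2) x" for x
        by (simp add: ex_def exp_cnj)
      then have "of_real (f (ex 2 x)) * h x = u * (ex (2 * 1) x * h x) + cnj u * (ex (2 * (- 1)) x * h x)" for x
        unfolding fw by (simp add: algebra_simps)
      then show "(\<lambda>x. of_real (f (ex 2 x)) * h x) \<in> V"
        using V_add[OF V_scale[OF V_shift[OF h, of 1], of u] V_scale[OF V_shift[OF h, of "- 1"], of "cnj u"]] by simp
    qed
  next
    case (const c)
    then show ?case using V_scale by auto
  next
    case (add f g)
    have "(\<lambda>x. of_real (f (ex 2 x) + g (ex 2 x)) * h x) \<in> V" if "h \<in> V" for h
      using V_add[of "\<lambda>x. of_real (f (ex 2 x)) * h x" "\<lambda>x. of_real (g (ex 2 x)) * h x"] add that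
      by (simp add: distrib_right)
    then show ?case by blast
  next
    case (mult f g)
    have "(\<lambda>x. of_real (f (ex 2 x) * g (ex 2 x)) * h x) \<in> V" if h: "h \<in> V" for h
    proof -
      have "(\<lambda>x. of_real (g (ex 2 x)) * h x) \<in> V" using mult h by blast
      then have "(\<lambda>x. of_real (f (ex 2 x)) * (of_real (g (ex 2 x)) * h x)) \<in> V"
        by (rule mult.IH(1)[THEN bspec])
      then show ?thesis by (simp only: of_real_mult mult.assoc)
    qed
    then show ?case by blast
  qed
  moreover have "(\<lambda>x. 1) \<in> V" using orth by (simp add: V_def)
  ultimately have "(\<lambda>x. of_real (P (ex 2 x)) * 1) \<in> V" by (rule bspec)
  then have "integral\<^sup>L I_meas (\<lambda>x. g x * (of_real (P (ex 2 x)) * 1 * ex (2 * j) x)) = 0" for j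
    by (simp add: V_def)
  from this[of 0] show ?thesis by (simp add: ex_0)
qed

text \<open>Stone--Weierstrass on the circle: a polynomial uniformly within \<open>e\<close> of the
  function changes the integral by at most \<open>e\<close> times the integral of
  \<open>norm (g x)\<close>.\<close>

lemma orthogonal_to_periodic_real:
  fixes g :: "real \<Rightarrow> complex" and h :: "real \<Rightarrow> real"
  assumes g: "integrable I_meas g"
    and orth: "\<And>j. integral\<^sup>L I_meas (\<lambda>x. g x * ex (2 * j) x) = 0"
    and h: "continuous_on {0..pi} h" "h 0 = h pi"
  shows "integral\<^sup>L I_meas (\<lambda>x. g x * of_real (h x)) = 0"
proof -
  obtain \<psi> where \<psi>: "continuous_on (sphere 0 1) \<psi>" "\<And>x. x \<in> {0..pi} \<Longrightarrow> \<psi> (ex 2 x) = h x"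
    using periodic_continuous_factors_through_circle[OF h] by metis
  define C where "C = integral\<^sup>L I_meas (\<lambda>x. norm (g x))"
  have gh: "integrable I_meas (\<lambda>x. g x * of_real (h x))"
    by (intro integrable_mult_continuous g continuous_intros h)
  have le: "norm (integral\<^sup>L I_meas (\<lambda>x. g x * of_real (h x))) \<le> e * C" if "e > 0" for e
  proof -
    obtain P where P: "real_polynomial_function P" "\<And>w. w \<in> sphere 0 1 \<Longrightarrow> \<bar>\<psi> w - P w\<bar> < e"
      by (rule Stone_Weierstrass_real_polynomial_function[OF compact_sphere \<psi>(1) \<open>e > 0\<close>]) blast
    have "continuous_on UNIV P"
      using continuous_real_polymonial_function[OF P(1)] by (simp add: continuous_at_imp_continuous_on)
    then have "continuous_on {0..pi} (\<lambda>x. P (ex 2 x))"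
      by (rule continuous_on_compose2[OF _ continuous_ex]) auto
    then have gP: "integrable I_meas (\<lambda>x. g x * of_real (P (ex 2 x)))"
      by (intro integrable_mult_continuous g continuous_intros)
    have "integral\<^sup>L I_meas (\<lambda>x. g x * of_real (h x)) = integral\<^sup>L I_meas (\<lambda>x. g x * of_real (h x)) - integral\<^sup>L I_meas (\<lambda>x. g x * of_real (P (ex 2 x)))"
      using orthogonal_to_polynomials[OF g orth P(1)] by simp
    also have "\<dots> = integral\<^sup>L I_meas (\<lambda>x. g x * of_real (h x) - g x * of_real (P (ex 2 x)))"
      by (rule Bochner_Integration.integral_diff[symmetric, OF gh gP])
    finally have eq: "integral\<^sup>L I_meas (\<lambda>x. g x * of_real (h x)) = integral\<^sup>L I_meas (\<lambda>x. g x * of_real (h x) - g x * of_real (P (ex 2 x)))" .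
    have "norm (integral\<^sup>L I_meas (\<lambda>x. g x * of_real (h x) - g x * of_real (P (ex 2 x)))) \<le> integral\<^sup>L I_meas (\<lambda>x. e * norm (g x))"
    proof (rule Bochner_Integration.integral_norm_bound_integral)
      show "integrable I_meas (\<lambda>x. g x * of_real (h x) - g x * of_real (P (ex 2 x)))" using gh gP by auto
      show "integrable I_meas (\<lambda>x. e * norm (g x))" using g by auto
      fix x assume "x \<in> space I_meas"
      then have "\<bar>h x - P (ex 2 x)\<bar> < e" using P(2)[of "ex 2 x"] \<psi>(2)[of x] norm_ex[of 2 x] by auto
      then have "norm (g x) * \<bar>h x - P (ex 2 x)\<bar> \<le> norm (g x) * e" by (intro mult_left_mono) auto
      moreover have "g x * of_real (h x) - g x * of_real (P (ex 2 x)) = g x * of_real (h x - P (ex 2 x))"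
        by (simp add: algebra_simps)
      ultimately show "norm (g x * of_real (h x) - g x * of_real (P (ex 2 x))) \<le> e * norm (g x)"
        by (simp only: norm_mult norm_of_real mult.commute)
    qed
    then show ?thesis unfolding eq by (simp add: C_def)
  qed
  have C0: "0 \<le> C" unfolding C_def by (intro integral_nonneg_AE) auto
  have "norm (integral\<^sup>L I_meas (\<lambda>x. g x * of_real (h x))) \<le> 0 + d" if "d > 0" for d
  proof -
    have "norm (integral\<^sup>L I_meas (\<lambda>x. g x * of_real (h x))) \<le> d / (C + 1) * C"
      using that C0 by (intro le) auto
    also have "\<dots> \<le> d" using that C0 by (simp add: field_simps)
    finally show ?thesis by simp
  qed
  then have "norm (integral\<^sup>L I_meas (\<lambda>x. g x * of_real (h x))) \<le> 0" by (rule field_le_epsilon)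
  then show ?thesis by simp
qed

lemma orthogonal_to_periodic:
  fixes g h :: "real \<Rightarrow> complex"
  assumes g: "integrable I_meas g"
    and orth: "\<And>j. integral\<^sup>L I_meas (\<lambda>x. g x * ex (2 * j) x) = 0"
    and h: "continuous_on {0..pi} h" "h 0 = h pi"
  shows "integral\<^sup>L I_meas (\<lambda>x. g x * h x) = 0"
proof -
  have c: "continuous_on {0..pi} (\<lambda>x. Re (h x))" "continuous_on {0..pi} (\<lambda>x. Im (h x))"
    by (intro continuous_intros h)+
  have i: "integrable I_meas (\<lambda>x. g x * of_real (Re (h x)))" "integrable I_meas (\<lambda>x. g x * of_real (Im (h x)))"
    by (intro integrable_mult_continuous g continuous_intros c)+
  have z: "integral\<^sup>L I_meas (\<lambda>x. g x * of_real (Re (h x))) = 0" "integral\<^sup>L I_meas (\<lambda>x. g x * of_real (Im (h x))) = 0"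
    using h(2) by (intro orthogonal_to_periodic_real[OF g orth] c; simp)+
  have "g x * h x = g x * of_real (Re (h x)) + \<i> * (g x * of_real (Im (h x)))" for x
    by (subst (1) complex_eq[of "h x"]) (simp add: algebra_simps)
  then have "integral\<^sup>L I_meas (\<lambda>x. g x * h x) = integral\<^sup>L I_meas (\<lambda>x. g x * of_real (Re (h x)) + \<i> * (g x * of_real (Im (h x))))"
    by simp
  also have "\<dots> = 0" using i z by simp
  finally show ?thesis .
qed

text \<open>Testing \<open>g\<close> against its conjugate phase \<open>t\<close> would give the
  integral of \<open>norm (g x)\<close>. As \<open>t\<close> is only measurable, it is approximated
  almost everywhere by continuous functions that vanish at both end points and are bounded by
  \<open>1\<close>, so that dominated convergence applies.\<close>

lemma trigonometric_system_complete:
  assumes g: "integrable I_meas g"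
    and orth: "\<And>j. integral\<^sup>L I_meas (\<lambda>x. g x * ex (2 * j) x) = 0"
  shows "AE x in I_meas. g x = 0"
proof -
  define t where "t x = cnj (g x) / of_real (norm (g x))" for x
  have gm: "g \<in> borel_measurable I_meas" using g by auto
  have "(\<lambda>x. cnj (g x)) \<in> borel_measurable I_meas"
    by (rule borel_measurable_continuous_on[OF _ gm]) (intro continuous_intros)
  then have "t \<in> borel_measurable I_meas"
    unfolding t_def using gm by measurable
  then have "t measurable_on {0..pi}"
    by (subst measurable_on_iff_borel_measurable) auto
  then obtain N h where N: "negligible N" and h: "\<And>n. continuous_on UNIV (h n)"
    and lim: "\<And>x. x \<notin> N \<Longrightarrow> (\<lambda>n. h n x) \<longlonglongrightarrow> (if x \<in> {0..pi} then t x else 0)"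
    unfolding measurable_on_def by metis
  \<comment> \<open>The factor \<open>c n\<close> vanishes at \<open>0\<close> and
    \<open>pi\<close>, which makes \<open>H n\<close> periodic, and tends to \<open>1\<close>
    inside; the division in \<open>H\<close> retracts the values to the unit disc, where
    \<open>t\<close> takes its values.\<close>
  define c where "c n x = max 0 (min 1 (min (real n * x) (real n * (pi - x))))" for n :: nat and x :: real
  define H where "H n x = of_real (c n x) * (h n x / of_real (max 1 (norm (h n x))))" for n x
  have cH: "continuous_on {0..pi} (H n)" for n
    unfolding H_def c_def
    by (intro continuous_intros continuous_on_subset[OF h]) auto
  have bH: "norm (H n x) \<le> 1" for n x
  proof -
    have "norm (h n x / of_real (max 1 (norm (h n x)))) \<le> 1"
      by (simp add: norm_divide divide_le_eq)
    moreover have "\<bar>c n x\<bar> \<le> 1" by (auto simp: c_def)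
    ultimately show ?thesis unfolding H_def norm_mult norm_of_real by (intro mult_le_one) auto
  qed
  have zero: "integral\<^sup>L I_meas (\<lambda>x. g x * H n x) = 0" for n
    by (rule orthogonal_to_periodic[OF g orth cH]) (simp add: H_def c_def)
  have "(\<lambda>n. integral\<^sup>L I_meas (\<lambda>x. g x * H n x)) \<longlonglongrightarrow> integral\<^sup>L I_meas (\<lambda>x. g x * t x)"
  proof (rule integral_dominated_convergence[where w = "\<lambda>x. norm (g x)"])
    show "(\<lambda>x. g x * t x) \<in> borel_measurable I_meas"
      using gm \<open>t \<in> borel_measurable I_meas\<close> by measurable
    show "(\<lambda>x. g x * H n x) \<in> borel_measurable I_meas" for n
      using gm measurable_I_continuous[OF cH] by measurable
    show "integrable I_meas (\<lambda>x. norm (g x))" using g by auto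
    have neg: "negligible (N \<union> {0, pi})" using N by auto
    have "AE x in lebesgue. x \<notin> N \<union> {0, pi}"
      by (rule AE_not_in) (use neg in \<open>simp add: negligible_iff_null_sets\<close>)
    then have "AE x in I_meas. x \<notin> N \<union> {0, pi}" by (subst AE_restrict_space_iff) auto
    then show "AE x in I_meas. (\<lambda>n. g x * H n x) \<longlonglongrightarrow> g x * t x"
    proof (rule AE_mp, intro AE_I2 impI)
      fix x assume "x \<in> space I_meas" and x: "x \<notin> N \<union> {0, pi}"
      then have x0: "0 < x" "x < pi" by auto
      have hl: "(\<lambda>n. h n x) \<longlonglongrightarrow> t x" using lim[of x] x x0 by simp
      have "norm (t x) \<le> 1" by (simp add: t_def norm_divide)
      have "(\<lambda>n. h n x / of_real (max 1 (norm (h n x)))) \<longlonglongrightarrow> t x / of_real (max 1 (norm (t x)))"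
        by (intro tendsto_intros hl) auto
      then have l1: "(\<lambda>n. h n x / of_real (max 1 (norm (h n x)))) \<longlonglongrightarrow> t x"
        using \<open>norm (t x) \<le> 1\<close> by (simp add: max_absorb1)
      have l2: "(\<lambda>n. complex_of_real (c n x)) \<longlonglongrightarrow> 1"
      proof (rule tendsto_eventually)
        define M where "M = max (1 / x) (1 / (pi - x))"
        have "\<forall>\<^sub>F m in sequentially. M \<le> real m"
          using filterlim_real_sequentially by (simp add: filterlim_at_top)
        then show "\<forall>\<^sub>F n in sequentially. complex_of_real (c n x) = 1"
        proof eventually_elim
          case (elim n)
          then have "1 / x \<le> real n" "1 / (pi - x) \<le> real n" by (auto simp: M_def)
          then have "1 \<le> real n * x" "1 \<le> real n * (pi - x)" using x0 by (simp_all add: pos_divide_le_eq)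
          then show ?case by (simp add: c_def)
        qed
      qed
      have "(\<lambda>n. g x * H n x) \<longlonglongrightarrow> g x * (1 * t x)"
        unfolding H_def by (intro tendsto_mult tendsto_const l1 l2)
      then show "(\<lambda>n. g x * H n x) \<longlonglongrightarrow> g x * t x" by simp
    qed
    show "AE x in I_meas. norm (g x * H n x) \<le> norm (g x)" for n
      using bH by (auto simp: norm_mult intro!: AE_I2 mult_left_le)
  qed
  then have "integral\<^sup>L I_meas (\<lambda>x. g x * t x) = 0"
    unfolding zero using LIMSEQ_unique tendsto_const by blast
  moreover have "g x * t x = of_real (norm (g x))" for x
  proof (cases "g x = 0")
    case False
    have "g x * cnj (g x) = of_real ((norm (g x))\<^sup>2)" by (simp add: complex_norm_square[symmetric])
    then show ?thesis using False
      by (simp add: t_def power2_eq_square field_simps)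
  qed (simp add: t_def)
  ultimately have "integral\<^sup>L I_meas (\<lambda>x. norm (g x)) = 0"
    by (simp add: integral_complex_of_real)
  then have "AE x in I_meas. norm (g x) = 0"
    using g by (subst (asm) integral_nonneg_eq_0_iff_AE) auto
  then show ?thesis by simp
qed

text \<open>Multiplication by \<open>ex 1\<close> turns the odd frequencies into the even ones, for
  which completeness is known.\<close>

lemma fc_odd_eq_0_imp:
  assumes f: "f \<in> L2" and z: "\<And>k. odd k \<Longrightarrow> fc f k = 0"
  shows "L2_eq f (\<lambda>x. 0)"
proof -
  have "AE x in I_meas. f x * ex 1 x = 0"
  proof (rule trigonometric_system_complete)
    show "integrable I_meas (\<lambda>x. f x * ex 1 x)" by (rule integrable_fc[OF f])
    fix j :: int
    have "- (- 1 - 2 * j) = 1 + 2 * j" by simp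
    then have eq: "f x * ex 1 x * ex (2 * j) x = f x * ex (- (- 1 - 2 * j)) x" for x
      by (simp only: ex_add mult.assoc)
    have "fc f (- 1 - 2 * j) = 0" by (rule z) simp
    then show "integral\<^sup>L I_meas (\<lambda>x. f x * ex 1 x * ex (2 * j) x) = 0"
      unfolding eq fc_def .
  qed
  then have "AE x in I_meas. f x = 0"
  proof eventually_elim
    case (elim x)
    moreover have "ex 1 x \<noteq> 0" using norm_ex[of 1 x] by auto
    ultimately show ?case by simp
  qed
  then show ?thesis by (simp add: L2_eq_def)
qed

section \<open>Spectral projections\<close>

definition hat :: "int \<Rightarrow> (real \<Rightarrow> complex) \<Rightarrow> int \<Rightarrow> complex" where
  "hat n f i = fc f (2 * i - n)"

lemma bounded_hat: "f \<in> L2 \<Longrightarrow> bounded (range (hat n f))"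
  using fc_le by (auto simp: bounded_iff hat_def)

lemma hat_hill_graph:
  fixes a b :: complex and s :: nat
  assumes v: "v = (\<lambda>x. a * exp (- 2 * \<i> * of_real x) + b * exp (2 * \<i> * of_nat s * of_real x))"
    and yw: "(y, w) \<in> hill_graph v \<mu>" and n: "odd n"
  shows "hat n w i = hill_sequence.T a b (int s) n (\<mu> - (of_int n)\<^sup>2) (hat n y) i"
proof -
  interpret hill_sequence a b "int s" n .
  have "odd (2 * i - n)" using n by simp
  from fc_hill_graph(3)[OF v yw this]
  have "hat n w i = ((of_int (2 * i - n))\<^sup>2 - \<mu>) * hat n y i + a * fc y (2 * i - n + 2) + b * fc y (2 * i - n - 2 * int s)"
    by (simp add: hat_def)
  moreover have "fc y (2 * i - n + 2) = hat n y (i + 1)" "fc y (2 * i - n - 2 * int s) = hat n y (i - int s)"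
    by (simp_all add: hat_def algebra_simps)
  moreover have "(of_int (2 * i - n))\<^sup>2 - \<mu> = of_int (4 * i * (i - n)) - (\<mu> - (of_int n)\<^sup>2)"
    by (simp add: power2_eq_square algebra_simps)
  ultimately show ?thesis by (simp only: T_def)
qed

text \<open>The indices \<open>i\<close> and \<open>n - i\<close> stand for opposite frequencies, so
  this is the integral of \<open>f\<close> times the function with coefficients \<open>y\<close>,
  written without that function. The normalization of \<open>fc\<close> makes the constant
  one.\<close>

definition pairing :: "int \<Rightarrow> (int \<Rightarrow> complex) \<Rightarrow> (real \<Rightarrow> complex) \<Rightarrow> complex" where
  "pairing n y f = (\<Sum>\<^sub>\<infinity>i. hat n f i * y (n - i))"

lemma pairing_summable:
  assumes "(\<lambda>i. norm (y i)) summable_on UNIV" "f \<in> L2"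
  shows "(\<lambda>i. hat n f i * y (n - i)) summable_on UNIV" "(\<lambda>i. norm (hat n f i * y (n - i))) summable_on UNIV"
  using summable_on_bounded_mult[OF bounded_hat[OF assms(2)] summable_on_reflect_int[OF assms(1)]] by auto

lemma pairing_le:
  assumes y: "(\<lambda>i. norm (y i)) summable_on UNIV" and f: "f \<in> L2"
  shows "norm (pairing n y f) \<le> 3 * L2_norm f * infsum (\<lambda>i. norm (y i)) UNIV"
proof -
  have "norm (pairing n y f) \<le> infsum (\<lambda>i. norm (hat n f i * y (n - i))) UNIV"
    unfolding pairing_def by (rule norm_infsum_bound[OF pairing_summable(2)[OF y f]])
  also have "\<dots> \<le> infsum (\<lambda>i. (3 * L2_norm f) * norm (y (n - i))) UNIV"
    by (rule infsum_mono[OF pairing_summable(2)[OF y f] summable_on_cmult_right[OF summable_on_reflect_int[OF y]]])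
      (auto simp: norm_mult hat_def intro!: mult_right_mono fc_le f)
  also have "\<dots> = 3 * L2_norm f * infsum (\<lambda>i. norm (y i)) UNIV"
    using infsum_reflect_int[of "\<lambda>i. norm (y i)" n] by (simp only: infsum_cmult_right')
  finally show ?thesis .
qed

lemma pairing_add_scaled:
  assumes y: "(\<lambda>i. norm (y i)) summable_on UNIV" and f: "f \<in> L2" "g \<in> L2"
  shows "pairing n y (\<lambda>x. f x + c * g x) = pairing n y f + c * pairing n y g"
proof -
  have "pairing n y (\<lambda>x. f x + c * g x) = (\<Sum>\<^sub>\<infinity>i. hat n f i * y (n - i) + c * (hat n g i * y (n - i)))"
    unfolding pairing_def hat_def fc_add_scaled[OF f] by (simp add: algebra_simps)
  also have "\<dots> = pairing n y f + c * pairing n y g"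
    unfolding pairing_def
    by (simp only: infsum_add pairing_summable[OF y] f summable_on_cmult_right infsum_cmult_right')
  finally show ?thesis .
qed

lemma pairing_sum:
  fixes N :: nat
  assumes y: "(\<lambda>i. norm (y i)) summable_on UNIV" and u: "\<And>m. u m \<in> L2"
  shows "pairing n y (\<lambda>x. \<Sum>m<N. c m * u m x) = (\<Sum>m<N. c m * pairing n y (u m))"
proof (induction N)
  case 0
  show ?case by (simp add: pairing_def hat_def fc_zero)
next
  case (Suc N)
  then show ?case
    using pairing_add_scaled[OF y L2_sum[where u = u and c = c and N = N, OF u] u[of N], of n "c N"] by simp
qed

lemma hat_eq_0_imp:
  assumes f: "f \<in> L2" and n: "odd n" and z: "\<And>i. hat n f i = 0"
  shows "L2_eq f (\<lambda>x. 0)"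
proof (rule fc_odd_eq_0_imp[OF f])
  fix k :: int assume "odd k"
  then have "k = 2 * ((k + n) div 2) - n" using n by presburger
  then show "fc f k = 0" using z[of "(k + n) div 2"] unfolding hat_def by metis
qed

lemma L2_norm_eq_0:
  assumes "f \<in> L2" "L2_eq f (\<lambda>x. 0)" shows "L2_norm f = 0"
proof -
  have "integral\<^sup>L I_meas (\<lambda>x. (norm (f x))\<^sup>2) = integral\<^sup>L I_meas (\<lambda>x. 0)"
  proof (rule integral_cong_AE)
    show "(\<lambda>x. (norm (f x))\<^sup>2) \<in> borel_measurable I_meas" using assms(1) by (auto simp: L2_def)
    show "AE x in I_meas. (norm (f x))\<^sup>2 = 0"
      using assms(2) unfolding L2_eq_def by eventually_elim simp
  qed simp
  then show ?thesis by (simp add: L2_norm_def)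
qed

lemma hat_eq_0:
  assumes "w \<in> L2" "L2_eq w (\<lambda>x. 0)" shows "hat n w i = 0"
proof -
  have "fc w (2 * i - n) = fc (\<lambda>x. 0) (2 * i - n)"
    using assms by (intro fc_cong) (auto simp: L2_def)
  then show ?thesis by (simp add: hat_def fc_zero)
qed

lemma hill_ker_chain:
  fixes a b :: complex and s :: nat
  assumes v: "v = (\<lambda>x. a * exp (- 2 * \<i> * of_real x) + b * exp (2 * \<i> * of_nat s * of_real x))"
    and u: "u \<in> L2" "(u, w) \<in> hill_graph v \<mu> ^^ k"
  shows "w \<in> L2"
proof (cases k)
  case (Suc k')
  then obtain u' where "(u', w) \<in> hill_graph v \<mu>" using u(2) by auto
  then show ?thesis by (rule fc_hill_graph(2)[OF v])
qed (use u in simp)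

text \<open>All facts about the eigenvalue \<open>n\<^sup>2 + z\<close>, stated for coefficients.
  \<open>B\<close> excludes associated functions, and \<open>simple\<close> makes the eigenspace
  one-dimensional among bounded sequences, which include the coefficients of all functions in
  L2.\<close>

locale eigenvector =
  fixes a b :: complex and s :: nat and n :: int and z :: complex and Y :: "int \<Rightarrow> complex"
    and v :: "real \<Rightarrow> complex"
  assumes v: "v = (\<lambda>x. a * exp (- 2 * \<i> * of_real x) + b * exp (2 * \<i> * of_nat s * of_real x))"
    and n: "odd n"
    and ss: "hill_sequence.strongly_summable n Y"
    and TY: "\<And>i. hill_sequence.T a b (int s) n z Y i = 0"
    and B: "(\<Sum>\<^sub>\<infinity>i. Y i * Y (n - i)) \<noteq> 0"
    and simple: "\<And>u i. bounded (range u) \<Longrightarrow> (\<And>i. hill_sequence.T a b (int s) n z u i = 0) \<Longrightarrow> u i = u n * Y i"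
begin

sublocale hill_sequence a b "int s" n .

lemma Y_summable: "(\<lambda>i. norm (Y i)) summable_on UNIV"
  using ss by (simp add: strongly_summable_def)

lemma sum_T_mult_Y: "bounded (range u) \<Longrightarrow> (\<Sum>\<^sub>\<infinity>i. T z u i * Y (n - i)) = 0"
  using T_symmetric[OF _ ss, of u z] by (simp add: TY)

text \<open>Pairing with \<open>Y\<close> is an eigenvector of the transposed operator, by
  \<open>T_symmetric\<close>.\<close>

lemma pairing_hill_graph:
  assumes yw: "(y, w) \<in> hill_graph v \<mu>"
  shows "pairing n Y w = ((of_int n)\<^sup>2 + z - \<mu>) * pairing n Y y"
proof -
  note L = fc_hill_graph(1,2)[OF v yw]
  define d where "d = (of_int n)\<^sup>2 + z - \<mu>"
  have hw: "hat n w i = T z (hat n y) i + d * hat n y i" for i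
    unfolding hat_hill_graph[OF v yw n] by (simp add: T_def d_def algebra_simps)
  then have eq: "T z (hat n y) i * Y (n - i) = hat n w i * Y (n - i) + (- d) * (hat n y i * Y (n - i))" for i
    by (simp add: algebra_simps)
  have "0 = (\<Sum>\<^sub>\<infinity>i. T z (hat n y) i * Y (n - i))"
    using sum_T_mult_Y[OF bounded_hat[OF L(1)]] by simp
  also have "\<dots> = pairing n Y w + (- d) * pairing n Y y"
    unfolding eq pairing_def
    by (simp only: infsum_add pairing_summable[OF Y_summable] L summable_on_cmult_right infsum_cmult_right')
  finally have "pairing n Y w = d * pairing n Y y" by algebra
  then show ?thesis by (simp add: d_def)
qed

text \<open>Along a chain for another eigenvalue each step multiplies the pairing by a nonzero
  number, so a zero at the end of the chain is carried back to its start.\<close>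

lemma pairing_eq_0:
  assumes "\<mu> \<noteq> (of_int n)\<^sup>2 + z"
  shows "u \<in> L2 \<Longrightarrow> (u, w) \<in> hill_graph v \<mu> ^^ k \<Longrightarrow> pairing n Y w = 0 \<Longrightarrow> pairing n Y u = 0"
proof (induction k arbitrary: u)
  case (Suc k)
  obtain u' where u': "(u, u') \<in> hill_graph v \<mu>" "(u', w) \<in> hill_graph v \<mu> ^^ k"
    using relpow_Suc_D2[OF Suc.prems(2)] by blast
  have "pairing n Y u' = 0"
    by (rule Suc.IH[OF fc_hill_graph(2)[OF v u'(1)] u'(2) Suc.prems(3)])
  then show ?case using pairing_hill_graph[OF u'(1)] assms by auto
qed simp

text \<open>If applying the operator once gives \<open>c\<close> times \<open>Y\<close>, the result
  pairs to zero with \<open>Y\<close>, whereas \<open>Y\<close> itself does not. Hence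
  \<open>c = 0\<close>: no Jordan block occurs, and \<open>simple\<close> applies.\<close>

lemma hat_multiple:
  assumes "\<mu> = (of_int n)\<^sup>2 + z"
  shows "u \<in> L2 \<Longrightarrow> (u, w) \<in> hill_graph v \<mu> ^^ k \<Longrightarrow> (\<And>i. hat n w i = 0)
    \<Longrightarrow> \<exists>c. \<forall>i. hat n u i = c * Y i"
proof (induction k arbitrary: u)
  case 0
  then have "hat n u i = 0 * Y i" for i by simp
  then show ?case by blast
next
  case (Suc k)
  obtain u' where u': "(u, u') \<in> hill_graph v \<mu>" "(u', w) \<in> hill_graph v \<mu> ^^ k"
    using relpow_Suc_D2[OF Suc.prems(2)] by blast
  obtain c where c: "\<And>i. hat n u' i = c * Y i"
    using Suc.IH[OF fc_hill_graph(2)[OF v u'(1)] u'(2) Suc.prems(3)] by blast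
  have "pairing n Y u' = c * (\<Sum>\<^sub>\<infinity>i. Y i * Y (n - i))"
    unfolding pairing_def c by (simp add: mult.assoc infsum_cmult_right')
  moreover have "pairing n Y u' = 0" using pairing_hill_graph[OF u'(1)] assms by simp
  ultimately have "c = 0" using B by simp
  have "T z (hat n u) i = 0" for i
    using hat_hill_graph[OF v u'(1) n, of i] c[of i] \<open>c = 0\<close> assms by simp
  then have "hat n u i = hat n u n * Y i" for i
    by (rule simple[OF bounded_hat[OF Suc.prems(1)]])
  then show ?case by blast
qed

lemma root_function_dichotomy:
  assumes u: "u \<in> L2" and root: "root_function v u" and nz: "pairing n Y u \<noteq> 0"
  shows "\<exists>c. c \<noteq> 0 \<and> (\<forall>i. hat n u i = c * Y i)"
    and "\<exists>k. u \<in> hill_ker v ((of_int n)\<^sup>2 + z) k"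
    and "u \<in> hill_ker v \<mu> k \<Longrightarrow> \<mu> = (of_int n)\<^sup>2 + z"
proof -
  show eq: "\<mu> = (of_int n)\<^sup>2 + z" if mem: "u \<in> hill_ker v \<mu> k" for \<mu> k
  proof (rule ccontr)
    assume "\<mu> \<noteq> (of_int n)\<^sup>2 + z"
    obtain w where w: "(u, w) \<in> hill_graph v \<mu> ^^ k" "L2_eq w (\<lambda>x. 0)"
      using mem unfolding hill_ker_def by blast
    have "pairing n Y w = 0"
      unfolding pairing_def using hat_eq_0[OF hill_ker_chain[OF v u w(1)] w(2)] by simp
    then show False using pairing_eq_0[OF \<open>\<mu> \<noteq> _\<close> u w(1)] nz by simp
  qed
  obtain \<mu> k where k: "u \<in> hill_ker v \<mu> k" using root by (auto simp: root_function_def)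
  then show "\<exists>k. u \<in> hill_ker v ((of_int n)\<^sup>2 + z) k" using eq by blast
  obtain w where w: "(u, w) \<in> hill_graph v \<mu> ^^ k" "L2_eq w (\<lambda>x. 0)"
    using k unfolding hill_ker_def by blast
  obtain c where c: "\<And>i. hat n u i = c * Y i"
    using hat_multiple[OF eq[OF k] u w(1) hat_eq_0[OF hill_ker_chain[OF v u w(1)] w(2)]] by blast
  have "c \<noteq> 0"
  proof
    assume "c = 0"
    then have "pairing n Y u = 0" by (simp add: pairing_def c)
    then show False using nz by simp
  qed
  then show "\<exists>c. c \<noteq> 0 \<and> (\<forall>i. hat n u i = c * Y i)" using c by blast
qed

end

text \<open>A finite linear relation would be a second expansion of the zero function.\<close>

lemma schauder_basis_eventually_zero:
  assumes basis: "schauder_basis u" and M: "\<And>m. m \<ge> M \<Longrightarrow> c m = 0"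
    and z: "L2_eq (\<lambda>x. \<Sum>m<M. c m * u m x) (\<lambda>x. 0)"
  shows "c m = 0"
proof -
  have u: "\<And>m. u m \<in> L2" using basis by (auto simp: schauder_basis_def)
  define S where "S N x = (\<Sum>m<N. c m * u m x)" for N x
  have S: "S N = S M" if "N \<ge> M" for N
  proof
    fix x
    show "S N x = S M x"
      unfolding S_def using that M by (intro sum.mono_neutral_right) auto
  qed
  have "L2_norm (\<lambda>x. 0 - S N x) = 0" if "N \<ge> M" for N
  proof (rule L2_norm_eq_0)
    have "S N \<in> L2" unfolding S_def[abs_def] by (rule L2_sum[OF u])
    then show "(\<lambda>x. 0 - S N x) \<in> L2" using L2_scaled[of "S N" "- 1"] by simp
    have "AE x in I_meas. S M x = 0" using z by (simp add: L2_eq_def S_def)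
    then show "L2_eq (\<lambda>x. 0 - S N x) (\<lambda>x. 0)"
      unfolding L2_eq_def S[OF that] by eventually_elim simp
  qed
  moreover define C where "C d \<longleftrightarrow> (\<lambda>N. L2_norm (\<lambda>x. 0 - (\<Sum>m<N. d m * u m x))) \<longlonglongrightarrow> 0" for d :: "nat \<Rightarrow> complex"
  ultimately have "C c"
    unfolding C_def S_def by (intro tendsto_eventually eventually_sequentiallyI[of M]) auto
  moreover have "C (\<lambda>m. 0)"
    unfolding C_def by (simp add: L2_norm_def)
  moreover have "\<forall>f\<in>L2. \<exists>!d. (\<lambda>N. L2_norm (\<lambda>x. f x - (\<Sum>m<N. d m * u m x))) \<longlonglongrightarrow> 0"
    using basis unfolding schauder_basis_def by (rule conjunct2)
  from bspec[OF this L2_zero] have "\<exists>!d. C d" unfolding C_def .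
  ultimately have "c = (\<lambda>m. 0)" by blast
  then show ?thesis by simp
qed

text \<open>
  If \<open>pairing n Y f \<noteq> 0\<close>, exactly one basis element is a root function for the eigenvalue of \<open>Y\<close>,
  and its component in the expansion of \<open>f\<close> is the spectral projection \<open>pairing n Y f / B\<close> times \<open>Y\<close>.
\<close>

lemma (in eigenvector) basis_coefficient:
  assumes basis: "schauder_basis u" and root: "\<And>m. root_function v (u m)"
    and f: "f \<in> L2" and lim: "(\<lambda>N. L2_norm (\<lambda>x. f x - (\<Sum>m<N. c m * u m x))) \<longlonglongrightarrow> 0"
    and nz: "pairing n Y f \<noteq> 0"
  shows "\<exists>m. pairing n Y (u m) \<noteq> 0 \<and> c m * fc (u m) n * (\<Sum>\<^sub>\<infinity>i. Y i * Y (n - i)) = pairing n Y f * Y n"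
proof -
  have u: "\<And>m. u m \<in> L2" using basis by (auto simp: schauder_basis_def)
  define E where "E N x = f x - (\<Sum>m<N. c m * u m x)" for N x
  have E: "E N \<in> L2" for N
    using L2_add_scaled[OF f L2_sum[where u = u and c = c and N = N, OF u], of "- 1"] by (simp add: E_def[abs_def])
  have pE: "pairing n Y (E N) = pairing n Y f - (\<Sum>m<N. c m * pairing n Y (u m))" for N
    using pairing_add_scaled[OF Y_summable f L2_sum[where u = u and c = c and N = N, OF u], of n "- 1"] pairing_sum[where u = u and c = c and N = N and n = n, OF Y_summable u]
    by (simp add: E_def[abs_def])
  have "(\<lambda>N. 3 * L2_norm (E N) * infsum (\<lambda>i. norm (Y i)) UNIV) \<longlonglongrightarrow> 3 * 0 * infsum (\<lambda>i. norm (Y i)) UNIV"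
    using lim unfolding E_def[abs_def] by (intro tendsto_intros)
  then have bound: "(\<lambda>N. 3 * L2_norm (E N) * infsum (\<lambda>i. norm (Y i)) UNIV) \<longlonglongrightarrow> 0" by simp
  have "(\<lambda>N. pairing n Y (E N)) \<longlonglongrightarrow> 0"
  proof (rule Lim_null_comparison[OF _ bound])
    show "\<forall>\<^sub>F N in sequentially. norm (pairing n Y (E N)) \<le> 3 * L2_norm (E N) * infsum (\<lambda>i. norm (Y i)) UNIV"
      by (intro always_eventually allI pairing_le[OF Y_summable E])
  qed
  then have "(\<lambda>N. pairing n Y f - pairing n Y (E N)) \<longlonglongrightarrow> pairing n Y f - 0"
    by (intro tendsto_intros)
  then have limF: "(\<lambda>N. \<Sum>m<N. c m * pairing n Y (u m)) \<longlonglongrightarrow> pairing n Y f"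
    by (simp add: pE)
  have "\<exists>m. pairing n Y (u m) \<noteq> 0"
  proof (rule ccontr)
    assume "\<not> ?thesis"
    then have "(\<lambda>N. \<Sum>m<N. c m * pairing n Y (u m)) = (\<lambda>N. 0)" by auto
    then show False using limF nz by (simp add: LIMSEQ_const_iff)
  qed
  then obtain m where m: "pairing n Y (u m) \<noteq> 0" by blast
  obtain g where g: "g \<noteq> 0" "\<And>i. hat n (u m) i = g * Y i"
    using root_function_dichotomy(1)[OF u root m] by blast
  have unique: "m' = m" if m': "pairing n Y (u m') \<noteq> 0" for m'
  proof (rule ccontr)
    assume "m' \<noteq> m"
    obtain g' where g': "g' \<noteq> 0" "\<And>i. hat n (u m') i = g' * Y i"
      using root_function_dichotomy(1)[OF u root m'] by blast
    \<comment> \<open>The combination \<open>g' * u m - g * u m'\<close> has coefficients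
      \<open>g' * g * Y i - g * g' * Y i = 0\<close>.\<close>
    define d where "d i = (if i = m then g' else if i = m' then - g else 0)" for i
    define M where "M = Suc (max m m')"
    have dM: "d i = 0" if "i \<ge> M" for i using that by (auto simp: d_def M_def)
    have sum: "(\<Sum>i<M. d i * w i) = g' * w m + (- g) * w m'" for w :: "nat \<Rightarrow> complex"
    proof -
      have "(\<Sum>i<M. d i * w i) = (\<Sum>i\<in>{m, m'}. d i * w i)"
        by (rule sum.mono_neutral_right) (auto simp: d_def M_def)
      then show ?thesis using \<open>m' \<noteq> m\<close> by (simp add: d_def)
    qed
    have zero: "L2_eq (\<lambda>x. \<Sum>i<M. d i * u i x) (\<lambda>x. 0)"
    proof (rule hat_eq_0_imp[OF L2_sum[OF u] n])
      fix i
      have "hat n (\<lambda>x. \<Sum>i<M. d i * u i x) i = (\<Sum>j<M. d j * hat n (u j) i)"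
        unfolding hat_def by (rule fc_sum[OF u])
      also have "\<dots> = 0" unfolding sum g g' by simp
      finally show "hat n (\<lambda>x. \<Sum>i<M. d i * u i x) i = 0" .
    qed
    have "d m = 0"
      by (rule schauder_basis_eventually_zero[where c = d and M = M, OF basis _ zero]) (rule dM)
    then show False using g' by (simp add: d_def)
  qed
  have "(\<lambda>N. \<Sum>m<N. c m * pairing n Y (u m)) \<longlonglongrightarrow> c m * pairing n Y (u m)"
  proof (rule tendsto_eventually, rule eventually_sequentiallyI)
    fix N assume N: "Suc m \<le> N"
    have "(\<Sum>m<N. c m * pairing n Y (u m)) = (\<Sum>m\<in>{m}. c m * pairing n Y (u m))"
      using N unique by (intro sum.mono_neutral_right) auto
    then show "(\<Sum>m<N. c m * pairing n Y (u m)) = c m * pairing n Y (u m)" by simp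
  qed
  then have eq: "pairing n Y f = c m * pairing n Y (u m)" using limF LIMSEQ_unique by blast
  have "pairing n Y (u m) = g * (\<Sum>\<^sub>\<infinity>i. Y i * Y (n - i))"
    unfolding pairing_def g by (simp add: mult.assoc infsum_cmult_right')
  moreover have "fc (u m) n = g * Y n" using g(2)[of n] by (simp add: hat_def)
  ultimately have "c m * fc (u m) n * (\<Sum>\<^sub>\<infinity>i. Y i * Y (n - i)) = pairing n Y f * Y n"
    unfolding eq by (simp add: mult_ac)
  then show ?thesis using m by blast
qed

text \<open>The series converges absolutely and uniformly, so it may be integrated termwise, and odd
  frequencies are orthogonal among themselves.\<close>

lemma lacunary_series:
  fixes \<nu> :: "nat \<Rightarrow> int" and \<delta> :: "nat \<Rightarrow> real"
  assumes \<nu>: "\<And>j. odd (\<nu> j)" "inj \<nu>" and \<delta>: "\<And>j. 0 \<le> \<delta> j" "\<delta> sums 1"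
  obtains f where "f \<in> L2" "\<And>k. norm (fc f k) \<le> pi" "\<And>j. fc f (\<nu> j) = of_real (pi * \<delta> j)"
proof
  define f where "f x = (\<Sum>j. of_real (\<delta> j) * ex (\<nu> j) x)" for x
  have sumn: "summable (\<lambda>j. norm (of_real (\<delta> j) * ex (\<nu> j) x))" for x
    using \<delta> by (simp add: norm_mult norm_ex sums_iff)
  have meas: "f \<in> borel_measurable I_meas"
    unfolding f_def using measurable_ex by measurable
  have f1: "norm (f x) \<le> 1" for x
  proof -
    have "norm (f x) \<le> (\<Sum>j. norm (of_real (\<delta> j) * ex (\<nu> j) x))"
      unfolding f_def by (rule summable_norm[OF sumn])
    also have "\<dots> = 1" using \<delta> by (simp add: norm_mult norm_ex sums_iff)
    finally show ?thesis .
  qed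
  show fL: "f \<in> L2" by (rule L2_bounded[OF meas f1])
  show "norm (fc f k) \<le> pi" for k
  proof -
    have "norm (fc f k) \<le> integral\<^sup>L I_meas (\<lambda>x. 1 :: real)"
      unfolding fc_def
      by (rule Bochner_Integration.integral_norm_bound_integral[OF integrable_fc[OF fL]])
        (auto simp: norm_mult norm_ex f1 intro!: integrable_I_continuous)
    then show ?thesis by (simp add: measure_I)
  qed
  fix j
  have "(\<lambda>i. integral\<^sup>L I_meas (\<lambda>x. of_real (\<delta> i) * ex (\<nu> i) x * ex (- \<nu> j) x)) sums
      integral\<^sup>L I_meas (\<lambda>x. \<Sum>i. of_real (\<delta> i) * ex (\<nu> i) x * ex (- \<nu> j) x)"
  proof (rule sums_integral)
    show "integrable I_meas (\<lambda>x. of_real (\<delta> i) * ex (\<nu> i) x * ex (- \<nu> j) x)" for i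
      by (intro integrable_I_continuous continuous_intros continuous_ex)
    show "AE x in I_meas. summable (\<lambda>i. norm (of_real (\<delta> i) * ex (\<nu> i) x * ex (- \<nu> j) x))"
      using sumn by (auto simp: norm_mult norm_ex)
    have "summable (\<lambda>i. pi * \<delta> i)" using \<delta>(2) by (intro summable_mult) (auto simp: sums_iff)
    then show "summable (\<lambda>i. LINT x|I_meas. norm (of_real (\<delta> i) * ex (\<nu> i) x * ex (- \<nu> j) x))"
      using \<delta>(1) by (simp add: norm_mult norm_ex measure_I mult.commute)
  qed
  also have "(\<lambda>x. \<Sum>i. of_real (\<delta> i) * ex (\<nu> i) x * ex (- \<nu> j) x) = (\<lambda>x. f x * ex (- \<nu> j) x)"
  proof
    fix x
    show "(\<Sum>i. of_real (\<delta> i) * ex (\<nu> i) x * ex (- \<nu> j) x) = f x * ex (- \<nu> j) x"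
      unfolding f_def by (rule suminf_mult2[symmetric, OF summable_norm_cancel[OF sumn]])
  qed
  also have "integral\<^sup>L I_meas (\<lambda>x. f x * ex (- \<nu> j) x) = fc f (\<nu> j)" by (simp add: fc_def)
  finally have sums: "(\<lambda>i. integral\<^sup>L I_meas (\<lambda>x. of_real (\<delta> i) * ex (\<nu> i) x * ex (- \<nu> j) x)) sums fc f (\<nu> j)" .
  have coeff: "integral\<^sup>L I_meas (\<lambda>x. of_real (\<delta> i) * ex (\<nu> i) x * ex (- \<nu> j) x) = (if i = j then of_real (pi * \<delta> j) else 0)" for i
  proof -
    have "integral\<^sup>L I_meas (\<lambda>x. of_real (\<delta> i) * ex (\<nu> i) x * ex (- \<nu> j) x) = of_real (\<delta> i) * fc (ex (\<nu> i)) (\<nu> j)"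
      unfolding fc_def integral_mult_right_zero[symmetric] by (simp only: mult.assoc)
    also have "fc (ex (\<nu> i)) (\<nu> j) = (if \<nu> i = \<nu> j then of_real pi else 0)"
      using \<nu>(1) by (intro fc_ex) simp
    also have "\<nu> i = \<nu> j \<longleftrightarrow> i = j" using \<nu>(2) by (auto simp: inj_def)
    finally show ?thesis by simp
  qed
  have "(\<lambda>i. if i = j then of_real (pi * \<delta> j) else (0 :: complex)) sums of_real (pi * \<delta> j)"
    using sums_single[of j "\<lambda>_. of_real (pi * \<delta> j) :: complex"] by simp
  then show "fc f (\<nu> j) = of_real (pi * \<delta> j)"
    using sums sums_unique2 unfolding coeff by blast
qed

theorem theorem18:
  fixes s :: nat and a b :: complex and v :: "real \<Rightarrow> complex"
  assumes "s \<ge> 3"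
    and "a \<noteq> 0"
    and "b \<noteq> 0"
    and "v = (\<lambda>x. a * exp (- 2 * \<i> * of_real x) + b * exp (2 * \<i> * of_nat s * of_real x))"
  shows "\<not> (\<exists>u. schauder_basis u \<and> (\<forall>n. root_function v (u n)))"
proof
  assume "\<exists>u. schauder_basis u \<and> (\<forall>n. root_function v (u n))"
  then obtain u where basis: "schauder_basis u" and root: "\<And>m. root_function v (u m)" by blast
  have u: "\<And>m. u m \<in> L2" using basis by (auto simp: schauder_basis_def)
  define \<delta> :: "nat \<Rightarrow> real" where "\<delta> j = (1 / 2) ^ Suc j" for j
  have \<delta>0: "0 < \<delta> j" "\<delta> j \<le> 1" for j
    by (simp_all add: \<delta>_def power_le_one del: power_Suc)
  define good where "good j t \<longleftrightarrow> (case t of (n, z, y) \<Rightarrow> n > 0 \<and> odd n \<and> norm z \<le> 1 \<and> y n = 1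
    \<and> infsum (\<lambda>i. norm (y i)) (UNIV - {n}) \<le> \<delta> j / 8 \<and> eigenvector a b s n z y v)"
    for j and t :: "int \<times> complex \<times> (int \<Rightarrow> complex)"
  have ex: "\<exists>n z y. n > N \<and> good j (n, z, y)" if "N \<ge> 0" for N j
  proof -
    obtain n z y where *: "n > N" "odd n" "norm z \<le> 1" "y n = 1" "hill_sequence.strongly_summable n y"
      "\<forall>i. hill_sequence.T a b (int s) n z y i = 0"
      "infsum (\<lambda>i. norm (y i)) (UNIV - {n}) \<le> \<delta> j / 8" "(\<Sum>\<^sub>\<infinity>i. y i * y (n - i)) \<noteq> 0"
      "\<forall>u. bounded (range u) \<longrightarrow> (\<forall>i. hill_sequence.T a b (int s) n z u i = 0) \<longrightarrow> (\<forall>i. u i = u n * y i)"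
      using eigenvector_sequence[OF assms(2,3,1), of "\<delta> j / 8" N] \<delta>0[of j] by auto
    have "eigenvector a b s n z y v"
      by (rule eigenvector.intro) (use * assms(4) in blast)+
    then show ?thesis using * that unfolding good_def by (intro exI[of _ n] exI[of _ z] exI[of _ y]) auto
  qed
  have "\<exists>F. \<forall>j. good j (F j) \<and> fst (F j) < fst (F (Suc j))"
  proof (rule dependent_nat_choice)
    show "\<exists>t. good 0 t" using ex[of 0 0] by blast
    fix t j assume "good j t"
    then have "fst t \<ge> 0" by (auto simp: good_def)
    then obtain n z y where "n > fst t" "good (Suc j) (n, z, y)" using ex by blast
    then show "\<exists>t'. good (Suc j) t' \<and> fst t < fst t'" by (intro exI[of _ "(n, z, y)"]) auto
  qed
  then obtain F where F: "\<And>j. good j (F j)" "\<And>j. fst (F j) < fst (F (Suc j))" by blast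
  define \<nu> z Y where "\<nu> j = fst (F j)" and "z j = fst (snd (F j))" and "Y j = snd (snd (F j))" for j
  have g: "\<nu> j > 0" "odd (\<nu> j)" "norm (z j) \<le> 1" "Y j (\<nu> j) = 1"
    "infsum (\<lambda>i. norm (Y j i)) (UNIV - {\<nu> j}) \<le> \<delta> j / 8" "eigenvector a b s (\<nu> j) (z j) (Y j) v" for j
    using F(1)[of j] by (auto simp: good_def \<nu>_def z_def Y_def split: prod.splits)
  have mono: "strict_mono \<nu>" using F(2) by (intro strict_monoI_Suc) (simp add: \<nu>_def)
  have inj: "inj (\<lambda>j. - \<nu> j)"
    using strict_mono_imp_inj_on[OF mono] by (auto simp: inj_def)
  have \<delta>sum: "\<delta> sums 1" using power_half_series by (simp add: \<delta>_def[abs_def])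
  \<comment> \<open>\<open>Y j\<close> is close to the exponential of frequency
    \<open>\<nu> j\<close>, and the pairing multiplies opposite frequencies; hence the weight
    \<open>\<delta> j\<close> sits at \<open>- \<nu> j\<close>. The remaining entries of
    \<open>Y j\<close> sum to at most \<open>\<delta> j / 8\<close> and cannot cancel it.\<close>
  obtain f where f: "f \<in> L2" "\<And>k. norm (fc f k) \<le> pi" "\<And>j. fc f (- \<nu> j) = of_real (pi * \<delta> j)"
    using lacunary_series[OF _ inj _ \<delta>sum] g(2) \<delta>0 by (metis even_minus less_imp_le)
  obtain c where c: "(\<lambda>N. L2_norm (\<lambda>x. f x - (\<Sum>m<N. c m * u m x))) \<longlonglongrightarrow> 0"
    using basis f(1) unfolding schauder_basis_def by blast
  have sY: "(\<lambda>i. norm (Y j i)) summable_on A" for j A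
    using eigenvector.Y_summable[OF g(6)] summable_on_subset_banach by blast
  have pf: "norm (pairing (\<nu> j) (Y j) f) \<ge> 2 * \<delta> j" for j
  proof -
    define h where "h i = hat (\<nu> j) f i * Y j (\<nu> j - i)" for i
    have sh: "h summable_on A" "(\<lambda>i. norm (h i)) summable_on A" for A
      using pairing_summable[OF sY f(1)] summable_on_subset_banach unfolding h_def by blast+
    have "pairing (\<nu> j) (Y j) f = infsum h (insert 0 (UNIV - {0}))"
      unfolding pairing_def h_def by (simp add: insert_UNIV)
    also have "\<dots> = h 0 + infsum h (UNIV - {0})" by (rule infsum_insert[OF sh(1)]) simp
    also have "h 0 = of_real (pi * \<delta> j)" using g(4) f(3)[of j] by (simp add: h_def hat_def)
    finally have eq: "pairing (\<nu> j) (Y j) f = of_real (pi * \<delta> j) + infsum h (UNIV - {0})" .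
    have "norm (infsum h (UNIV - {0})) \<le> infsum (\<lambda>i. norm (h i)) (UNIV - {0})"
      by (rule norm_infsum_bound[OF sh(2)])
    also have "\<dots> \<le> infsum (\<lambda>i. pi * norm (Y j (\<nu> j - i))) (UNIV - {0})"
    proof (rule infsum_mono[OF sh(2)])
      show "(\<lambda>i. pi * norm (Y j (\<nu> j - i))) summable_on (UNIV - {0})"
        by (rule summable_on_cmult_right[OF summable_on_subset_banach[OF summable_on_reflect_int[OF sY]]]) simp
    qed (auto simp: h_def hat_def norm_mult intro!: mult_right_mono f)
    also have "\<dots> = pi * infsum (\<lambda>i. norm (Y j (\<nu> j - i))) (UNIV - {0})" by (rule infsum_cmult_right')
    also have "infsum (\<lambda>i. norm (Y j (\<nu> j - i))) (UNIV - {0}) = infsum (\<lambda>i. norm (Y j i)) (UNIV - {\<nu> j})"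
      by (rule infsum_reindex_bij_witness[of _ "\<lambda>i. \<nu> j - i" "\<lambda>i. \<nu> j - i"]) auto
    also have "pi * \<dots> \<le> pi * (\<delta> j / 8)" using g(5) by (intro mult_left_mono) auto
    finally have "norm (infsum h (UNIV - {0})) \<le> pi * (\<delta> j / 8)" .
    moreover have "norm (of_real (pi * \<delta> j) :: complex) = pi * \<delta> j"
      unfolding norm_of_real using \<delta>0[of j] by simp
    moreover have "norm (of_real (pi * \<delta> j) :: complex) - norm (infsum h (UNIV - {0})) \<le> norm (pairing (\<nu> j) (Y j) f)"
      unfolding eq by (rule norm_diff_ineq)
    moreover have "3 * \<delta> j \<le> pi * \<delta> j" using \<delta>0[of j] pi_gt3 by (intro mult_right_mono) auto
    moreover have "pi * (\<delta> j / 8) = (pi * \<delta> j) / 8" by simp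
    ultimately show ?thesis using \<delta>0[of j] by linarith
  qed
  \<comment> \<open>Since \<open>\<nu> j\<close> is not \<open>0\<close>, every product has a factor
    with index other than \<open>\<nu> j\<close>: the term \<open>i = \<nu> j\<close> contains
    \<open>Y j 0\<close>, every other term contains \<open>Y j i\<close>. Against the lower bound
    \<open>2 * \<delta> j\<close> for the pairing, this gives a projection coefficient of size at
    least \<open>8\<close>.\<close>
  have B_le: "norm (\<Sum>\<^sub>\<infinity>i. Y j i * Y j (\<nu> j - i)) \<le> \<delta> j / 4" for j
  proof -
    define h where "h i = Y j i * Y j (\<nu> j - i)" for i
    have le\<delta>: "norm (Y j i) \<le> \<delta> j / 8" if "i \<noteq> \<nu> j" for i
    proof -
      have "norm (Y j i) = infsum (\<lambda>i. norm (Y j i)) {i}" by simp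
      also have "\<dots> \<le> infsum (\<lambda>i. norm (Y j i)) (UNIV - {\<nu> j})"
        using that by (intro infsum_mono2 sY) auto
      finally show ?thesis using g(5)[of j] by linarith
    qed
    have le1: "norm (Y j i) \<le> 1" for i
      using le\<delta>[of i] g(4)[of j] \<delta>0[of j] by (cases "i = \<nu> j") auto
    have bY: "bounded (range (Y j))" using le1 by (auto simp: bounded_iff)
    have sh: "h summable_on A" "(\<lambda>i. norm (h i)) summable_on A" for A
      using summable_on_bounded_mult[OF bY summable_on_reflect_int[OF sY]] summable_on_subset_banach
      unfolding h_def by blast+
    have "infsum h UNIV = infsum h (insert (\<nu> j) (UNIV - {\<nu> j}))" by (simp add: insert_UNIV)
    also have "\<dots> = h (\<nu> j) + infsum h (UNIV - {\<nu> j})" by (rule infsum_insert[OF sh(1)]) simp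
    finally have "norm (infsum h UNIV) \<le> norm (h (\<nu> j)) + norm (infsum h (UNIV - {\<nu> j}))"
      by (simp add: norm_triangle_ineq)
    also have "norm (h (\<nu> j)) \<le> \<delta> j / 8" using le\<delta>[of 0] g(1)[of j] g(4)[of j] by (simp add: h_def)
    also have "norm (infsum h (UNIV - {\<nu> j})) \<le> infsum (\<lambda>i. norm (h i)) (UNIV - {\<nu> j})"
      by (rule norm_infsum_bound[OF sh(2)])
    also have "\<dots> \<le> infsum (\<lambda>i. norm (Y j i)) (UNIV - {\<nu> j})"
      using le1 by (intro infsum_mono sh sY) (auto simp: h_def norm_mult intro!: mult_left_le)
    also have "\<dots> \<le> \<delta> j / 8" by (rule g(5))
    finally show ?thesis by (simp add: h_def[abs_def])
  qed
  have "\<exists>m. pairing (\<nu> j) (Y j) (u m) \<noteq> 0 \<and> 1 \<le> norm (c m * fc (u m) (\<nu> j))" for j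
  proof -
    interpret eigenvector a b s "\<nu> j" "z j" "Y j" v by (rule g(6))
    define \<beta> where "\<beta> = (\<Sum>\<^sub>\<infinity>i. Y j i * Y j (\<nu> j - i))"
    have "pairing (\<nu> j) (Y j) f \<noteq> 0" using pf[of j] \<delta>0[of j] by auto
    then obtain m where m: "pairing (\<nu> j) (Y j) (u m) \<noteq> 0" "c m * fc (u m) (\<nu> j) * \<beta> = pairing (\<nu> j) (Y j) f * Y j (\<nu> j)"
      using basis_coefficient[OF basis root f(1) c] unfolding \<beta>_def by blast
    have "2 * \<delta> j \<le> norm (c m * fc (u m) (\<nu> j)) * norm \<beta>"
      using pf[of j] m(2) g(4)[of j] by (metis mult_1_right norm_mult)
    also have "\<dots> \<le> norm (c m * fc (u m) (\<nu> j)) * (\<delta> j / 4)"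
      unfolding \<beta>_def by (intro mult_left_mono B_le) auto
    finally have "8 \<le> norm (c m * fc (u m) (\<nu> j))"
      using \<delta>0[of j] by (simp add: field_simps)
    then show ?thesis using m(1) by (intro exI[of _ m]) auto
  qed
  then obtain m where m: "\<And>j. pairing (\<nu> j) (Y j) (u (m j)) \<noteq> 0" "\<And>j. 1 \<le> norm (c (m j) * fc (u (m j)) (\<nu> j))"
    by metis
  have inj_m: "inj m"
  proof (rule injI, rule ccontr)
    fix i j assume eq: "m i = m j" and "i \<noteq> j"
    obtain k where k: "u (m i) \<in> hill_ker v ((of_int (\<nu> i))\<^sup>2 + z i) k"
      using eigenvector.root_function_dichotomy(2)[OF g(6) u root m(1)] by blast
    have "(of_int (\<nu> i))\<^sup>2 + z i = (of_int (\<nu> j))\<^sup>2 + z j"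
      by (rule eigenvector.root_function_dichotomy(3)[OF g(6) u root m(1)[of j]]) (use k eq in simp)
    then have "of_int ((\<nu> i)\<^sup>2 - (\<nu> j)\<^sup>2) = z j - z i" by (simp add: algebra_simps)
    then have "norm (of_int ((\<nu> i)\<^sup>2 - (\<nu> j)\<^sup>2) :: complex) \<le> 2"
      using norm_triangle_ineq4[of "z j" "z i"] g(3)[of i] g(3)[of j] by simp
    then have le2: "\<bar>(\<nu> i)\<^sup>2 - (\<nu> j)\<^sup>2\<bar> \<le> 2" unfolding norm_of_int by linarith
    \<comment> \<open>Squares of distinct positive integers differ by at least \<open>3\<close>,
      while two shifts in the unit disc differ by at most \<open>2\<close>; so the eigenvalues are
      distinct and each basis element serves one \<open>j\<close>.\<close>
    have sq: "3 \<le> q\<^sup>2 - p\<^sup>2" if "0 < p" "p < q" for p q :: int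
    proof -
      have "(p + 1)\<^sup>2 \<le> q\<^sup>2" using that by (intro power_mono) auto
      then show ?thesis using that by (simp add: power2_sum)
    qed
    have "\<nu> i \<noteq> \<nu> j" using strict_mono_eq[OF mono] \<open>i \<noteq> j\<close> by simp
    then consider "\<nu> i < \<nu> j" | "\<nu> j < \<nu> i" by linarith
    then show False
      using sq[of "\<nu> i" "\<nu> j"] sq[of "\<nu> j" "\<nu> i"] g(1)[of i] g(1)[of j] le2 by cases linarith+
  qed
  define E where "E N x = f x - (\<Sum>m<N. c m * u m x)" for N x
  have E: "E N \<in> L2" for N
    using L2_add_scaled[OF f(1) L2_sum[where u = u and c = c and N = N, OF u], of "- 1"] by (simp add: E_def[abs_def])
  have fcE: "fc (E N) k = fc f k - (\<Sum>m<N. c m * fc (u m) k)" for N k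
    using fc_add_scaled[OF f(1) L2_sum[where u = u and c = c and N = N, OF u], of "- 1" k] fc_sum[where u = u and c = c and N = N and k = k, OF u]
    by (simp add: E_def[abs_def])
  \<comment> \<open>A term of the expansion is the difference of two consecutive remainders. With
    the constant \<open>3\<close> of \<open>fc_le\<close>, remainders below \<open>1 / 6\<close>
    keep its Fourier coefficients below \<open>1\<close>, so all the \<open>m j\<close> lie below
    \<open>N\<close>, contrary to injectivity.\<close>
  obtain N where N: "\<And>N'. N' \<ge> N \<Longrightarrow> L2_norm (E N') < 1 / 6"
    using order_tendstoD(2)[OF c, of "1 / 6"] unfolding E_def[abs_def] eventually_sequentially by auto
  have "m j < N" for j
  proof (rule ccontr)
    assume "\<not> m j < N"
    then have "L2_norm (E (m j)) < 1 / 6" "L2_norm (E (Suc (m j))) < 1 / 6" using N by auto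
    moreover have diff: "c (m j) * fc (u (m j)) (\<nu> j) = fc (E (m j)) (\<nu> j) - fc (E (Suc (m j))) (\<nu> j)"
      by (simp add: fcE)
    have "norm (c (m j) * fc (u (m j)) (\<nu> j)) \<le> 3 * L2_norm (E (m j)) + 3 * L2_norm (E (Suc (m j)))"
      using norm_triangle_ineq4[of "fc (E (m j)) (\<nu> j)" "fc (E (Suc (m j))) (\<nu> j)"] fc_le[OF E, of "m j" "\<nu> j"]
        fc_le[OF E, of "Suc (m j)" "\<nu> j"] unfolding diff by linarith
    ultimately show False using m(2)[of j] by linarith
  qed
  then have "range m \<subseteq> {..<N}" by auto
  then have "finite (range m)" using finite_subset by blast
  then have "finite (UNIV :: nat set)" using finite_imageD[OF _ inj_m] by blast
  then show False by simp
qed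

end
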